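(* Let $N\ge2$ and $\mu\in\mathbb{R}$ with $|\mu|>v_N$. Let $Y=(Y_1,\dots,Y_N)$ be a one-dimensional Brownian Bee system with drift $\mu$, started from an arbitrary initial condition, ordered so that $Y_1(t)\le\dots\le Y_N(t)$. Then almost surely $$\lim_{t\to\infty}\frac{Y_1(t)}{t}=\Big(1-\frac{v_N}{|\mu|}\Big)\mu .$$
   Context: Brunet–Derrida system in $\mathbb{R}$ with $N\ge2$ particles, score function $s:\mathbb{R}\to\mathbb{R}$ and drift $\mu\in\mathbb{R}$: let $(J_i)_{i\ge0}$ ($J_0=0$) be the jump times of a Poisson process of rate $N$, $(K_i)_{i\ge1}$ i.i.d. uniform on $\{1,\dots,N\}$, and independent standard Brownian motions, all mutually independent. Between jump times each particle moves as an independent Brownian motion with drift $\mu$ (i.e. $B(t)+\mu t$). At each time $J_i$, the particle with minimal score $s(Y_n(J_i^-))$ (ties broken arbitrarily) is removed and replaced by a copy of the particle $Y_{K_i}(J_i^-)$ (equivalently, the minimal-score particle jumps to the position $Y_{K_i}(J_i^-)$; if it is that same particle nothing happens). At all times particles are relabelled so that $Y_1(t)\le\dots\le Y_N(t)$. An N-BBM (killing from the left) is the case $s(x)=x$, $\mu=0$. A one-dimensional Brownian Bee system with drift $\mu$ is the case $s(x)=-|x|$ (the particle furthest from the origin is removed). It is a known fact (cited in the paper) that for an N-BBM, for any initial condition, $X_1(t)/t\to v_N$ almost surely as $t\to\infty$, where $v_N>0$ is a deterministic constant depending only on $N$, called the asymptotic speed of the N-BBM. *)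

theory Defs
  imports "HOL-Probability.Probability"
begin

definition is_std_BM :: "'a measure \<Rightarrow> (real \<Rightarrow> 'a \<Rightarrow> real) \<Rightarrow> bool" where
  "is_std_BM M W \<longleftrightarrow>
     (\<forall>t. W t \<in> borel_measurable M) \<and>
     (\<forall>\<omega>\<in>space M. W 0 \<omega> = 0) \<and>
     (AE \<omega> in M. continuous_on {0..} (\<lambda>t. W t \<omega>)) \<and>
     (\<forall>s t. 0 \<le> s \<longrightarrow> s < t \<longrightarrow>
        distributed M lborel (\<lambda>\<omega>. W t \<omega> - W s \<omega>) (normal_density 0 (sqrt (t - s)))) \<and>
     (\<forall>ts. sorted_wrt (<) ts \<longrightarrow> (\<forall>t\<in>set ts. 0 \<le> t) \<longrightarrow>
        prob_space.indep_vars M (\<lambda>_. borel) (\<lambda>i \<omega>. W (ts ! Suc i) \<omega> - W (ts ! i) \<omega>)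
          {..<length ts - 1})"

definition gen_sets :: "'a measure \<Rightarrow> 'b measure \<Rightarrow> ('a \<Rightarrow> 'b) \<Rightarrow> 'a set set" where
  "gen_sets M N X = {X -` A \<inter> space M | A. A \<in> sets N}"

definition gen_sets_proc :: "'a measure \<Rightarrow> (real \<Rightarrow> 'a \<Rightarrow> real) \<Rightarrow> 'a set set" where
  "gen_sets_proc M W = sigma_sets (space M) (\<Union>t\<in>{0..}. gen_sets M borel (W t))"

text \<open>Randomness of a Brunet--Derrida system with N particles:
  J i = i-th jump time of a rate-N Poisson process (J 0 = 0, i.i.d. Exp(N) gaps),
  K i (i \<ge> 1) i.i.d. uniform on {1..N}, B n (n \<in> {1..N}) standard Brownian motions,
  all mutually independent.
  Index encoding: Inl i = i-th gap J (i+1) - J i; Inr (Inl i) = K (i+1); Inr (Inr n) = B n.\<close>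
definition bd_ingredients ::
  "'a measure \<Rightarrow> nat \<Rightarrow> (nat \<Rightarrow> 'a \<Rightarrow> real) \<Rightarrow> (nat \<Rightarrow> 'a \<Rightarrow> nat)
     \<Rightarrow> (nat \<Rightarrow> real \<Rightarrow> 'a \<Rightarrow> real) \<Rightarrow> bool" where
  "bd_ingredients M N J K B \<longleftrightarrow>
     prob_space M \<and>
     (\<forall>\<omega>\<in>space M. J 0 \<omega> = 0) \<and>
     (\<forall>i. distributed M lborel (\<lambda>\<omega>. J (Suc i) \<omega> - J i \<omega>) (exponential_density (real N))) \<and>
     (\<forall>i. K (Suc i) \<in> measurable M (count_space UNIV) \<and>
          distr M (count_space UNIV) (K (Suc i)) = measure_pmf (pmf_of_set {1..N})) \<and>
     (\<forall>n\<in>{1..N}. is_std_BM M (B n)) \<and>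
     prob_space.indep_sets M
       (\<lambda>x. case x of
              Inl i \<Rightarrow> gen_sets M borel (\<lambda>\<omega>. J (Suc i) \<omega> - J i \<omega>)
            | Inr (Inl i) \<Rightarrow> gen_sets M (count_space UNIV) (K (Suc i))
            | Inr (Inr n) \<Rightarrow> gen_sets_proc M (B n))
       (range Inl \<union> range (Inr \<circ> Inl) \<union> (Inr \<circ> Inr) ` {1..N})"

text \<open>Pathwise dynamics (for one sample point \<omega>) of a Brunet--Derrida system with
  N particles, score s, drift mu, initial positions x0, driven by J, K, B.
  Particles carry fixed labels 1..N (particle n driven by B n); X t n is the
  position of particle n at time t.  Between jumps particles follow B n + mu t;
  at J (i+1) a particle m of minimal score (any minimiser: arbitrary tie-breaking)
  jumps to the pre-jump position of particle K (i+1).\<close>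
definition bd_path ::
  "nat \<Rightarrow> (real \<Rightarrow> real) \<Rightarrow> real \<Rightarrow> (nat \<Rightarrow> 'a \<Rightarrow> real) \<Rightarrow> (nat \<Rightarrow> 'a \<Rightarrow> nat)
     \<Rightarrow> (nat \<Rightarrow> real \<Rightarrow> 'a \<Rightarrow> real) \<Rightarrow> (nat \<Rightarrow> real) \<Rightarrow> 'a \<Rightarrow> (real \<Rightarrow> nat \<Rightarrow> real) \<Rightarrow> bool" where
  "bd_path N s mu J K B x0 \<omega> X \<longleftrightarrow>
     (\<forall>n\<in>{1..N}. X 0 n = x0 n) \<and>
     (\<forall>i t. J i \<omega> \<le> t \<longrightarrow> t < J (Suc i) \<omega> \<longrightarrow>
        (\<forall>n\<in>{1..N}. X t n = X (J i \<omega>) n + (B n t \<omega> - B n (J i \<omega>) \<omega>) + mu * (t - J i \<omega>))) \<and>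
     (\<forall>i. let p = (\<lambda>n. X (J i \<omega>) n + (B n (J (Suc i) \<omega>) \<omega> - B n (J i \<omega>) \<omega>)
                        + mu * (J (Suc i) \<omega> - J i \<omega>))
          in \<exists>m\<in>{1..N}. (\<forall>n\<in>{1..N}. s (p m) \<le> s (p n)) \<and>
               (\<forall>n\<in>{1..N}. X (J (Suc i) \<omega>) n = (if n = m then p (K (Suc i) \<omega>) else p n)))"

definition leftmost :: "nat \<Rightarrow> (real \<Rightarrow> nat \<Rightarrow> real) \<Rightarrow> real \<Rightarrow> real" where
  "leftmost N X t = Min ((\<lambda>n. X t n) ` {1..N})"

definition is_NBBM_speed :: "'a measure \<Rightarrow> nat \<Rightarrow> real \<Rightarrow> bool" where
  "is_NBBM_speed M N v \<longleftrightarrow>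
     (\<forall>J K B x0 X. bd_ingredients M N J K B \<longrightarrow>
        (AE \<omega> in M. bd_path N (\<lambda>x. x) 0 J K B x0 \<omega> (X \<omega>)) \<longrightarrow>
        (AE \<omega> in M. ((\<lambda>t. leftmost N (X \<omega>) t / t) \<longlongrightarrow> v) at_top))"

end

theory Submission
  imports Defs "HOL-Combinatorics.Permutations"
begin

text \<open>
  By reflection it suffices to treat a drift to the left with \<open>v + mu < 0\<close>. Run the Bee system
  together with an N-BBM with drift, both driven by the same Brownian increments, with the
  particles of the second system renamed at each jump: if the Bee system kills \<open>m\<close> and the N-BBM
  kills \<open>m'\<close>, then \<open>m\<close> and \<open>m'\<close> exchange their names in the N-BBM. Whatever particle the Bee
  system kills, this keeps every N-BBM particle above its partner, so the Bee system is eventually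
  negative. From then on it kills its leftmost particle, and the distances between partners no
  longer increase; hence both systems have the same speed.

  In its own labels the second system is an N-BBM for permuted driving noise. The pieces of noise
  between consecutive jumps are independent and identically distributed, and the permutation used
  on each piece depends only on earlier pieces, so the permuted noise has the original law and the
  speed \<open>v\<close> is available. Ties in the Bee system have probability zero, which makes its killed
  labels measurable functions of the noise. That the rightmost particle of an N-BBM also has speed
  \<open>v\<close> follows from laws of large numbers: up to errors \<open>o(t)\<close>, the particle that is rightmost
  at time \<open>t\<close> either becomes the leftmost one and is killed before time \<open>(1 + e) t\<close>, or is chosen as
  a parent so often that all others jump to it.
\<close>

subsection \<open>Independence\<close>

text \<open>The speed \<open>v\<close> is only known for N-BBMs whose noise satisfies
  \<open>bd_ingredients\<close> on the given space \<open>M\<close>; a copy on another space would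
  be of no use. So the comparison system is built on \<open>M\<close> out of the given noise, and
  its renamed noise must meet every clause of that definition. The names cannot be fixed in advance:
  the exchange at a jump depends on the positions, hence on the past. This is why the noise is cut
  into excursions, whose law no permutation of the labels changes. The exchange is forced by the
  case where the Bee system kills a particle far from the leftmost one of the N-BBM. The Bee
  particle \<open>m\<close> may then jump upwards, past its partner, which stays where it is.
  Handing the name \<open>m\<close> to the particle newly born in the N-BBM repairs this, and the
  old partner takes over the name \<open>m'\<close>, where it is higher than the particle that was
  killed. Both extremes of the N-BBM are needed: the rightmost particle decides when the whole Bee
  system is negative, and reflection turns a statement about the leftmost particle into one about
  the rightmost.\<close>

lemma (in prob_space) indep_vars_transfer_law:
  assumes X: "X \<in> measurable M S" and Y: "Y \<in> measurable M S"
    and law: "distr M S X = distr M S Y"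
    and f: "\<And>i. i \<in> I \<Longrightarrow> f i \<in> measurable S (T i)"
    and ind: "indep_vars T (\<lambda>i \<omega>. f i (X \<omega>)) I"
  shows "indep_vars T (\<lambda>i \<omega>. f i (Y \<omega>)) I"
proof -
  have *: "prob {\<omega> \<in> space M. \<forall>j\<in>J. f j (X \<omega>) \<in> A j} = prob {\<omega> \<in> space M. \<forall>j\<in>J. f j (Y \<omega>) \<in> A j}"
    if "finite J" "J \<subseteq> I" "\<And>j. j \<in> J \<Longrightarrow> A j \<in> sets (T j)" for J A
  proof -
    let ?C = "{s \<in> space S. \<forall>j\<in>J. f j s \<in> A j}"
    have C: "?C \<in> sets S"
    proof (rule sets.sets_Collect_finite_All[OF _ that(1)])
      fix j assume "j \<in> J"
      then show "{s \<in> space S. f j s \<in> A j} \<in> sets S"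
        using measurable_sets[OF f, of j "A j"] that by (auto simp: vimage_def Int_def conj_commute)
    qed
    have "prob (X -` ?C \<inter> space M) = prob (Y -` ?C \<inter> space M)"
      using arg_cong[OF law, of "\<lambda>m. measure m ?C"] X Y C by (simp add: measure_distr)
    moreover have "X -` ?C \<inter> space M = {\<omega> \<in> space M. \<forall>j\<in>J. f j (X \<omega>) \<in> A j}"
      using measurable_space[OF X] by auto
    moreover have "Y -` ?C \<inter> space M = {\<omega> \<in> space M. \<forall>j\<in>J. f j (Y \<omega>) \<in> A j}"
      using measurable_space[OF Y] by auto
    ultimately show ?thesis by simp
  qed
  show ?thesis
    unfolding indep_vars_def2
  proof (intro conjI ballI indep_setsI)
    fix i assume "i \<in> I"
    then show "random_variable (T i) (\<lambda>\<omega>. f i (Y \<omega>))"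
      using f Y by (auto intro: measurable_compose)
    then show "{(\<lambda>\<omega>. f i (Y \<omega>)) -` A \<inter> space M |A. A \<in> sets (T i)} \<subseteq> events"
      by (auto intro: measurable_sets)
  next
    fix A J assume J: "J \<noteq> {}" "J \<subseteq> I" "finite J"
      and "\<forall>j\<in>J. A j \<in> {(\<lambda>\<omega>. f j (Y \<omega>)) -` A \<inter> space M |A. A \<in> sets (T j)}"
    then have "\<forall>j\<in>J. \<exists>C. A j = (\<lambda>\<omega>. f j (Y \<omega>)) -` C \<inter> space M \<and> C \<in> sets (T j)" by auto
    then obtain C where C: "\<And>j. j \<in> J \<Longrightarrow> A j = (\<lambda>\<omega>. f j (Y \<omega>)) -` C j \<inter> space M"
        "\<And>j. j \<in> J \<Longrightarrow> C j \<in> sets (T j)" by metis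
    have "prob (\<Inter> (A ` J)) = prob {\<omega> \<in> space M. \<forall>j\<in>J. f j (Y \<omega>) \<in> C j}"
      using C J by (intro arg_cong[where f=prob]) auto
    also have "\<dots> = prob {\<omega> \<in> space M. \<forall>j\<in>J. f j (X \<omega>) \<in> C j}"
      using *[of J C] J C by simp
    also have "\<dots> = prob (\<Inter>j\<in>J. (\<lambda>\<omega>. f j (X \<omega>)) -` C j \<inter> space M)"
      using J by (intro arg_cong[where f=prob]) auto
    also have "\<dots> = (\<Prod>j\<in>J. prob ((\<lambda>\<omega>. f j (X \<omega>)) -` C j \<inter> space M))"
      using J C by (intro indep_varsD[OF ind]) auto
    also have "\<dots> = (\<Prod>j\<in>J. prob (A j))"
    proof (rule prod.cong[OF refl])
      fix j assume j: "j \<in> J"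
      have "prob ((\<lambda>\<omega>. f j (X \<omega>)) -` C j \<inter> space M) = prob {\<omega> \<in> space M. \<forall>i\<in>{j}. f i (X \<omega>) \<in> C i}"
        by (intro arg_cong[where f=prob]) auto
      also have "\<dots> = prob {\<omega> \<in> space M. \<forall>i\<in>{j}. f i (Y \<omega>) \<in> C i}"
        using j J C by (intro *) auto
      also have "\<dots> = prob (A j)"
        using C j by (intro arg_cong[where f=prob]) auto
      finally show "prob ((\<lambda>\<omega>. f j (X \<omega>)) -` C j \<inter> space M) = prob (A j)" .
    qed
    finally show "prob (\<Inter> (A ` J)) = (\<Prod>j\<in>J. prob (A j))" .
  qed
qed

text \<open>Injectivity matters because a product over a finite set of old indices must become a
  product over their images without merging factors.\<close>

lemma (in prob_space) indep_vars_reindex: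
  assumes ind: "indep_vars M' X (f ` I)" and inj: "inj_on f I"
  shows "indep_vars (\<lambda>i. M' (f i)) (\<lambda>i. X (f i)) I"
  unfolding indep_vars_def2
proof (intro conjI ballI indep_setsI)
  fix i assume i: "i \<in> I"
  then show "random_variable (M' (f i)) (X (f i))"
    using ind by (auto simp: indep_vars_def2)
  then show "{X (f i) -` A \<inter> space M |A. A \<in> sets (M' (f i))} \<subseteq> events"
    by (auto intro: measurable_sets)
next
  fix A J assume J: "J \<noteq> {}" "J \<subseteq> I" "finite J"
    and "\<forall>j\<in>J. A j \<in> {X (f j) -` A \<inter> space M |A. A \<in> sets (M' (f j))}"
  then have "\<forall>j\<in>J. \<exists>C. A j = X (f j) -` C \<inter> space M \<and> C \<in> sets (M' (f j))" by auto
  then obtain C where C: "\<And>j. j \<in> J \<Longrightarrow> A j = X (f j) -` C j \<inter> space M"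
      "\<And>j. j \<in> J \<Longrightarrow> C j \<in> sets (M' (f j))" by metis
  have injJ: "inj_on f J" using inj J inj_on_subset by blast
  let ?D = "\<lambda>x. C (the_inv_into J f x)"
  have D: "?D (f j) = C j" if "j \<in> J" for j
    using the_inv_into_f_f[OF injJ that] by simp
  have "prob (\<Inter> (A ` J)) = prob (\<Inter>x\<in>f ` J. X x -` ?D x \<inter> space M)"
    using C D by (intro arg_cong[where f=prob]) auto
  also have "\<dots> = (\<Prod>x\<in>f ` J. prob (X x -` ?D x \<inter> space M))"
    using J C D by (intro indep_varsD[OF ind]) auto
  also have "\<dots> = (\<Prod>j\<in>J. prob (A j))"
    using C D by (simp add: prod.reindex[OF injJ])
  finally show "prob (\<Inter> (A ` J)) = (\<Prod>j\<in>J. prob (A j))" .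
qed

lemma sigma_sets_vimage_PiM:
  assumes Z: "Z \<in> measurable M (PiM L U)"
  shows "sigma_sets (space M) {Z -` A \<inter> space M |A. A \<in> sets (PiM L U)}
      = sigma_sets (space M) {Z -` A \<inter> space M |A. A \<in> prod_algebra L U}"
proof -
  have "Z \<in> space M \<rightarrow> (\<Pi>\<^sub>E i\<in>L. space (U i))" using measurable_space[OF Z] by (auto simp: space_PiM)
  from sigma_sets_vimage_commute[OF this, of "prod_algebra L U"]
  have "{Z -` A \<inter> space M |A. A \<in> sets (PiM L U)} = sigma_sets (space M) {Z -` A \<inter> space M |A. A \<in> prod_algebra L U}"
    unfolding sets_PiM .
  then show ?thesis
    using sigma_sets_sigma_sets_eq[of "{Z -` A \<inter> space M |A. A \<in> prod_algebra L U}" "space M"] by auto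
qed

lemma Int_stable_vimage_prod_algebra: "Int_stable {Z -` A \<inter> \<Omega> |A. A \<in> prod_algebra L U}"
proof (safe intro!: Int_stableI)
  fix A B assume "A \<in> prod_algebra L U" "B \<in> prod_algebra L U"
  then have "A \<inter> B \<in> prod_algebra L U" using Int_stable_prod_algebra by (auto simp: Int_stable_def)
  then show "\<exists>C. Z -` A \<inter> \<Omega> \<inter> (Z -` B \<inter> \<Omega>) = Z -` C \<inter> \<Omega> \<and> C \<in> prod_algebra L U"
    by (intro exI[of _ "A \<inter> B"]) auto
qed

lemma vimage_prod_emb:
  assumes "Z \<in> measurable M (PiM L U)" "J \<subseteq> L"
  shows "Z -` prod_emb L U J (Pi\<^sub>E J E) \<inter> space M = {\<omega> \<in> space M. \<forall>j\<in>J. Z \<omega> j \<in> E j}"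
  using measurable_space[OF assms(1)] assms(2)
  by (auto simp: prod_emb_def space_PiM PiE_iff restrict_def extensional_def)

text \<open>Preimages of finite-dimensional cylinders form a pi-system that generates the
  sigma-algebra of a product-valued variable, so the product rule for finitely many coordinates on
  either side suffices. It is applied to whole paths, whose index set is uncountable.\<close>

lemma (in prob_space) indep_var_PiM_I:
  assumes X: "X \<in> measurable M (PiM I S)" and Y: "Y \<in> measurable M (PiM I' T)"
    and rect: "\<And>J J' A A'. finite J \<Longrightarrow> J \<subseteq> I \<Longrightarrow> finite J' \<Longrightarrow> J' \<subseteq> I' \<Longrightarrow>
      (\<And>j. j \<in> J \<Longrightarrow> A j \<in> sets (S j)) \<Longrightarrow> (\<And>j. j \<in> J' \<Longrightarrow> A' j \<in> sets (T j)) \<Longrightarrow>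
      prob ({\<omega> \<in> space M. \<forall>j\<in>J. X \<omega> j \<in> A j} \<inter> {\<omega> \<in> space M. \<forall>j\<in>J'. Y \<omega> j \<in> A' j}) =
      prob {\<omega> \<in> space M. \<forall>j\<in>J. X \<omega> j \<in> A j} * prob {\<omega> \<in> space M. \<forall>j\<in>J'. Y \<omega> j \<in> A' j}"
  shows "indep_var (PiM I S) X (PiM I' T) Y"
proof -
  have "indep_set {X -` A \<inter> space M |A. A \<in> prod_algebra I S} {Y -` A \<inter> space M |A. A \<in> prod_algebra I' T}"
    unfolding indep_sets2_eq
  proof (intro conjI ballI)
    show "{X -` A \<inter> space M |A. A \<in> prod_algebra I S} \<subseteq> events"
      using measurable_sets[OF X] by (auto simp: sets_PiM)
    show "{Y -` A \<inter> space M |A. A \<in> prod_algebra I' T} \<subseteq> events"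
      using measurable_sets[OF Y] by (auto simp: sets_PiM)
    fix a b assume "a \<in> {X -` A \<inter> space M |A. A \<in> prod_algebra I S}" "b \<in> {Y -` A \<inter> space M |A. A \<in> prod_algebra I' T}"
    then obtain A B where a: "a = X -` A \<inter> space M" "A \<in> prod_algebra I S"
      and b: "b = Y -` B \<inter> space M" "B \<in> prod_algebra I' T" by auto
    from prod_algebraE[OF a(2)] obtain J E where J: "A = prod_emb I S J (Pi\<^sub>E J E)"
      "finite J" "J \<subseteq> I" "\<And>i. i \<in> J \<Longrightarrow> E i \<in> sets (S i)" by metis
    from prod_algebraE[OF b(2)] obtain J' E' where J': "B = prod_emb I' T J' (Pi\<^sub>E J' E')"
      "finite J'" "J' \<subseteq> I'" "\<And>i. i \<in> J' \<Longrightarrow> E' i \<in> sets (T i)" by metis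
    show "prob (a \<inter> b) = prob a * prob b"
      unfolding a(1) b(1) J(1) J'(1) vimage_prod_emb[OF X J(3)] vimage_prod_emb[OF Y J'(3)]
      using J J' by (intro rect) auto
  qed
  from indep_set_sigma_sets[OF this Int_stable_vimage_prod_algebra Int_stable_vimage_prod_algebra]
  show ?thesis
    unfolding indep_var_eq sigma_sets_vimage_PiM[OF X] sigma_sets_vimage_PiM[OF Y] using X Y by simp
qed

subsection \<open>Brownian motion as a random path\<close>

text \<open>The set of continuous functions is not measurable in this product sigma-algebra.
  Continuity is therefore carried along as an almost sure property and never as part of the
  space.\<close>

definition Path :: "(real \<Rightarrow> real) measure" where
  "Path = PiM {0..} (\<lambda>_. borel)"

text \<open>The restriction makes the path an element of the product space and drops negative times,
  about which \<open>is_std_BM\<close> says nothing beyond measurability.\<close>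

definition traj :: "(real \<Rightarrow> 'a \<Rightarrow> real) \<Rightarrow> 'a \<Rightarrow> real \<Rightarrow> real" where
  "traj W \<omega> = (\<lambda>t\<in>{0..}. W t \<omega>)"

lemma space_Path: "space Path = extensional {0..}"
  by (simp add: Path_def space_PiM PiE_def)

lemma measurable_traj:
  assumes "\<And>t. t \<ge> 0 \<Longrightarrow> W t \<in> borel_measurable M"
  shows "traj W \<in> measurable M Path"
  unfolding traj_def Path_def using assms by (intro measurable_restrict) auto

text \<open>At a negative time every extensional function has the same value
  \<open>undefined\<close>, so evaluation is constant there. Having no side condition on
  \<open>t\<close> keeps later measurability goals automatic.\<close>

lemma measurable_Path_component [measurable (raw)]:
  assumes f: "f \<in> measurable M Path"
  shows "(\<lambda>\<omega>. f \<omega> t) \<in> borel_measurable M"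
proof (cases "t \<ge> 0")
  case True
  then show ?thesis
    using measurable_component_singleton[of t "{0..}" "\<lambda>_. borel"] f
    by (auto simp: Path_def intro: measurable_compose)
next
  case False
  then have "f \<omega> t = undefined" if "\<omega> \<in> space M" for \<omega>
    using measurable_space[OF f that] by (auto simp: space_Path extensional_def)
  then show ?thesis by (subst measurable_cong) auto
qed

lemma measurable_Path_I:
  assumes "\<And>t. t \<ge> 0 \<Longrightarrow> (\<lambda>\<omega>. f \<omega> t) \<in> borel_measurable M"
  shows "(\<lambda>\<omega>. \<lambda>t\<in>{0..}. f \<omega> t) \<in> measurable M Path"
  unfolding Path_def using assms by (intro measurable_restrict) auto

text \<open>Evaluation of a path at a real time is not measurable in the pair (path, time) on the
  product space; this limit along dyadic times is, and it agrees with evaluation on continuous paths.\<close>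

definition evalp :: "(real \<Rightarrow> real) \<Rightarrow> real \<Rightarrow> real" where
  "evalp p s = lim (\<lambda>k. p (max 0 (real_of_int \<lceil>2 ^ k * s\<rceil> / 2 ^ k)))"

lemma measurable_evalp [measurable (raw)]:
  assumes f [measurable]: "f \<in> measurable M Path" and T [measurable]: "T \<in> borel_measurable M"
  shows "(\<lambda>\<omega>. evalp (f \<omega>) (T \<omega>)) \<in> borel_measurable M"
  unfolding evalp_def
proof (rule borel_measurable_lim_metric)
  fix k :: nat
  have "(\<lambda>\<omega>. (\<lambda>i \<omega>. f \<omega> (max 0 (real_of_int i / 2 ^ k))) \<lceil>2 ^ k * T \<omega>\<rceil> \<omega>) \<in> borel_measurable M"
    by (rule measurable_compose_countable) measurable
  then show "(\<lambda>\<omega>. f \<omega> (max 0 (real_of_int \<lceil>2 ^ k * T \<omega>\<rceil> / 2 ^ k))) \<in> borel_measurable M" by simp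
qed

lemma dyadic_ceiling_tendsto: "(\<lambda>k. real_of_int \<lceil>2 ^ k * s\<rceil> / 2 ^ k) \<longlonglongrightarrow> s"
proof (rule tendsto_sandwich[where f="\<lambda>_. s" and h="\<lambda>k. s + (1/2) ^ k"])
  show "\<forall>\<^sub>F k in sequentially. s \<le> real_of_int \<lceil>2 ^ k * s\<rceil> / 2 ^ k"
    by (intro always_eventually allI) (simp add: pos_le_divide_eq mult.commute)
  have "real_of_int \<lceil>2 ^ k * s\<rceil> / 2 ^ k \<le> s + (1/2) ^ k" for k
  proof -
    have "real_of_int \<lceil>2 ^ k * s\<rceil> \<le> 2 ^ k * s + 1" by linarith
    then show ?thesis by (simp add: field_simps power_divide)
  qed
  then show "\<forall>\<^sub>F k in sequentially. real_of_int \<lceil>2 ^ k * s\<rceil> / 2 ^ k \<le> s + (1/2) ^ k" by simp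
  have "(\<lambda>k. s + (1/2::real) ^ k) \<longlonglongrightarrow> s + 0"
    by (intro tendsto_intros LIMSEQ_power_zero) auto
  then show "(\<lambda>k. s + (1/2) ^ k) \<longlonglongrightarrow> s" by simp
qed simp

lemma evalp_eq:
  assumes "continuous_on {0..} p" "s \<ge> 0"
  shows "evalp p s = p s"
proof -
  have "(\<lambda>k. max 0 (real_of_int \<lceil>2 ^ k * s\<rceil> / 2 ^ k)) \<longlonglongrightarrow> max 0 s"
    by (intro tendsto_intros dyadic_ceiling_tendsto)
  then have "(\<lambda>k. p (max 0 (real_of_int \<lceil>2 ^ k * s\<rceil> / 2 ^ k))) \<longlonglongrightarrow> p s"
    using assms by (intro continuous_on_tendsto_compose[OF assms(1)]) auto
  then show ?thesis unfolding evalp_def by (rule limI)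
qed

lemma continuous_traj: "continuous_on {0..} (traj W \<omega>) \<longleftrightarrow> continuous_on {0..} (\<lambda>t. W t \<omega>)"
  unfolding traj_def by (intro continuous_on_cong) auto

lemma is_std_BM_D:
  assumes "is_std_BM M W"
  shows "W t \<in> borel_measurable M" "\<omega> \<in> space M \<Longrightarrow> W 0 \<omega> = 0"
    "AE \<omega> in M. continuous_on {0..} (\<lambda>t. W t \<omega>)"
    "0 \<le> s \<Longrightarrow> s < t \<Longrightarrow> distributed M lborel (\<lambda>\<omega>. W t \<omega> - W s \<omega>) (normal_density 0 (sqrt (t - s)))"
    "sorted_wrt (<) ts \<Longrightarrow> (\<And>t. t \<in> set ts \<Longrightarrow> 0 \<le> t) \<Longrightarrow>
      prob_space.indep_vars M (\<lambda>_. borel) (\<lambda>i \<omega>. W (ts ! Suc i) \<omega> - W (ts ! i) \<omega>) {..<length ts - 1}"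
  using assms unfolding is_std_BM_def by blast+

lemma is_std_BM_traj: "is_std_BM M W \<Longrightarrow> traj W \<in> measurable M Path"
  by (intro measurable_traj is_std_BM_D)

text \<open>Along one increasing list that contains 0, every value of the path at a time in
  \<open>F\<close> is a partial sum of increments. The time 1 is thrown in so that there is at least
  one increment, since the description of independence by a product measure asks for a nonempty
  index set.\<close>

lemma time_grid:
  fixes F :: "real set"
  assumes "finite F" "F \<subseteq> {0..}"
  obtains ts k where "sorted_wrt (<) ts" "\<And>t. t \<in> set ts \<Longrightarrow> 0 \<le> t" "length ts \<ge> 2"
    "ts ! 0 = 0" "\<And>t. t \<in> F \<Longrightarrow> k t < length ts \<and> ts ! k t = t"
    "\<And>s t. s \<in> F \<Longrightarrow> t \<in> F \<Longrightarrow> s \<le> t \<Longrightarrow> k s \<le> k t"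
proof -
  define ts where "ts = sorted_list_of_set (insert 0 (insert 1 F))"
  define k where "k t = (SOME i. i < length ts \<and> ts ! i = t)" for t
  have fin: "finite (insert 0 (insert 1 F))" using assms by simp
  have set: "set ts = insert 0 (insert 1 F)" unfolding ts_def by (rule set_sorted_list_of_set[OF fin])
  have srt: "sorted_wrt (<) ts" unfolding ts_def by (rule strict_sorted_list_of_set)
  have len: "length ts = card (insert 0 (insert 1 F))" unfolding ts_def by (rule length_sorted_list_of_set)
  have "card {0, 1::real} \<le> length ts" unfolding len using fin by (intro card_mono) auto
  then have len2: "length ts \<ge> 2" by simp
  have k: "k t < length ts \<and> ts ! k t = t" if "t \<in> F" for t
  proof -
    have "t \<in> set ts" using that set by auto
    then show ?thesis unfolding k_def by (intro someI_ex[of "\<lambda>i. i < length ts \<and> ts ! i = t"]) (simp add: in_set_conv_nth)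
  qed
  have mono: "k s \<le> k t" if "s \<in> F" "t \<in> F" "s \<le> t" for s t
  proof (rule ccontr)
    assume "\<not> k s \<le> k t"
    then have "ts ! k t < ts ! k s" using srt k[OF that(1)] by (intro sorted_wrt_nth_less[OF srt]) auto
    then show False using k[OF that(1)] k[OF that(2)] that(3) by simp
  qed
  have "0 \<in> set ts" using set by simp
  then obtain i where i: "i < length ts" "ts ! i = 0" by (auto simp: in_set_conv_nth)
  have pos: "0 \<le> t" if "t \<in> set ts" for t using that set assms by auto
  have "ts ! 0 = 0"
  proof (cases "i = 0")
    case False
    then have "ts ! 0 < ts ! i" using srt i by (intro sorted_wrt_nth_less[OF srt]) auto
    moreover have "0 \<le> ts ! 0" using len2 by (intro pos nth_mem) auto
    ultimately show ?thesis using i by simp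
  qed (use i in simp)
  from that[OF srt pos len2 this k mono] show thesis .
qed

lemma increments_telescope:
  fixes f :: "real \<Rightarrow> real"
  shows "a \<le> b \<Longrightarrow> (\<Sum>i=a..<b. f (ts ! Suc i) - f (ts ! i)) = f (ts ! b) - f (ts ! a)"
  by (rule sum_Suc_diff')

text \<open>A measure on the path space is determined by its cylinders. A cylinder event is an event
  \<open>?C\<close> about partial sums of grid increments, and the joint law of these increments is
  a product of Gaussian laws in which only the grid enters.\<close>

lemma (in prob_space) std_BM_law_unique:
  assumes W: "is_std_BM M W" and V: "is_std_BM M V"
  shows "distr M Path (traj W) = distr M Path (traj V)"
  unfolding Path_def
proof (rule measure_eqI_PiM_infinite)
  note meas = is_std_BM_traj[OF W, unfolded Path_def] is_std_BM_traj[OF V, unfolded Path_def]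
  show "finite_measure (distr M (Pi\<^sub>M {0..} (\<lambda>_. borel)) (traj W))"
    using meas by (intro finite_measure_distr) auto
  fix A and J :: "real set" assume J: "finite J" "J \<subseteq> {0..}" "\<And>i. i \<in> J \<Longrightarrow> A i \<in> sets (borel :: real measure)"
  obtain ts k where ts: "sorted_wrt (<) ts" "\<And>t. t \<in> set ts \<Longrightarrow> 0 \<le> t"
      "length ts \<ge> 2" "ts ! 0 = 0" "\<And>t. t \<in> J \<Longrightarrow> k t < length ts \<and> ts ! k t = t"
      "\<And>s t. s \<in> J \<Longrightarrow> t \<in> J \<Longrightarrow> s \<le> t \<Longrightarrow> k s \<le> k t"
    by (rule time_grid[OF J(1,2)]) blast
  let ?n = "length ts - 1"
  let ?D = "\<lambda>U \<omega>. \<lambda>i\<in>{..<?n}. U (ts ! Suc i) \<omega> - U (ts ! i) \<omega>"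
  let ?C = "{d \<in> space (PiM {..<?n} (\<lambda>_. borel)). \<forall>j\<in>J. (\<Sum>i<k j. d i) \<in> A j}"
  have C: "?C \<in> sets (PiM {..<?n} (\<lambda>_. borel :: real measure))"
  proof (rule sets.sets_Collect_finite_All[OF _ J(1)])
    fix j assume j: "j \<in> J"
    have "(\<lambda>d. \<Sum>i<k j. d i) \<in> borel_measurable (PiM {..<?n} (\<lambda>_. borel :: real measure))"
      using ts(5)[OF j] by (intro borel_measurable_sum measurable_component_singleton) auto
    from measurable_sets[OF this J(3)[OF j]]
    show "{d \<in> space (PiM {..<?n} (\<lambda>_. borel)). (\<Sum>i<k j. d i) \<in> A j} \<in> sets (PiM {..<?n} (\<lambda>_. borel :: real measure))"
      by (auto simp: vimage_def Int_def conj_commute)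
  qed
  have key: "emeasure M {\<omega> \<in> space M. \<forall>j\<in>J. U j \<omega> \<in> A j}
      = emeasure (PiM {..<?n} (\<lambda>i. density lborel (normal_density 0 (sqrt (ts ! Suc i - ts ! i))))) ?C"
    if U: "is_std_BM M U" for U
  proof -
    have D: "distr M (PiM {..<?n} (\<lambda>_. borel)) (?D U) = PiM {..<?n} (\<lambda>i. distr M borel (\<lambda>\<omega>. U (ts ! Suc i) \<omega> - U (ts ! i) \<omega>))"
      using is_std_BM_D(5)[OF U ts(1,2)] is_std_BM_D(1)[OF U] ts(3)
      by (subst indep_vars_iff_distr_eq_PiM[symmetric]) (auto simp: lessThan_empty_iff)
    also have "\<dots> = PiM {..<?n} (\<lambda>i. density lborel (normal_density 0 (sqrt (ts ! Suc i - ts ! i))))"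
    proof (rule PiM_cong[OF refl])
      fix i assume i: "i \<in> {..<?n}"
      have "distributed M lborel (\<lambda>\<omega>. U (ts ! Suc i) \<omega> - U (ts ! i) \<omega>) (normal_density 0 (sqrt (ts ! Suc i - ts ! i)))"
        using i ts(1) by (intro is_std_BM_D(4)[OF U] ts(2) sorted_wrt_nth_less[OF ts(1)]) auto
      then show "distr M borel (\<lambda>\<omega>. U (ts ! Suc i) \<omega> - U (ts ! i) \<omega>) = density lborel (normal_density 0 (sqrt (ts ! Suc i - ts ! i)))"
        using distributed_distr_eq_density[of M lborel "\<lambda>\<omega>. U (ts ! Suc i) \<omega> - U (ts ! i) \<omega>"]
        by (simp cong: distr_cong)
    qed
    finally have D: "distr M (PiM {..<?n} (\<lambda>_. borel)) (?D U) = \<dots>" .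
    have DM: "?D U \<in> measurable M (PiM {..<?n} (\<lambda>_. borel))"
      using is_std_BM_D(1)[OF U] by (intro measurable_restrict) auto
    have "{\<omega> \<in> space M. \<forall>j\<in>J. U j \<omega> \<in> A j} = ?D U -` ?C \<inter> space M"
    proof -
      have "(\<Sum>i<k j. ?D U \<omega> i) = U j \<omega>" if "j \<in> J" "\<omega> \<in> space M" for j \<omega>
      proof -
        have "(\<Sum>i<k j. ?D U \<omega> i) = (\<Sum>i=0..<k j. U (ts ! Suc i) \<omega> - U (ts ! i) \<omega>)"
          using ts(5)[OF that(1)] by (intro sum.cong) auto
        also have "\<dots> = U j \<omega>"
          using increments_telescope[of 0 "k j" "\<lambda>t. U t \<omega>" ts] ts(4,5) that is_std_BM_D(2)[OF U] by simp
        finally show ?thesis .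
      qed
      then show ?thesis using measurable_space[OF DM] by auto
    qed
    then show ?thesis using emeasure_distr[OF DM C] unfolding D by (simp only:)
  qed
  show "emeasure (distr M (Pi\<^sub>M {0..} (\<lambda>_. borel)) (traj W)) (prod_emb {0..} (\<lambda>_. borel) J (Pi\<^sub>E J A)) =
        emeasure (distr M (Pi\<^sub>M {0..} (\<lambda>_. borel)) (traj V)) (prod_emb {0..} (\<lambda>_. borel) J (Pi\<^sub>E J A))"
  proof -
    have "emeasure (distr M (Pi\<^sub>M {0..} (\<lambda>_. borel)) (traj U)) (prod_emb {0..} (\<lambda>_. borel) J (Pi\<^sub>E J A))
      = emeasure M {\<omega> \<in> space M. \<forall>j\<in>J. U j \<omega> \<in> A j}" if U: "is_std_BM M U" for U
    proof -
      note m = is_std_BM_traj[OF U, unfolded Path_def]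
      have "{\<omega> \<in> space M. \<forall>j\<in>J. traj U \<omega> j \<in> A j} = {\<omega> \<in> space M. \<forall>j\<in>J. U j \<omega> \<in> A j}"
        using J(2) by (auto simp: traj_def subset_eq)
      then show ?thesis
        using J by (subst emeasure_distr[OF m]) (auto simp: vimage_prod_emb[OF m J(2)] intro!: sets_PiM_I)
    qed
    then show ?thesis using key[OF W] key[OF V] W V by simp
  qed
qed auto

lemma (in prob_space) std_BM_shift:
  assumes W: "is_std_BM M W" and a: "a \<ge> 0"
  shows "is_std_BM M (\<lambda>s \<omega>. W (a + s) \<omega> - W a \<omega>)"
  unfolding is_std_BM_def
proof (intro conjI allI impI ballI)
  fix t show "(\<lambda>\<omega>. W (a + t) \<omega> - W a \<omega>) \<in> borel_measurable M"
    using is_std_BM_D(1)[OF W] by auto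
next
  show "AE \<omega> in M. continuous_on {0..} (\<lambda>t. W (a + t) \<omega> - W a \<omega>)"
    using is_std_BM_D(3)[OF W]
  proof eventually_elim
    fix \<omega> assume *: "continuous_on {0..} (\<lambda>t. W t \<omega>)"
    show "continuous_on {0..} (\<lambda>t. W (a + t) \<omega> - W a \<omega>)"
      by (intro continuous_intros continuous_on_compose2[OF *]) (use a in auto)
  qed
next
  fix s t :: real assume "0 \<le> s" "s < t"
  then show "distributed M lborel (\<lambda>\<omega>. W (a + t) \<omega> - W a \<omega> - (W (a + s) \<omega> - W a \<omega>)) (normal_density 0 (sqrt (t - s)))"
    using is_std_BM_D(4)[OF W, of "a + s" "a + t"] a by simp
next
  fix ts :: "real list" assume ts: "sorted_wrt (<) ts" "\<forall>t\<in>set ts. 0 \<le> t"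
  have "indep_vars (\<lambda>_. borel) (\<lambda>i \<omega>. W (map ((+) a) ts ! Suc i) \<omega> - W (map ((+) a) ts ! i) \<omega>) {..<length (map ((+) a) ts) - 1}"
    using ts a by (intro is_std_BM_D(5)[OF W]) (auto simp: sorted_wrt_map)
  then show "indep_vars (\<lambda>_. borel) (\<lambda>i \<omega>. W (a + ts ! Suc i) \<omega> - W a \<omega> - (W (a + ts ! i) \<omega> - W a \<omega>)) {..<length ts - 1}"
    by (rule indep_vars_cong[THEN iffD1, rotated -1]) (auto simp: fun_eq_iff)
qed auto

text \<open>With \<open>a\<close> itself on the time grid, the increments split into a block before
  \<open>a\<close> and a block after it. Finitely many values of the stopped path are sums over the
  first block, those of the shifted path sums over the second, and disjoint blocks of independent
  variables are independent.\<close>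

lemma (in prob_space) std_BM_indep_stop_shift:
  assumes W: "is_std_BM M W" and a: "a \<ge> 0"
  shows "indep_var Path (traj (\<lambda>s. W (min s a))) Path (traj (\<lambda>s \<omega>. W (a + s) \<omega> - W a \<omega>))"
  unfolding Path_def
proof (rule indep_var_PiM_I)
  show "random_variable (Pi\<^sub>M {0..} (\<lambda>_. borel)) (traj (\<lambda>s. W (min s a)))"
    using is_std_BM_D(1)[OF W] measurable_traj[of "\<lambda>s. W (min s a)"] by (simp add: Path_def)
  show "random_variable (Pi\<^sub>M {0..} (\<lambda>_. borel)) (traj (\<lambda>s \<omega>. W (a + s) \<omega> - W a \<omega>))"
    using is_std_BM_D(1)[OF W] measurable_traj[of "\<lambda>s \<omega>. W (a + s) \<omega> - W a \<omega>"] by (simp add: Path_def)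
  fix J J' :: "real set" and A A'
  assume J: "finite J" "J \<subseteq> {0..}" "finite J'" "J' \<subseteq> {0..}"
    "\<And>j. j \<in> J \<Longrightarrow> A j \<in> sets (borel::real measure)" "\<And>j. j \<in> J' \<Longrightarrow> A' j \<in> sets (borel::real measure)"
  let ?F = "insert a ((\<lambda>s. min s a) ` J \<union> (+) a ` J')"
  have F: "finite ?F" "?F \<subseteq> {0..}" using J a by auto
  obtain ts k where ts: "sorted_wrt (<) ts" "\<And>t. t \<in> set ts \<Longrightarrow> 0 \<le> t"
      "length ts \<ge> 2" "ts ! 0 = 0" "\<And>t. t \<in> ?F \<Longrightarrow> k t < length ts \<and> ts ! k t = t"
      "\<And>s t. s \<in> ?F \<Longrightarrow> t \<in> ?F \<Longrightarrow> s \<le> t \<Longrightarrow> k s \<le> k t"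
    by (rule time_grid[OF F]) blast
  let ?n = "length ts - 1" and ?k = "k a"
  have ka: "?k \<le> ?n" using ts(5)[of a] by auto
  let ?X = "\<lambda>i \<omega>. W (ts ! Suc i) \<omega> - W (ts ! i) \<omega>"
  have "indep_var (PiM {..<?k} (\<lambda>_. borel)) (\<lambda>\<omega>. \<lambda>i\<in>{..<?k}. ?X i \<omega>) (PiM {?k..<?n} (\<lambda>_. borel)) (\<lambda>\<omega>. \<lambda>i\<in>{?k..<?n}. ?X i \<omega>)"
    using ka by (intro indep_var_restrict[OF is_std_BM_D(5)[OF W ts(1,2)]]) auto
  note ind = indep_varD[OF this]
  let ?C = "{d \<in> space (PiM {..<?k} (\<lambda>_. borel)). \<forall>j\<in>J. (\<Sum>i=0..<k (min j a). d i) \<in> A j}"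
  let ?C' = "{d \<in> space (PiM {?k..<?n} (\<lambda>_. borel)). \<forall>j\<in>J'. (\<Sum>i=?k..<k (a + j). d i) \<in> A' j}"
  have kj: "k (min j a) \<le> ?k" if "j \<in> J" for j using that by (intro ts(6)) auto
  have kj': "?k \<le> k (a + j)" "k (a + j) \<le> ?n" if "j \<in> J'" for j
    using that ts(5)[of "a + j"] J(4) by (auto intro!: ts(6))
  have C: "?C \<in> sets (PiM {..<?k} (\<lambda>_. borel :: real measure))"
  proof (rule sets.sets_Collect_finite_All[OF _ J(1)])
    fix j assume j: "j \<in> J"
    have "(\<lambda>d. \<Sum>i=0..<k (min j a). d i) \<in> borel_measurable (PiM {..<?k} (\<lambda>_. borel :: real measure))"
      using kj[OF j] by (intro borel_measurable_sum measurable_component_singleton) auto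
    from measurable_sets[OF this J(5)[OF j]]
    show "{d \<in> space (PiM {..<?k} (\<lambda>_. borel)). (\<Sum>i=0..<k (min j a). d i) \<in> A j} \<in> sets (PiM {..<?k} (\<lambda>_. borel :: real measure))"
      by (auto simp: vimage_def Int_def conj_commute)
  qed
  have C': "?C' \<in> sets (PiM {?k..<?n} (\<lambda>_. borel :: real measure))"
  proof (rule sets.sets_Collect_finite_All[OF _ J(3)])
    fix j assume j: "j \<in> J'"
    have "(\<lambda>d. \<Sum>i=?k..<k (a + j). d i) \<in> borel_measurable (PiM {?k..<?n} (\<lambda>_. borel :: real measure))"
      using kj'[OF j] by (intro borel_measurable_sum measurable_component_singleton) auto
    from measurable_sets[OF this J(6)[OF j]]
    show "{d \<in> space (PiM {?k..<?n} (\<lambda>_. borel)). (\<Sum>i=?k..<k (a + j). d i) \<in> A' j} \<in> sets (PiM {?k..<?n} (\<lambda>_. borel :: real measure))"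
      by (auto simp: vimage_def Int_def conj_commute)
  qed
  have s: "(\<Sum>i=0..<k (min j a). (\<lambda>i\<in>{..<?k}. ?X i \<omega>) i) = W (min j a) \<omega>" if "j \<in> J" "\<omega> \<in> space M" for j \<omega>
  proof -
    have "(\<Sum>i=0..<k (min j a). (\<lambda>i\<in>{..<?k}. ?X i \<omega>) i) = (\<Sum>i=0..<k (min j a). W (ts ! Suc i) \<omega> - W (ts ! i) \<omega>)"
      using kj[OF that(1)] by (intro sum.cong) auto
    also have "\<dots> = W (min j a) \<omega>"
      using increments_telescope[of 0 "k (min j a)" "\<lambda>t. W t \<omega>" ts] ts(4) ts(5)[of "min j a"] that is_std_BM_D(2)[OF W] by simp
    finally show ?thesis .
  qed
  have s': "(\<Sum>i=?k..<k (a + j). (\<lambda>i\<in>{?k..<?n}. ?X i \<omega>) i) = W (a + j) \<omega> - W a \<omega>" if "j \<in> J'" "\<omega> \<in> space M" for j \<omega>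
  proof -
    have "(\<Sum>i=?k..<k (a + j). (\<lambda>i\<in>{?k..<?n}. ?X i \<omega>) i) = (\<Sum>i=?k..<k (a + j). W (ts ! Suc i) \<omega> - W (ts ! i) \<omega>)"
      using kj'[OF that(1)] by (intro sum.cong) auto
    also have "\<dots> = W (a + j) \<omega> - W a \<omega>"
      using increments_telescope[of ?k "k (a + j)" "\<lambda>t. W t \<omega>" ts] kj'[OF that(1)] ts(5)[of a] ts(5)[of "a + j"] that by simp
    finally show ?thesis .
  qed
  have e: "(\<lambda>\<omega>. \<lambda>i\<in>{..<?k}. ?X i \<omega>) -` ?C \<inter> space M = {\<omega> \<in> space M. \<forall>j\<in>J. traj (\<lambda>s. W (min s a)) \<omega> j \<in> A j}"
    using J(2) s by (auto simp: traj_def subset_eq space_PiM)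
  have e': "(\<lambda>\<omega>. \<lambda>i\<in>{?k..<?n}. ?X i \<omega>) -` ?C' \<inter> space M = {\<omega> \<in> space M. \<forall>j\<in>J'. traj (\<lambda>s \<omega>. W (a + s) \<omega> - W a \<omega>) \<omega> j \<in> A' j}"
    using J(4) s' by (auto simp: traj_def subset_eq space_PiM)
  have ee: "(\<lambda>x. (\<lambda>i\<in>{..<?k}. ?X i x, \<lambda>i\<in>{?k..<?n}. ?X i x)) -` (?C \<times> ?C') \<inter> space M =
    ((\<lambda>\<omega>. \<lambda>i\<in>{..<?k}. ?X i \<omega>) -` ?C \<inter> space M) \<inter> ((\<lambda>\<omega>. \<lambda>i\<in>{?k..<?n}. ?X i \<omega>) -` ?C' \<inter> space M)" by auto
  show "prob ({\<omega> \<in> space M. \<forall>j\<in>J. traj (\<lambda>s. W (min s a)) \<omega> j \<in> A j} \<inter>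
          {\<omega> \<in> space M. \<forall>j\<in>J'. traj (\<lambda>s \<omega>. W (a + s) \<omega> - W a \<omega>) \<omega> j \<in> A' j}) =
    prob {\<omega> \<in> space M. \<forall>j\<in>J. traj (\<lambda>s. W (min s a)) \<omega> j \<in> A j} *
    prob {\<omega> \<in> space M. \<forall>j\<in>J'. traj (\<lambda>s \<omega>. W (a + s) \<omega> - W a \<omega>) \<omega> j \<in> A' j}"
    using ind[OF C C'] unfolding ee e e' .
qed

text \<open>The Gaussian increments and their independence can be read off the law on
  \<open>Path\<close>. The law does not determine continuity, nor that the start is 0 at every
  sample point, so these two are separate hypotheses.\<close>

lemma (in prob_space) std_BM_of_law:
  assumes W: "is_std_BM M W"
    and V: "\<And>t. V t \<in> borel_measurable M" "\<And>\<omega>. \<omega> \<in> space M \<Longrightarrow> V 0 \<omega> = 0"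
      "AE \<omega> in M. continuous_on {0..} (\<lambda>t. V t \<omega>)"
    and law: "distr M Path (traj V) = distr M Path (traj W)"
  shows "is_std_BM M V"
  unfolding is_std_BM_def
proof (intro conjI allI impI ballI)
  have mV: "traj V \<in> measurable M Path" using V(1) by (rule measurable_traj)
  note mW = is_std_BM_traj[OF W]
  show "V t \<in> borel_measurable M" for t by (rule V)
  show "V 0 \<omega> = 0" if "\<omega> \<in> space M" for \<omega> using V(2)[OF that] .
  show "AE \<omega> in M. continuous_on {0..} (\<lambda>t. V t \<omega>)" by (rule V)
  fix s t :: real assume st: "0 \<le> s" "s < t"
  have g: "(\<lambda>p. p t - p s) \<in> measurable Path lborel" by measurable
  have "distr M lborel (\<lambda>\<omega>. V t \<omega> - V s \<omega>) = distr (distr M Path (traj V)) lborel (\<lambda>p. p t - p s)"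
    using st by (subst distr_distr[OF g mV]) (auto simp: comp_def traj_def)
  also have "\<dots> = distr M lborel (\<lambda>\<omega>. W t \<omega> - W s \<omega>)"
    unfolding law using st by (subst distr_distr[OF g mW]) (auto simp: comp_def traj_def)
  finally show "distributed M lborel (\<lambda>\<omega>. V t \<omega> - V s \<omega>) (normal_density 0 (sqrt (t - s)))"
    using is_std_BM_D(4)[OF W st] V(1) unfolding distributed_def by simp
next
  have mV: "traj V \<in> measurable M Path" using V(1) by (rule measurable_traj)
  note mW = is_std_BM_traj[OF W]
  fix ts :: "real list" assume ts: "sorted_wrt (<) ts" "\<forall>t\<in>set ts. 0 \<le> t"
  let ?f = "\<lambda>i p. p (ts ! Suc i) - p (ts ! i) :: real"
  have eq: "indep_vars (\<lambda>_. borel) (\<lambda>i \<omega>. ?f i (traj U \<omega>)) {..<length ts - 1} \<longleftrightarrow>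
      indep_vars (\<lambda>_. borel) (\<lambda>i \<omega>. U (ts ! Suc i) \<omega> - U (ts ! i) \<omega>) {..<length ts - 1}" for U
    using ts(2) by (intro indep_vars_cong refl) (auto simp: traj_def fun_eq_iff)
  have "indep_vars (\<lambda>_. borel) (\<lambda>i \<omega>. ?f i (traj W \<omega>)) {..<length ts - 1}"
    unfolding eq using is_std_BM_D(5)[OF W ts(1)] ts(2) by blast
  then have "indep_vars (\<lambda>_. borel) (\<lambda>i \<omega>. ?f i (traj V \<omega>)) {..<length ts - 1}"
    by (rule indep_vars_transfer_law[OF mW mV law[symmetric], rotated]) measurable
  then show "indep_vars (\<lambda>_. borel) (\<lambda>i \<omega>. V (ts ! Suc i) \<omega> - V (ts ! i) \<omega>) {..<length ts - 1}"
    unfolding eq .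
qed

lemma (in prob_space) indep_var_const:
  assumes c: "c \<in> space S" and Y: "Y \<in> measurable M T"
  shows "indep_var S (\<lambda>_. c) T Y" "indep_var T Y S (\<lambda>_. c)"
proof -
  have *: "prob (a \<inter> b) = prob a * prob b" "prob (b \<inter> a) = prob b * prob a"
    if "a = {} \<or> a = space M" "b \<in> events" for a b
    using that sets.sets_into_space[of b M] by (auto simp: prob_space Int_absorb1 Int_absorb2)
  have sub: "sigma_sets (space M) {(\<lambda>_. c) -` A \<inter> space M |A. A \<in> sets S} \<subseteq> {{}, space M}"
  proof -
    have "sigma_sets (space M) {(\<lambda>_. c) -` A \<inter> space M |A. A \<in> sets S} \<subseteq> sigma_sets (space M) {{}, space M}"
      by (intro sigma_sets_mono') auto
    also have "\<dots> = {{}, space M}"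
      by (intro sigma_algebra.sigma_sets_eq sigma_algebra_trivial)
    finally show ?thesis .
  qed
  have ev: "sigma_sets (space M) {Y -` A \<inter> space M |A. A \<in> sets T} \<subseteq> events"
    using Y by (intro sets.sigma_sets_subset) (auto intro: measurable_sets)
  show "indep_var S (\<lambda>_. c) T Y" "indep_var T Y S (\<lambda>_. c)"
  proof -
    have tr: "sigma_sets (space M) {(\<lambda>_. c) -` A \<inter> space M |A. A \<in> sets S} \<subseteq> events"
      using sub by blast
    have rv: "random_variable S (\<lambda>_. c)" using c by simp
    show "indep_var S (\<lambda>_. c) T Y"
      unfolding indep_var_eq indep_sets2_eq
    proof (intro conjI ballI rv Y tr ev)
      fix a b assume "a \<in> sigma_sets (space M) {(\<lambda>_. c) -` A \<inter> space M |A. A \<in> sets S}"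
        "b \<in> sigma_sets (space M) {Y -` A \<inter> space M |A. A \<in> sets T}"
      then have "a = {} \<or> a = space M" "b \<in> events" using sub ev by blast+
      then show "prob (a \<inter> b) = prob a * prob b" by (rule *)
    qed
    show "indep_var T Y S (\<lambda>_. c)"
      unfolding indep_var_eq indep_sets2_eq
    proof (intro conjI ballI rv Y tr ev)
      fix b a assume "a \<in> sigma_sets (space M) {(\<lambda>_. c) -` A \<inter> space M |A. A \<in> sets S}"
        "b \<in> sigma_sets (space M) {Y -` A \<inter> space M |A. A \<in> sets T}"
      then have "a = {} \<or> a = space M" "b \<in> events" using sub ev by blast+
      then show "prob (b \<inter> a) = prob b * prob a" by (rule *)
    qed
  qed
qed

text \<open>This cuts all Brownian motions at the same time: \<open>u\<close> and \<open>v\<close>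
  extract the part before and the part after, and the index is doubled by a boolean. The two halves
  of one member are independent by hypothesis, different members by independence of the family, and
  the product rule combines both.\<close>

lemma (in prob_space) indep_vars_split:
  assumes ind: "indep_vars (\<lambda>_. P) X I"
    and u: "\<And>x. x \<in> I \<Longrightarrow> u x \<in> measurable P P" and v: "\<And>x. x \<in> I \<Longrightarrow> v x \<in> measurable P P"
    and uv: "\<And>x. x \<in> I \<Longrightarrow> indep_var P (\<lambda>\<omega>. u x (X x \<omega>)) P (\<lambda>\<omega>. v x (X x \<omega>))"
  shows "indep_vars (\<lambda>_. P) (\<lambda>j \<omega>. (if snd j then u else v) (fst j) (X (fst j) \<omega>)) (I \<times> (UNIV :: bool set))"
proof -
  let ?Y = "\<lambda>j \<omega>. (if snd j then u else v) (fst j) (X (fst j) \<omega>)"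
  have X: "X x \<in> measurable M P" if "x \<in> I" for x
    using ind that by (auto simp: indep_vars_def2)
  have rv: "random_variable P (?Y j)" if "j \<in> I \<times> UNIV" for j
    using that X[of "fst j"] u[of "fst j"] v[of "fst j"] by auto
  show ?thesis
    unfolding indep_vars_def2
  proof (intro conjI ballI indep_setsI)
    fix j assume j: "j \<in> I \<times> (UNIV::bool set)"
    show "random_variable P (?Y j)" by (rule rv[OF j])
    show "{?Y j -` A \<inter> space M |A. A \<in> sets P} \<subseteq> events"
      using rv[OF j] by (auto intro: measurable_sets)
  next
    fix A J assume J: "J \<noteq> {}" "J \<subseteq> I \<times> (UNIV::bool set)" "finite J"
      and "\<forall>j\<in>J. A j \<in> {?Y j -` A \<inter> space M |A. A \<in> sets P}"
    then have "\<forall>j\<in>J. \<exists>C. A j = ?Y j -` C \<inter> space M \<and> C \<in> sets P" by auto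
    then obtain C where C: "\<And>j. j \<in> J \<Longrightarrow> A j = ?Y j -` C j \<inter> space M"
        "\<And>j. j \<in> J \<Longrightarrow> C j \<in> sets P" by metis
    \<comment> \<open>\<open>J\<close> may contain only one half of some index. The missing half
      receives the whole space as its constraint, which contributes a factor 1.\<close>
    define D where "D j = (if j \<in> J then C j else space P)" for j
    have D: "D j \<in> sets P" for j using C by (auto simp: D_def)
    define G where "G x = {p \<in> space P. u x p \<in> D (x, True) \<and> v x p \<in> D (x, False)}" for x
    let ?X0 = "fst ` J"
    have X0: "?X0 \<subseteq> I" "finite ?X0" "?X0 \<noteq> {}" using J by auto
    have G: "G x \<in> sets P" if "x \<in> I" for x
    proof -
      have "G x = (u x -` D (x, True) \<inter> space P) \<inter> (v x -` D (x, False) \<inter> space P)" by (auto simp: G_def)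
      then show ?thesis using measurable_sets[OF u[OF that] D] measurable_sets[OF v[OF that] D] by auto
    qed
    have sp: "u x (X x \<omega>) \<in> space P" "v x (X x \<omega>) \<in> space P" "X x \<omega> \<in> space P" if "x \<in> I" "\<omega> \<in> space M" for x \<omega>
      using measurable_space[OF X[OF that(1)] that(2)] measurable_space[OF u[OF that(1)]] measurable_space[OF v[OF that(1)]] by auto
    have XG: "X x -` G x \<inter> space M = (?Y (x, True) -` D (x, True) \<inter> space M) \<inter> (?Y (x, False) -` D (x, False) \<inter> space M)" if "x \<in> I" for x
      using sp[OF that] by (auto simp: G_def)
    have "\<Inter> (A ` J) = (\<Inter>x\<in>?X0. X x -` G x \<inter> space M)"
    proof (intro equalityI subsetI)
      fix \<omega> assume \<omega>: "\<omega> \<in> \<Inter> (A ` J)"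
      then have sM: "\<omega> \<in> space M" using J C by blast
      have Y: "?Y (x, b) \<omega> \<in> D (x, b)" if "x \<in> I" for x b
      proof (cases "(x, b) \<in> J")
        case True
        then have "\<omega> \<in> A (x, b)" using \<omega> by blast
        then show ?thesis unfolding C(1)[OF True] using True by (simp add: D_def)
      qed (use sp[OF that sM] in \<open>simp add: D_def\<close>)
      show "\<omega> \<in> (\<Inter>x\<in>?X0. X x -` G x \<inter> space M)"
      proof -
        have "\<omega> \<in> X x -` G x \<inter> space M" if "x \<in> I" for x
          unfolding XG[OF that] using Y[OF that, of True] Y[OF that, of False] sM by simp
        then show ?thesis using X0(1) by blast
      qed
    next
      fix \<omega> assume \<omega>: "\<omega> \<in> (\<Inter>x\<in>?X0. X x -` G x \<inter> space M)"
      show "\<omega> \<in> \<Inter> (A ` J)"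
      proof
        fix j assume j: "j \<in> J"
        then have "fst j \<in> I" "\<omega> \<in> X (fst j) -` G (fst j) \<inter> space M" using \<omega> X0 by auto
        then have "?Y j \<omega> \<in> D j" "\<omega> \<in> space M" by (cases j; cases "snd j"; simp add: G_def)+
        then show "\<omega> \<in> A j" using C(1)[OF j] j by (auto simp: D_def)
      qed
    qed
    then have "prob (\<Inter> (A ` J)) = prob (\<Inter>x\<in>?X0. X x -` G x \<inter> space M)" by (simp only:)
    also have "\<dots> = (\<Prod>x\<in>?X0. prob (X x -` G x \<inter> space M))"
      using G X0 by (intro indep_varsD[OF ind X0(3,2,1)]) auto
    also have "\<dots> = (\<Prod>x\<in>?X0. \<Prod>b\<in>UNIV. prob (?Y (x, b) -` D (x, b) \<inter> space M))"
    proof (rule prod.cong[OF refl])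
      fix x assume "x \<in> ?X0"
      then have x: "x \<in> I" using X0 by auto
      have "X x -` G x \<inter> space M = (\<lambda>\<omega>. (u x (X x \<omega>), v x (X x \<omega>))) -` (D (x, True) \<times> D (x, False)) \<inter> space M"
        using sp[OF x] by (auto simp: G_def)
      then show "prob (X x -` G x \<inter> space M) = (\<Prod>b\<in>UNIV. prob (?Y (x, b) -` D (x, b) \<inter> space M))"
        using indep_varD[OF uv[OF x] D D] by (simp add: UNIV_bool)
    qed
    also have "\<dots> = (\<Prod>j\<in>?X0 \<times> UNIV. prob (?Y j -` D j \<inter> space M))"
      by (simp add: prod.cartesian_product split_beta)
    also have "\<dots> = (\<Prod>j\<in>J. prob (?Y j -` D j \<inter> space M))"
    proof (rule prod.mono_neutral_right)
      show "finite (?X0 \<times> (UNIV::bool set))" using J by auto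
      show "J \<subseteq> ?X0 \<times> UNIV" by force
      show "\<forall>j\<in>?X0 \<times> UNIV - J. prob (?Y j -` D j \<inter> space M) = 1"
      proof
        fix j assume j: "j \<in> ?X0 \<times> (UNIV::bool set) - J"
        then have "?Y j -` D j \<inter> space M = space M" using sp X0 by (auto simp: D_def)
        then show "prob (?Y j -` D j \<inter> space M) = 1" by (simp add: prob_space)
      qed
    qed
    also have "\<dots> = (\<Prod>j\<in>J. prob (A j))"
      using C by (intro prod.cong refl) (simp add: D_def)
    finally show "prob (\<Inter> (A ` J)) = (\<Prod>j\<in>J. prob (A j))" .
  qed
qed

subsection \<open>The driving randomness as one random element\<close>

definition ing_index :: "nat \<Rightarrow> (nat + nat + nat) set" where
  "ing_index N = range Inl \<union> range (Inr \<circ> Inl) \<union> (Inr \<circ> Inr) ` {1..N}"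

lemma ing_index_simps [simp]:
  "Inl i \<in> ing_index N" "Inr (Inl i) \<in> ing_index N" "Inr (Inr n) \<in> ing_index N \<longleftrightarrow> n \<in> {1..N}"
  by (auto simp: ing_index_def)

lemma ing_index_cases:
  assumes "x \<in> ing_index N"
  obtains i where "x = Inl i" | i where "x = Inr (Inl i)" | n where "x = Inr (Inr n)" "n \<in> {1..N}"
  using assms by (auto simp: ing_index_def)

text \<open>Gaps and marks are encoded as constant paths, so that all ingredients have values in one
  space and their mutual independence becomes a single \<open>indep_vars\<close> statement.\<close>

definition ing_path ::
  "(nat \<Rightarrow> 'a \<Rightarrow> real) \<Rightarrow> (nat \<Rightarrow> 'a \<Rightarrow> nat) \<Rightarrow> (nat \<Rightarrow> real \<Rightarrow> 'a \<Rightarrow> real) \<Rightarrow> nat + nat + nat \<Rightarrow> 'a \<Rightarrow> real \<Rightarrow> real" where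
  "ing_path g k B x = traj (\<lambda>t \<omega>. case x of Inl i \<Rightarrow> g i \<omega> | Inr (Inl i) \<Rightarrow> real (k i \<omega>) | Inr (Inr n) \<Rightarrow> B n t \<omega>)"

lemma ing_path_simps:
  "ing_path g k B (Inl i) = traj (\<lambda>_. g i)"
  "ing_path g k B (Inr (Inl i)) = traj (\<lambda>_ \<omega>. real (k i \<omega>))"
  "ing_path g k B (Inr (Inr n)) = traj (B n)"
  by (simp_all add: ing_path_def)

definition Ing :: "nat \<Rightarrow> (nat + nat + nat \<Rightarrow> real \<Rightarrow> real) measure" where
  "Ing N = PiM (ing_index N) (\<lambda>_. Path)"

definition ing_elem where
  "ing_elem N g k B \<omega> = (\<lambda>x\<in>ing_index N. ing_path g k B x \<omega>)"

text \<open>In contrast to \<open>bd_ingredients\<close>, the primary objects are the gaps, and the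
  marks are numbered from 0. Discarding the first jump then replaces \<open>i\<close> by
  \<open>Suc i\<close> in both families.\<close>

definition ingredients ::
  "'a measure \<Rightarrow> nat \<Rightarrow> (nat \<Rightarrow> 'a \<Rightarrow> real) \<Rightarrow> (nat \<Rightarrow> 'a \<Rightarrow> nat) \<Rightarrow> (nat \<Rightarrow> real \<Rightarrow> 'a \<Rightarrow> real) \<Rightarrow> bool" where
  "ingredients M N g k B \<longleftrightarrow> prob_space M \<and>
     (\<forall>i. distributed M lborel (g i) (exponential_density (real N))) \<and>
     (\<forall>i. k i \<in> measurable M (count_space UNIV) \<and>
          distr M (count_space UNIV) (k i) = measure_pmf (pmf_of_set {1..N})) \<and>
     (\<forall>n\<in>{1..N}. is_std_BM M (B n)) \<and>
     prob_space.indep_vars M (\<lambda>_. Path) (ing_path g k B) (ing_index N)"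

lemma const_path_measurable [measurable]: "(\<lambda>x. \<lambda>t\<in>{0..}. x) \<in> measurable borel Path"
  by (rule measurable_Path_I) simp

lemma gen_sets_real:
  assumes X: "X \<in> borel_measurable M"
  shows "gen_sets M borel X = {traj (\<lambda>_. X) -` A \<inter> space M |A. A \<in> sets Path}"
proof (intro equalityI subsetI)
  fix a assume "a \<in> gen_sets M borel X"
  then obtain A where A: "A \<in> sets borel" "a = X -` A \<inter> space M" by (auto simp: gen_sets_def)
  have "{p \<in> space Path. p 0 \<in> A} \<in> sets Path"
    using A by measurable
  moreover have "a = traj (\<lambda>_. X) -` {p \<in> space Path. p 0 \<in> A} \<inter> space M"
    by (auto simp: A traj_def space_Path)
  ultimately show "a \<in> {traj (\<lambda>_. X) -` A \<inter> space M |A. A \<in> sets Path}" by blast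
next
  fix a assume "a \<in> {traj (\<lambda>_. X) -` A \<inter> space M |A. A \<in> sets Path}"
  then obtain A where A: "A \<in> sets Path" "a = traj (\<lambda>_. X) -` A \<inter> space M" by auto
  have "a = X -` ((\<lambda>x. \<lambda>t\<in>{0..}. x) -` A \<inter> space borel) \<inter> space M"
    by (auto simp: A traj_def)
  then show "a \<in> gen_sets M borel X"
    using measurable_sets[OF const_path_measurable A(1)] by (auto simp: gen_sets_def)
qed

lemma gen_sets_nat:
  "gen_sets M (count_space UNIV) K = {traj (\<lambda>_ \<omega>. real (K \<omega>)) -` A \<inter> space M |A. A \<in> sets Path}"
proof (intro equalityI subsetI)
  fix a assume "a \<in> gen_sets M (count_space UNIV) K"
  then obtain A where A: "a = K -` A \<inter> space M" by (auto simp: gen_sets_def)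
  have "real ` A \<in> sets borel" by (rule sets.countable) auto
  then have "{p \<in> space Path. p 0 \<in> real ` A} \<in> sets Path" by measurable
  moreover have "a = traj (\<lambda>_ \<omega>. real (K \<omega>)) -` {p \<in> space Path. p 0 \<in> real ` A} \<inter> space M"
    by (auto simp: A traj_def space_Path)
  ultimately show "a \<in> {traj (\<lambda>_ \<omega>. real (K \<omega>)) -` A \<inter> space M |A. A \<in> sets Path}" by blast
next
  fix a assume "a \<in> {traj (\<lambda>_ \<omega>. real (K \<omega>)) -` A \<inter> space M |A. A \<in> sets Path}"
  then obtain A where A: "a = traj (\<lambda>_ \<omega>. real (K \<omega>)) -` A \<inter> space M" by auto
  have "a = K -` {m. (\<lambda>t\<in>{0..}. real m) \<in> A} \<inter> space M"
    by (auto simp: A traj_def)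
  then show "a \<in> gen_sets M (count_space UNIV) K" 
    unfolding gen_sets_def by (intro CollectI exI[of _ "{m. (\<lambda>t\<in>{0..}. real m) \<in> A}"]) simp
qed

text \<open>Taking preimages commutes with generating a sigma-algebra, and the product sigma-algebra
  is generated by conditions on single coordinates.\<close>

lemma gen_sets_proc_eq:
  "gen_sets_proc M W = {traj W -` A \<inter> space M |A. A \<in> sets Path}"
proof -
  let ?R = "{{f \<in> \<Pi>\<^sub>E i\<in>{0..}. space borel. f i \<in> A} |i A. i \<in> {0::real..} \<and> A \<in> sets (borel :: real measure)}"
  have "traj W \<in> space M \<rightarrow> (\<Pi>\<^sub>E i\<in>{0..}. space borel)" by (auto simp: traj_def)
  from sigma_sets_vimage_commute[OF this, of ?R]
  have "{traj W -` A \<inter> space M |A. A \<in> sets Path} = sigma_sets (space M) {traj W -` A \<inter> space M |A. A \<in> ?R}"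
    unfolding Path_def sets_PiM_single .
  also have "{traj W -` A \<inter> space M |A. A \<in> ?R} = (\<Union>t\<in>{0..}. gen_sets M borel (W t))"
  proof (intro equalityI subsetI)
    fix a assume "a \<in> {traj W -` A \<inter> space M |A. A \<in> ?R}"
    then obtain t A where "t \<ge> 0" "A \<in> sets borel" "a = traj W -` {f \<in> \<Pi>\<^sub>E i\<in>{0..}. space borel. f t \<in> A} \<inter> space M" by auto
    then have "a = W t -` A \<inter> space M" by (auto simp: traj_def)
    then show "a \<in> (\<Union>t\<in>{0..}. gen_sets M borel (W t))" using \<open>t \<ge> 0\<close> \<open>A \<in> sets borel\<close> by (auto simp: gen_sets_def)
  next
    fix a assume "a \<in> (\<Union>t\<in>{0..}. gen_sets M borel (W t))"
    then obtain t A where t: "t \<ge> 0" "A \<in> sets borel" "a = W t -` A \<inter> space M" by (auto simp: gen_sets_def)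
    then have "a = traj W -` {f \<in> \<Pi>\<^sub>E i\<in>{0..}. space borel. f t \<in> A} \<inter> space M" by (auto simp: traj_def)
    then show "a \<in> {traj W -` A \<inter> space M |A. A \<in> ?R}" using t by blast
  qed
  finally show ?thesis unfolding gen_sets_proc_def ..
qed

lemma bd_ingredients_iff:
  "bd_ingredients M N J K B \<longleftrightarrow> (\<forall>\<omega>\<in>space M. J 0 \<omega> = 0) \<and>
     ingredients M N (\<lambda>i \<omega>. J (Suc i) \<omega> - J i \<omega>) (\<lambda>i. K (Suc i)) B"
proof -
  let ?g = "\<lambda>i \<omega>. J (Suc i) \<omega> - J i \<omega>" and ?k = "\<lambda>i. K (Suc i)"
  have "prob_space.indep_sets M
       (\<lambda>x. case x of
              Inl i \<Rightarrow> gen_sets M borel (\<lambda>\<omega>. J (Suc i) \<omega> - J i \<omega>)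
            | Inr (Inl i) \<Rightarrow> gen_sets M (count_space UNIV) (K (Suc i))
            | Inr (Inr n) \<Rightarrow> gen_sets_proc M (B n))
       (range Inl \<union> range (Inr \<circ> Inl) \<union> (Inr \<circ> Inr) ` {1..N}) \<longleftrightarrow>
    prob_space.indep_vars M (\<lambda>_. Path) (ing_path ?g ?k B) (ing_index N)"
    if P: "prob_space M" and g: "\<And>i. ?g i \<in> borel_measurable M" and k: "\<And>i. ?k i \<in> measurable M (count_space UNIV)"
      and B: "\<And>n. n \<in> {1..N} \<Longrightarrow> is_std_BM M (B n)"
  proof -
    interpret prob_space M by (rule P)
    have rv: "\<forall>x\<in>ing_index N. random_variable Path (ing_path ?g ?k B x)"
    proof
      fix x assume "x \<in> ing_index N"
      then show "random_variable Path (ing_path ?g ?k B x)"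
      proof (cases rule: ing_index_cases)
        case (1 i)
        then show ?thesis using g[of i] by (auto simp: ing_path_simps intro!: measurable_traj)
      next
        case (2 i)
        have "(\<lambda>\<omega>. real (?k i \<omega>)) \<in> borel_measurable M" by (rule measurable_compose[OF k]) simp
        with 2 show ?thesis by (auto simp: ing_path_simps intro!: measurable_traj)
      next
        case (3 n)
        then show ?thesis using is_std_BM_traj[OF B, of n] by (simp add: ing_path_simps)
      qed
    qed
    have "indep_sets (\<lambda>x. case x of
              Inl i \<Rightarrow> gen_sets M borel (\<lambda>\<omega>. J (Suc i) \<omega> - J i \<omega>)
            | Inr (Inl i) \<Rightarrow> gen_sets M (count_space UNIV) (K (Suc i))
            | Inr (Inr n) \<Rightarrow> gen_sets_proc M (B n)) (ing_index N) \<longleftrightarrow>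
      indep_sets (\<lambda>x. {ing_path ?g ?k B x -` A \<inter> space M |A. A \<in> sets Path}) (ing_index N)"
    proof (rule indep_sets_cong[OF refl])
      fix x assume "x \<in> ing_index N"
      then show "(case x of
              Inl i \<Rightarrow> gen_sets M borel (\<lambda>\<omega>. J (Suc i) \<omega> - J i \<omega>)
            | Inr (Inl i) \<Rightarrow> gen_sets M (count_space UNIV) (K (Suc i))
            | Inr (Inr n) \<Rightarrow> gen_sets_proc M (B n)) = {ing_path ?g ?k B x -` A \<inter> space M |A. A \<in> sets Path}"
      proof (cases rule: ing_index_cases)
        case (1 i)
        show ?thesis unfolding 1 sum.case ing_path_simps by (rule gen_sets_real[OF g])
      next
        case (2 i)
        show ?thesis unfolding 2 sum.case ing_path_simps by (rule gen_sets_nat)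
      next
        case (3 n)
        show ?thesis unfolding 3(1) sum.case ing_path_simps by (rule gen_sets_proc_eq)
      qed
    qed
    then show ?thesis
      unfolding indep_vars_def2 ing_index_def[symmetric] eqTrueI[OF rv] simp_thms .
  qed
  note iff = this
  show ?thesis
  proof
    assume bd: "bd_ingredients M N J K B"
    note d = bd[unfolded bd_ingredients_def]
    have P: "prob_space M" and J: "\<forall>\<omega>\<in>space M. J 0 \<omega> = 0"
      and g: "\<forall>i. distributed M lborel (?g i) (exponential_density (real N))"
      and k: "\<forall>i. ?k i \<in> measurable M (count_space UNIV) \<and> distr M (count_space UNIV) (?k i) = measure_pmf (pmf_of_set {1..N})"
      and B: "\<forall>n\<in>{1..N}. is_std_BM M (B n)" using d by blast+
    have g': "?g i \<in> borel_measurable M" for i using g by (simp add: distributed_def)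
    have "prob_space.indep_vars M (\<lambda>_. Path) (ing_path ?g ?k B) (ing_index N)"
      using d[THEN conjunct2, THEN conjunct2, THEN conjunct2, THEN conjunct2, THEN conjunct2]
      by (rule iff[THEN iffD1, rotated -1]) (use P g' k B in \<open>simp_all only:\<close>)
    then show "(\<forall>\<omega>\<in>space M. J 0 \<omega> = 0) \<and> ingredients M N ?g ?k B"
      unfolding ingredients_def using P J g k B by blast
  next
    assume "(\<forall>\<omega>\<in>space M. J 0 \<omega> = 0) \<and> ingredients M N ?g ?k B"
    note d = this[unfolded ingredients_def]
    have P: "prob_space M" and J: "\<forall>\<omega>\<in>space M. J 0 \<omega> = 0"
      and g: "\<forall>i. distributed M lborel (?g i) (exponential_density (real N))"
      and k: "\<forall>i. ?k i \<in> measurable M (count_space UNIV) \<and> distr M (count_space UNIV) (?k i) = measure_pmf (pmf_of_set {1..N})"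
      and B: "\<forall>n\<in>{1..N}. is_std_BM M (B n)" using d by blast+
    have g': "?g i \<in> borel_measurable M" for i using g by (simp add: distributed_def)
    show "bd_ingredients M N J K B"
      unfolding bd_ingredients_def
    proof (intro conjI P J g k B iff[THEN iffD2])
      show "prob_space.indep_vars M (\<lambda>_. Path) (ing_path ?g ?k B) (ing_index N)"
        using d[THEN conjunct2, THEN conjunct2, THEN conjunct2, THEN conjunct2, THEN conjunct2] .
    qed (use P g' k B in \<open>simp_all only:\<close>)
  qed
qed

lemma ingredientsD:
  assumes "ingredients M N g k B"
  shows "prob_space M"
    "distributed M lborel (g i) (exponential_density (real N))"
    "g i \<in> borel_measurable M"
    "k i \<in> measurable M (count_space UNIV)"
    "distr M (count_space UNIV) (k i) = measure_pmf (pmf_of_set {1..N})"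
    "n \<in> {1..N} \<Longrightarrow> is_std_BM M (B n)"
    "prob_space.indep_vars M (\<lambda>_. Path) (ing_path g k B) (ing_index N)"
    "(\<lambda>\<omega>. real (k i \<omega>)) \<in> borel_measurable M"
proof -
  show g: "distributed M lborel (g i) (exponential_density (real N))"
    and P: "prob_space M"
    and k: "k i \<in> measurable M (count_space UNIV)"
    and "distr M (count_space UNIV) (k i) = measure_pmf (pmf_of_set {1..N})"
    and "n \<in> {1..N} \<Longrightarrow> is_std_BM M (B n)"
    and "prob_space.indep_vars M (\<lambda>_. Path) (ing_path g k B) (ing_index N)"
    using assms unfolding ingredients_def by blast+
  show "g i \<in> borel_measurable M" using g by (simp add: distributed_def)
  show "(\<lambda>\<omega>. real (k i \<omega>)) \<in> borel_measurable M" by (rule measurable_compose[OF k]) simp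
qed

lemma measurable_ing_path:
  assumes "\<And>i. g i \<in> borel_measurable M" "\<And>i. k i \<in> measurable M (count_space UNIV)"
    "\<And>n t. n \<in> {1..N} \<Longrightarrow> B n t \<in> borel_measurable M" "x \<in> ing_index N"
  shows "ing_path g k B x \<in> measurable M Path"
  using assms(4)
proof (cases rule: ing_index_cases)
  case (1 i)
  then show ?thesis using assms(1)[of i] by (auto simp: ing_path_simps intro!: measurable_traj)
next
  case (2 i)
  have "(\<lambda>\<omega>. real (k i \<omega>)) \<in> borel_measurable M" by (rule measurable_compose[OF assms(2)]) simp
  with 2 show ?thesis by (auto simp: ing_path_simps intro!: measurable_traj)
next
  case (3 n)
  then show ?thesis using assms(3)[of n] by (auto simp: ing_path_simps intro!: measurable_traj)
qed

lemma measurable_ing_elem: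
  assumes "\<And>i. g i \<in> borel_measurable M" "\<And>i. k i \<in> measurable M (count_space UNIV)"
    "\<And>n t. n \<in> {1..N} \<Longrightarrow> B n t \<in> borel_measurable M"
  shows "ing_elem N g k B \<in> measurable M (Ing N)"
  unfolding ing_elem_def[abs_def] Ing_def
  by (intro measurable_restrict measurable_ing_path[OF assms])

lemma ingredients_measurable_elem:
  "ingredients M N g k B \<Longrightarrow> ing_elem N g k B \<in> measurable M (Ing N)"
  by (intro measurable_ing_elem ingredientsD is_std_BM_D(1)) (auto dest: ingredientsD(6))

lemma Ing_component:
  "x \<in> ing_index N \<Longrightarrow> (\<lambda>\<theta>. \<theta> x) \<in> measurable (Ing N) Path"
  unfolding Ing_def by (rule measurable_component_singleton)

lemma Inl_component_Ing [measurable]: "(\<lambda>\<theta>. \<theta> (Inl i)) \<in> measurable (Ing N) Path"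
  "(\<lambda>\<theta>. \<theta> (Inr (Inl i))) \<in> measurable (Ing N) Path"
  by (rule Ing_component; simp)+

lemma distr_traj_const:
  assumes "X \<in> borel_measurable M"
  shows "distr M Path (traj (\<lambda>_. X)) = distr (distr M borel X) Path (\<lambda>x. \<lambda>t\<in>{0..}. x)"
  using assms by (subst distr_distr) (auto simp: comp_def traj_def[abs_def])

text \<open>By independence the law of \<open>ing_elem\<close> is the product of the laws of its
  coordinates, and each of these is prescribed: exponential for a gap, uniform for a mark, and for
  the Brownian paths by \<open>std_BM_law_unique\<close>.\<close>

theorem ingredients_law_unique:
  assumes 1: "ingredients M N g k B" and 2: "ingredients M N g' k' B'"
  shows "distr M (Ing N) (ing_elem N g k B) = distr M (Ing N) (ing_elem N g' k' B')"
proof -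
  interpret prob_space M by (rule ingredientsD(1)[OF 1])
  have rep: "distr M (Ing N) (ing_elem N h l C) = (\<Pi>\<^sub>M x\<in>ing_index N. distr M Path (ing_path h l C x))"
    if I: "ingredients M N h l C" for h l C
  proof -
    have "ing_path h l C x \<in> measurable M Path" if "x \<in> ing_index N" for x
      using that by (intro measurable_ing_path ingredientsD[OF I] is_std_BM_D(1)[OF ingredientsD(6)[OF I]])
    moreover have "ing_index N \<noteq> {}" using ing_index_simps(1)[of 0 N] by blast
    ultimately show ?thesis
      using ingredientsD(7)[OF I] unfolding ing_elem_def[abs_def] Ing_def
      by (subst (asm) indep_vars_iff_distr_eq_PiM') auto
  qed
  show ?thesis
    unfolding rep[OF 1] rep[OF 2]
  proof (rule PiM_cong[OF refl])
    fix x assume "x \<in> ing_index N"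
    then show "distr M Path (ing_path g k B x) = distr M Path (ing_path g' k' B' x)"
    proof (cases rule: ing_index_cases)
      case (1 i)
      have *: "distr M borel (h i) = density lborel (exponential_density (real N))"
        if "ingredients M N h l C" for h l C
        using distributed_distr_eq_density[OF ingredientsD(2)[OF that, of i]] by (simp cong: distr_cong)
      show ?thesis
        unfolding 1 ing_path_simps
        unfolding distr_traj_const[OF ingredientsD(3)[OF assms(1)]] distr_traj_const[OF ingredientsD(3)[OF assms(2)]]
          *[OF assms(1)] *[OF assms(2)] ..
    next
      case (2 i)
      have *: "distr M borel (\<lambda>\<omega>. real (l i \<omega>)) = distr (measure_pmf (pmf_of_set {1..N})) borel real"
        if I: "ingredients M N h l C" for h l C
        unfolding ingredientsD(5)[OF I, of i, symmetric]
        by (subst distr_distr[OF _ ingredientsD(4)[OF I]]) (auto simp: comp_def)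
      show ?thesis
        unfolding 2 ing_path_simps
        unfolding distr_traj_const[OF ingredientsD(8)[OF assms(1)]] distr_traj_const[OF ingredientsD(8)[OF assms(2)]]
          *[OF assms(1)] *[OF assms(2)] ..
    next
      case (3 n)
      show ?thesis
        unfolding 3 ing_path_simps
        by (rule std_BM_law_unique; rule ingredientsD(6)[OF assms(1) 3(2)] ingredientsD(6)[OF assms(2) 3(2)])
    qed
  qed
qed

text \<open>This is how the renamed noise is recognised as legitimate noise: only its law has to be
  computed. The pointwise and path properties that a law cannot express appear as
  hypotheses.\<close>

theorem ingredients_of_law:
  assumes I: "ingredients M N g k B"
    and g': "\<And>i. g' i \<in> borel_measurable M" and k': "\<And>i. k' i \<in> measurable M (count_space UNIV)"
    and B': "\<And>n t. n \<in> {1..N} \<Longrightarrow> B' n t \<in> borel_measurable M"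
      "\<And>n \<omega>. n \<in> {1..N} \<Longrightarrow> \<omega> \<in> space M \<Longrightarrow> B' n 0 \<omega> = 0"
      "\<And>n. n \<in> {1..N} \<Longrightarrow> AE \<omega> in M. continuous_on {0..} (\<lambda>t. B' n t \<omega>)"
    and law: "distr M (Ing N) (ing_elem N g' k' B') = distr M (Ing N) (ing_elem N g k B)"
  shows "ingredients M N g' k' B'"
proof -
  interpret prob_space M by (rule ingredientsD(1)[OF I])
  note m = ingredients_measurable_elem[OF I]
  have m': "ing_elem N g' k' B' \<in> measurable M (Ing N)" using g' k' B'(1) by (rule measurable_ing_elem)
  have tr: "distr M T (\<lambda>\<omega>. f (ing_elem N g' k' B' \<omega>)) = distr M T (\<lambda>\<omega>. f (ing_elem N g k B \<omega>))"
    if f: "f \<in> measurable (Ing N) T" for f and T :: "'x measure"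
    using arg_cong[OF law, of "\<lambda>m. distr m T f"] by (simp add: distr_distr[OF f m] distr_distr[OF f m'] comp_def)
  show ?thesis
    unfolding ingredients_def
  proof (intro conjI allI ballI)
    fix i
    have "distr M lborel (\<lambda>\<omega>. ing_elem N g' k' B' \<omega> (Inl i) 0) = distr M lborel (\<lambda>\<omega>. ing_elem N g k B \<omega> (Inl i) 0)"
      by (rule tr) measurable
    then have "distr M lborel (g' i) = distr M lborel (g i)"
      by (simp add: ing_elem_def ing_path_simps traj_def)
    then show "distributed M lborel (g' i) (exponential_density (real N))"
      using ingredientsD(2)[OF I, of i] g' by (simp add: distributed_def)
  next
    fix i show "k' i \<in> measurable M (count_space UNIV)" by (rule k')
    have "distr M (count_space UNIV) (\<lambda>\<omega>. nat \<lfloor>ing_elem N g' k' B' \<omega> (Inr (Inl i)) 0\<rfloor>)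
      = distr M (count_space UNIV) (\<lambda>\<omega>. nat \<lfloor>ing_elem N g k B \<omega> (Inr (Inl i)) 0\<rfloor>)"
      by (rule tr) measurable
    then show "distr M (count_space UNIV) (k' i) = measure_pmf (pmf_of_set {1..N})"
      using ingredientsD(5)[OF I, of i] by (simp add: ing_elem_def ing_path_simps traj_def)
  next
    fix n assume n: "n \<in> {1..N}"
    have "distr M Path (\<lambda>\<omega>. ing_elem N g' k' B' \<omega> (Inr (Inr n))) = distr M Path (\<lambda>\<omega>. ing_elem N g k B \<omega> (Inr (Inr n)))"
      using n by (intro tr Ing_component) simp
    then have "distr M Path (traj (B' n)) = distr M Path (traj (B n))"
      using n by (simp add: ing_elem_def ing_path_simps)
    then show "is_std_BM M (B' n)"
      using n by (intro std_BM_of_law[OF ingredientsD(6)[OF I n]] B') auto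
  next
    have eq: "indep_vars (\<lambda>_. Path) (ing_path h l C) (ing_index N) \<longleftrightarrow>
      indep_vars (\<lambda>_. Path) (\<lambda>x \<omega>. ing_elem N h l C \<omega> x) (ing_index N)" for h l C
      by (intro indep_vars_cong refl) (auto simp: ing_elem_def)
    have "indep_vars (\<lambda>_. Path) (\<lambda>x \<omega>. ing_elem N g k B \<omega> x) (ing_index N)"
      using ingredientsD(7)[OF I] unfolding eq .
    from indep_vars_transfer_law[where f="\<lambda>x \<theta>. \<theta> x" and T="\<lambda>_. Path", OF m m' law[symmetric] _ this]
    show "indep_vars (\<lambda>_. Path) (ing_path g' k' B') (ing_index N)"
      unfolding eq using Ing_component by blast
  qed (rule prob_space_axioms)
qed

subsection \<open>The Markov property at the first jump\<close>

text \<open>The space of excursions, that is of pieces of noise between consecutive jumps: the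
  length of the gap, the mark used at its end, and the Brownian increments since its beginning,
  frozen from its end on.\<close>

definition Exc :: "nat \<Rightarrow> (real \<times> nat \<times> (nat \<Rightarrow> real \<Rightarrow> real)) measure" where
  "Exc N = borel \<Otimes>\<^sub>M (count_space UNIV \<Otimes>\<^sub>M PiM {1..N} (\<lambda>_. Path))"

text \<open>The cutting time is a parameter, apart from the first gap stored in the noise. The
  Markov property is first shown at a fixed time and then integrated over the first gap, which is
  independent of the coordinates in \<open>ing_later\<close>.\<close>

definition first_exc_at where
  "first_exc_at N t \<theta> = (t, nat \<lfloor>\<theta> (Inr (Inl 0)) 0\<rfloor>,
     \<lambda>n\<in>{1..N}. \<lambda>s\<in>{0..}. evalp (\<theta> (Inr (Inr n))) (min s t))"

definition rest_at where
  "rest_at N t \<theta> = (\<lambda>x\<in>ing_index N. case x of Inl i \<Rightarrow> \<theta> (Inl (Suc i))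
     | Inr (Inl i) \<Rightarrow> \<theta> (Inr (Inl (Suc i)))
     | Inr (Inr n) \<Rightarrow> \<lambda>s\<in>{0..}. evalp (\<theta> x) (t + s) - evalp (\<theta> x) t)"

definition "first_exc N \<theta> = first_exc_at N (\<theta> (Inl 0) 0) \<theta>"
definition "rest N \<theta> = rest_at N (\<theta> (Inl 0) 0) \<theta>"

definition "ing_later N = ing_index N - {Inl 0}"

text \<open>Measurability holds jointly in the time and the noise, which is what Fubini needs and
  what \<open>evalp\<close> was made for. Only the coordinates in \<open>ing_later\<close> are
  assumed measurable, because in the application the first gap lives in the other factor of a
  product.\<close>

lemma measurable_first_exc_at:
  assumes T [measurable]: "T \<in> borel_measurable Q"
    and f: "\<And>x. x \<in> ing_later N \<Longrightarrow> (\<lambda>q. f q x) \<in> measurable Q Path"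
  shows "(\<lambda>q. first_exc_at N (T q) (f q)) \<in> measurable Q (Exc N)"
proof -
  have [measurable]: "(\<lambda>q. f q (Inr (Inl 0))) \<in> measurable Q Path"
    by (rule f) (simp add: ing_later_def)
  have "(\<lambda>q. \<lambda>n\<in>{1..N}. \<lambda>s\<in>{0..}. evalp (f q (Inr (Inr n))) (min s (T q))) \<in> measurable Q (PiM {1..N} (\<lambda>_. Path))"
  proof (intro measurable_restrict measurable_Path_I)
    fix n and s :: real assume "n \<in> {1..N}"
    then have [measurable]: "(\<lambda>q. f q (Inr (Inr n))) \<in> measurable Q Path"
      by (intro f) (simp add: ing_later_def)
    show "(\<lambda>q. evalp (f q (Inr (Inr n))) (min s (T q))) \<in> borel_measurable Q" by measurable
  qed
  then show ?thesis unfolding first_exc_at_def Exc_def by measurable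
qed

lemma measurable_rest_at:
  assumes T [measurable]: "T \<in> borel_measurable Q"
    and f: "\<And>x. x \<in> ing_later N \<Longrightarrow> (\<lambda>q. f q x) \<in> measurable Q Path"
  shows "(\<lambda>q. rest_at N (T q) (f q)) \<in> measurable Q (Ing N)"
  unfolding rest_at_def Ing_def
proof (rule measurable_restrict)
  fix x assume "x \<in> ing_index N"
  then show "(\<lambda>q. case x of Inl i \<Rightarrow> f q (Inl (Suc i)) | Inr (Inl i) \<Rightarrow> f q (Inr (Inl (Suc i)))
     | Inr (Inr n) \<Rightarrow> \<lambda>s\<in>{0..}. evalp (f q x) (T q + s) - evalp (f q x) (T q)) \<in> measurable Q Path"
  proof (cases rule: ing_index_cases)
    case (3 n)
    have [measurable]: "(\<lambda>q. f q x) \<in> measurable Q Path"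
      using 3 by (intro f) (simp add: ing_later_def)
    have "(\<lambda>q. \<lambda>s\<in>{0..}. evalp (f q x) (T q + s) - evalp (f q x) (T q)) \<in> measurable Q Path"
      by (rule measurable_Path_I) measurable
    then show ?thesis by (simp add: 3)
  qed (auto intro!: f simp: ing_later_def)
qed

lemma measurable_first_exc [measurable]: "first_exc N \<in> measurable (Ing N) (Exc N)"
  unfolding first_exc_def[abs_def]
  by (rule measurable_first_exc_at[where f="\<lambda>\<theta>. \<theta>"]) (auto intro!: measurable_Path_component Ing_component simp: ing_later_def)

lemma measurable_rest [measurable]: "rest N \<in> measurable (Ing N) (Ing N)"
  unfolding rest_def[abs_def]
  by (rule measurable_rest_at[where f="\<lambda>\<theta>. \<theta>"]) (auto intro!: measurable_Path_component Ing_component simp: ing_later_def)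

text \<open>These are the counterparts of \<open>first_exc_at\<close> and \<open>rest_at\<close> at
  a deterministic time with plain evaluation of the paths. Both versions agree where the paths are
  continuous, hence almost surely.\<close>

definition "stopped_exc N a k B \<omega> = (a, k 0 \<omega>, \<lambda>n\<in>{1..N}. traj (\<lambda>s. B n (min s a)) \<omega>)"
definition "shifted_elem N a g k B = ing_elem N (\<lambda>i. g (Suc i)) (\<lambda>i. k (Suc i)) (\<lambda>n s \<omega>. B n (a + s) \<omega> - B n a \<omega>)"

text \<open>Each ingredient is divided at time \<open>a\<close>. A Brownian motion splits into its
  stopped and its shifted path; mark 0 belongs to the past, all other marks and the later gaps to
  the future. After \<open>indep_vars_split\<close> the past and the future are functions of
  disjoint sets of independent variables.\<close>

theorem deterministic_markov:
  assumes I: "ingredients M N g k B" and a: "a \<ge> 0"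
  shows "\<And>A C. A \<in> sets (Exc N) \<Longrightarrow> C \<in> sets (Ing N) \<Longrightarrow>
      measure M {\<omega> \<in> space M. stopped_exc N a k B \<omega> \<in> A \<and> shifted_elem N a g k B \<omega> \<in> C} =
      measure M {\<omega> \<in> space M. stopped_exc N a k B \<omega> \<in> A} * measure M {\<omega> \<in> space M. shifted_elem N a g k B \<omega> \<in> C}"
    and "ingredients M N (\<lambda>i. g (Suc i)) (\<lambda>i. k (Suc i)) (\<lambda>n s \<omega>. B n (a + s) \<omega> - B n a \<omega>)"
proof -
  interpret prob_space M by (rule ingredientsD(1)[OF I])
  define z :: "real \<Rightarrow> real" where "z = (\<lambda>t\<in>{0..}. 0)"
  have z: "z \<in> space Path" by (auto simp: z_def space_Path)
  \<comment> \<open>An ingredient that belongs entirely to one side has the constant path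
    \<open>z\<close> as its other half. A constant is independent of everything.\<close>
  define u where "u x p = (case x of Inl i \<Rightarrow> z | Inr (Inl i) \<Rightarrow> (if i = 0 then p else z)
      | Inr (Inr n) \<Rightarrow> \<lambda>s\<in>{0..}. p (min s a))" for x :: "nat + nat + nat" and p :: "real \<Rightarrow> real"
  define v where "v x p = (case x of Inl i \<Rightarrow> p | Inr (Inl i) \<Rightarrow> (if i = 0 then z else p)
      | Inr (Inr n) \<Rightarrow> \<lambda>s\<in>{0..}. p (a + s) - p a)" for x :: "nat + nat + nat" and p :: "real \<Rightarrow> real"
  let ?X = "ing_path g k B"
  have X: "?X x \<in> measurable M Path" if "x \<in> ing_index N" for x
    using that by (intro measurable_ing_path ingredientsD[OF I] is_std_BM_D(1)[OF ingredientsD(6)[OF I]])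
  have um: "u x \<in> measurable Path Path" for x
  proof -
    have "(\<lambda>p. \<lambda>s\<in>{0..}. p (min s a)) \<in> measurable Path Path"
      by (rule measurable_Path_I) measurable
    note * = this
    show ?thesis
    proof (cases x)
      case (Inl i)
      then show ?thesis using z by (simp add: u_def[abs_def])
    next
      case (Inr y)
      then show ?thesis using z * by (cases y) (auto simp: u_def[abs_def])
    qed
  qed
  have vm: "v x \<in> measurable Path Path" for x
  proof -
    have "(\<lambda>p. \<lambda>s\<in>{0..}. p (a + s) - p a) \<in> measurable Path Path"
      by (rule measurable_Path_I) measurable
    note * = this
    show ?thesis
    proof (cases x)
      case (Inl i)
      then show ?thesis using z by (simp add: v_def[abs_def])
    next
      case (Inr y)
      then show ?thesis using z * by (cases y) (auto simp: v_def[abs_def])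
    qed
  qed
  have uv: "indep_var Path (\<lambda>\<omega>. u x (?X x \<omega>)) Path (\<lambda>\<omega>. v x (?X x \<omega>))" if x: "x \<in> ing_index N" for x
    using x
  proof (cases rule: ing_index_cases)
    case (1 i)
    then show ?thesis using indep_var_const(1)[OF z X[OF x]] by (simp add: u_def v_def)
  next
    case (2 i)
    then show ?thesis using indep_var_const[OF z X[OF x]] by (cases "i = 0") (simp_all add: u_def v_def)
  next
    case (3 n)
    have "u x (?X x \<omega>) = traj (\<lambda>s. B n (min s a)) \<omega>" "v x (?X x \<omega>) = traj (\<lambda>s \<omega>. B n (a + s) \<omega> - B n a \<omega>) \<omega>" for \<omega>
      using a by (auto simp: 3 u_def v_def ing_path_simps traj_def fun_eq_iff)
    then show ?thesis using std_BM_indep_stop_shift[OF ingredientsD(6)[OF I 3(2)] a] by simp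
  qed
  let ?Y = "\<lambda>j \<omega>. (if snd j then u else v) (fst j) (?X (fst j) \<omega>)"
  have Y: "indep_vars (\<lambda>_. Path) ?Y (ing_index N \<times> UNIV)"
    by (rule indep_vars_split[OF ingredientsD(7)[OF I] um vm uv])
  \<comment> \<open>\<open>\<phi>\<close> tells from which half-ingredient each coordinate of the
    shifted noise is made. Gaps and marks move up by one, which leaves out mark 0 and the first
    gap.\<close>
  define \<phi> where "\<phi> x = (case x of Inl i \<Rightarrow> (Inl (Suc i), False) | Inr (Inl i) \<Rightarrow> (Inr (Inl (Suc i)), False)
     | Inr (Inr n) \<Rightarrow> (Inr (Inr n), False))" for x :: "nat + nat + nat"
  let ?A = "insert (Inr (Inl 0), True) ((\<lambda>n. (Inr (Inr n), True)) ` {1..N}) :: ((nat + nat + nat) \<times> bool) set"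
  let ?B = "\<phi> ` ing_index N"
  have \<phi>I: "?B \<subseteq> ing_index N \<times> UNIV"
  proof
    fix j assume "j \<in> ?B"
    then obtain x where x: "x \<in> ing_index N" "j = \<phi> x" by auto
    from x(1) show "j \<in> ing_index N \<times> UNIV"
      by (cases rule: ing_index_cases) (auto simp: x(2) \<phi>_def)
  qed
  have inj: "inj_on \<phi> (ing_index N)"
    by (auto simp: inj_on_def \<phi>_def split: sum.splits)
  have \<phi>Y: "?Y (\<phi> x) \<omega> = ing_path (\<lambda>i. g (Suc i)) (\<lambda>i. k (Suc i)) (\<lambda>n s \<omega>. B n (a + s) \<omega> - B n a \<omega>) x \<omega>"
    if x: "x \<in> ing_index N" for x \<omega>
    using x by (cases rule: ing_index_cases) (use a in \<open>auto simp: \<phi>_def v_def ing_path_simps traj_def fun_eq_iff\<close>)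
  have iv: "indep_var (PiM ?A (\<lambda>_. Path)) (\<lambda>\<omega>. \<lambda>j\<in>?A. ?Y j \<omega>) (PiM ?B (\<lambda>_. Path)) (\<lambda>\<omega>. \<lambda>j\<in>?B. ?Y j \<omega>)"
  proof (rule indep_var_restrict[OF Y])
    show "?A \<inter> ?B = {}" by (auto simp: \<phi>_def split: sum.splits)
  qed (use \<phi>I in auto)
  let ?hA = "\<lambda>q. (a, nat \<lfloor>q (Inr (Inl 0), True) 0\<rfloor>, \<lambda>n\<in>{1..N}. q (Inr (Inr n), True)) :: real \<times> nat \<times> (nat \<Rightarrow> real \<Rightarrow> real)"
  have hA: "?hA \<in> measurable (PiM ?A (\<lambda>_. Path)) (Exc N)"
  proof -
    have [measurable]: "(\<lambda>q. q (Inr (Inl 0), True)) \<in> measurable (PiM ?A (\<lambda>_. Path)) Path"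
      by (rule measurable_component_singleton) simp
    have [measurable]: "(\<lambda>q. \<lambda>n\<in>{1..N}. q (Inr (Inr n), True)) \<in> measurable (PiM ?A (\<lambda>_. Path)) (PiM {1..N} (\<lambda>_. Path))"
      by (intro measurable_restrict measurable_component_singleton) auto
    show ?thesis unfolding Exc_def by measurable
  qed
  let ?hB = "\<lambda>q. \<lambda>x\<in>ing_index N. q (\<phi> x)"
  have hB: "?hB \<in> measurable (PiM ?B (\<lambda>_. Path)) (Ing N)"
    unfolding Ing_def by (intro measurable_restrict measurable_component_singleton) auto
  have eA: "?hA (\<lambda>j\<in>?A. ?Y j \<omega>) = stopped_exc N a k B \<omega>" for \<omega>
    by (auto simp: stopped_exc_def u_def ing_path_simps traj_def fun_eq_iff a)
  have eB: "?hB (\<lambda>j\<in>?B. ?Y j \<omega>) = shifted_elem N a g k B \<omega>" for \<omega>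
    unfolding shifted_elem_def ing_elem_def by (rule restrict_ext) (simp only: restrict_apply' imageI \<phi>Y)
  show "prob {\<omega> \<in> space M. stopped_exc N a k B \<omega> \<in> A \<and> shifted_elem N a g k B \<omega> \<in> C} =
      prob {\<omega> \<in> space M. stopped_exc N a k B \<omega> \<in> A} * prob {\<omega> \<in> space M. shifted_elem N a g k B \<omega> \<in> C}"
    if A: "A \<in> sets (Exc N)" and C: "C \<in> sets (Ing N)" for A C
  proof -
    have rA: "(\<lambda>\<omega>. \<lambda>j\<in>?A. ?Y j \<omega>) \<in> measurable M (PiM ?A (\<lambda>_. Path))"
      and rB: "(\<lambda>\<omega>. \<lambda>j\<in>?B. ?Y j \<omega>) \<in> measurable M (PiM ?B (\<lambda>_. Path))"
      using indep_var_rv1[OF iv] indep_var_rv2[OF iv] .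
    have A': "(\<lambda>\<omega>. \<lambda>j\<in>?A. ?Y j \<omega>) -` (?hA -` A \<inter> space (PiM ?A (\<lambda>_. Path))) \<inter> space M
        = {\<omega> \<in> space M. stopped_exc N a k B \<omega> \<in> A}"
      using measurable_space[OF rA] unfolding eA[symmetric] by blast
    have C': "(\<lambda>\<omega>. \<lambda>j\<in>?B. ?Y j \<omega>) -` (?hB -` C \<inter> space (PiM ?B (\<lambda>_. Path))) \<inter> space M
        = {\<omega> \<in> space M. shifted_elem N a g k B \<omega> \<in> C}"
      using measurable_space[OF rB] unfolding eB[symmetric] by blast
    have AC: "(\<lambda>\<omega>. (\<lambda>j\<in>?A. ?Y j \<omega>, \<lambda>j\<in>?B. ?Y j \<omega>)) -` ((?hA -` A \<inter> space (PiM ?A (\<lambda>_. Path))) \<times> (?hB -` C \<inter> space (PiM ?B (\<lambda>_. Path)))) \<inter> space M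
        = {\<omega> \<in> space M. stopped_exc N a k B \<omega> \<in> A} \<inter> {\<omega> \<in> space M. shifted_elem N a g k B \<omega> \<in> C}"
      unfolding A'[symmetric] C'[symmetric] by blast
    have "{\<omega> \<in> space M. stopped_exc N a k B \<omega> \<in> A \<and> shifted_elem N a g k B \<omega> \<in> C} =
      {\<omega> \<in> space M. stopped_exc N a k B \<omega> \<in> A} \<inter> {\<omega> \<in> space M. shifted_elem N a g k B \<omega> \<in> C}" by blast
    then show ?thesis
      using indep_varD[OF iv measurable_sets[OF hA A] measurable_sets[OF hB C]] unfolding A' C' AC by (simp only:)
  qed
  show "ingredients M N (\<lambda>i. g (Suc i)) (\<lambda>i. k (Suc i)) (\<lambda>n s \<omega>. B n (a + s) \<omega> - B n a \<omega>)"
    unfolding ingredients_def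
  proof (intro conjI allI ballI prob_space_axioms ingredientsD[OF I])
    fix n assume "n \<in> {1..N}"
    then show "is_std_BM M (\<lambda>s \<omega>. B n (a + s) \<omega> - B n a \<omega>)"
      using a by (intro std_BM_shift ingredientsD(6)[OF I])
  next
    have "indep_vars (\<lambda>_. Path) (\<lambda>x. ?Y (\<phi> x)) (ing_index N)"
      using indep_vars_reindex[OF indep_vars_subset[OF Y \<phi>I] inj] .
    then show "indep_vars (\<lambda>_. Path) (ing_path (\<lambda>i. g (Suc i)) (\<lambda>i. k (Suc i)) (\<lambda>n s \<omega>. B n (a + s) \<omega> - B n a \<omega>)) (ing_index N)"
      by (rule indep_vars_cong[THEN iffD1, OF refl ext refl, rotated]) (rule \<phi>Y)
  qed
qed

lemma AE_exponential_pos: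
  assumes "distributed M lborel X (exponential_density l)"
  shows "AE \<omega> in M. 0 < X \<omega>"
proof -
  have "AE x in lborel. x \<noteq> (0::real)" by (rule AE_lborel_singleton)
  then have "AE x in density lborel (exponential_density l). 0 < x"
    by (subst AE_density) (auto simp: exponential_density_def split: if_splits elim!: eventually_mono)
  then have "AE x in distr M lborel X. 0 < x"
    unfolding distributed_distr_eq_density[OF assms] .
  then show ?thesis
    using assms by (subst (asm) AE_distr_iff) (auto simp: distributed_def)
qed

lemma ingredients_AE_continuous:
  assumes I: "ingredients M N g k B"
  shows "AE \<omega> in M. \<forall>n\<in>{1..N}. continuous_on {0..} (\<lambda>t. B n t \<omega>)"
proof -
  have "AE \<omega> in M. \<forall>n\<in>{1..N}. n \<in> {1..N} \<longrightarrow> continuous_on {0..} (\<lambda>t. B n t \<omega>)"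
    by (intro AE_finite_allI) (auto intro!: is_std_BM_D(3) ingredientsD(6)[OF I])
  then show ?thesis by simp
qed

lemma first_exc_at_eq:
  assumes "\<And>n. n \<in> {1..N} \<Longrightarrow> continuous_on {0..} (\<lambda>t. B n t \<omega>)" "t \<ge> 0"
  shows "first_exc_at N t (ing_elem N g k B \<omega>) = stopped_exc N t k B \<omega>"
  using assms
  by (auto simp: first_exc_at_def stopped_exc_def ing_elem_def ing_path_simps fun_eq_iff evalp_eq continuous_traj)
    (auto simp: traj_def)

lemma rest_at_eq:
  assumes "\<And>n. n \<in> {1..N} \<Longrightarrow> continuous_on {0..} (\<lambda>t. B n t \<omega>)" "t \<ge> 0"
  shows "rest_at N t (ing_elem N g k B \<omega>) = shifted_elem N t g k B \<omega>"
proof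
  fix x show "rest_at N t (ing_elem N g k B \<omega>) x = shifted_elem N t g k B \<omega> x"
  proof (cases "x \<in> ing_index N")
    case True
    then show ?thesis
    proof (cases rule: ing_index_cases)
      case (3 n)
      then show ?thesis using assms
        by (auto simp: rest_at_def shifted_elem_def ing_elem_def ing_path_simps evalp_eq continuous_traj fun_eq_iff)
          (auto simp: traj_def)
    qed (auto simp: rest_at_def shifted_elem_def ing_elem_def ing_path_simps)
  qed (simp add: rest_at_def shifted_elem_def ing_elem_def)
qed

lemma first_exc_at_restrict: "first_exc_at N t (restrict \<theta> (ing_later N)) = first_exc_at N t \<theta>"
  by (auto simp: first_exc_at_def ing_later_def fun_eq_iff)

lemma rest_at_restrict: "rest_at N t (restrict \<theta> (ing_later N)) = rest_at N t \<theta>"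
  by (auto simp: rest_at_def ing_later_def fun_eq_iff split: sum.split)

text \<open>Given the value \<open>t\<close> of the first gap, \<open>deterministic_markov\<close>
  separates the excursion from the rest. By \<open>ingredients_law_unique\<close> the rest has the
  law of the original noise whatever \<open>t\<close> is, so its probability leaves the integral
  over \<open>t\<close>.\<close>

theorem markov_at_first_jump:
  assumes I: "ingredients M N g k B"
  defines "\<theta> \<equiv> ing_elem N g k B"
  assumes A: "A \<in> sets (Exc N)" and C: "C \<in> sets (Ing N)"
  shows "emeasure M {\<omega> \<in> space M. first_exc N (\<theta> \<omega>) \<in> A \<and> rest N (\<theta> \<omega>) \<in> C} =
    emeasure M {\<omega> \<in> space M. first_exc N (\<theta> \<omega>) \<in> A} * emeasure M {\<omega> \<in> space M. \<theta> \<omega> \<in> C}"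
proof -
  interpret prob_space M by (rule ingredientsD(1)[OF I])
  have \<theta>: "\<theta> \<in> measurable M (Ing N)" unfolding \<theta>_def by (rule ingredients_measurable_elem[OF I])
  let ?P0 = "PiM {Inl 0} (\<lambda>_. Path) :: (nat + nat + nat \<Rightarrow> real \<Rightarrow> real) measure"
  let ?P1 = "PiM (ing_later N) (\<lambda>_. Path)"
  let ?X0 = "\<lambda>\<omega>. restrict (\<theta> \<omega>) {Inl 0}" and ?X1 = "\<lambda>\<omega>. restrict (\<theta> \<omega>) (ing_later N)"
  have "indep_var ?P0 (\<lambda>\<omega>. \<lambda>x\<in>{Inl 0}. ing_path g k B x \<omega>) ?P1 (\<lambda>\<omega>. \<lambda>x\<in>ing_later N. ing_path g k B x \<omega>)"
    by (rule indep_var_restrict[OF ingredientsD(7)[OF I]]) (auto simp: ing_later_def)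
  moreover have "(\<lambda>x\<in>{Inl 0}. ing_path g k B x \<omega>) = ?X0 \<omega>" "(\<lambda>x\<in>ing_later N. ing_path g k B x \<omega>) = ?X1 \<omega>" for \<omega>
    by (auto simp: \<theta>_def ing_elem_def ing_later_def fun_eq_iff)
  ultimately have ind: "indep_var ?P0 ?X0 ?P1 ?X1" by simp
  let ?D0 = "distr M ?P0 ?X0" and ?D1 = "distr M ?P1 ?X1"
  note X0 = indep_var_rv1[OF ind] and X1 = indep_var_rv2[OF ind]
  have D: "?D0 \<Otimes>\<^sub>M ?D1 = distr M (?P0 \<Otimes>\<^sub>M ?P1) (\<lambda>\<omega>. (?X0 \<omega>, ?X1 \<omega>))"
    using ind unfolding indep_var_distribution_eq by blast
  interpret D1: prob_space ?D1 by (rule prob_space_distr[OF X1])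
  let ?t = "\<lambda>p::nat + nat + nat \<Rightarrow> real \<Rightarrow> real. p (Inl 0) 0"
  have t [measurable]: "?t \<in> borel_measurable ?P0"
    by (intro measurable_Path_component measurable_component_singleton) simp
  define G where "G C = {(p, q) \<in> space (?P0 \<Otimes>\<^sub>M ?P1). first_exc_at N (?t p) q \<in> A \<and> rest_at N (?t p) q \<in> C}" for C
  have Gm: "G C \<in> sets (?P0 \<Otimes>\<^sub>M ?P1)" if C: "C \<in> sets (Ing N)" for C
  proof -
    have c: "(\<lambda>z. snd z x) \<in> measurable (?P0 \<Otimes>\<^sub>M ?P1) Path" if "x \<in> ing_later N" for x
      using measurable_component_singleton[OF that, of "\<lambda>_. Path"] by measurable
    have T: "(\<lambda>z. ?t (fst z)) \<in> borel_measurable (?P0 \<Otimes>\<^sub>M ?P1)" by measurable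
    have "(\<lambda>z. first_exc_at N (?t (fst z)) (snd z)) \<in> measurable (?P0 \<Otimes>\<^sub>M ?P1) (Exc N)"
      by (rule measurable_first_exc_at[OF T c])
    moreover have "(\<lambda>z. rest_at N (?t (fst z)) (snd z)) \<in> measurable (?P0 \<Otimes>\<^sub>M ?P1) (Ing N)"
      by (rule measurable_rest_at[OF T c])
    moreover have "G C = ((\<lambda>z. first_exc_at N (?t (fst z)) (snd z)) -` A \<inter> space (?P0 \<Otimes>\<^sub>M ?P1)) \<inter>
        ((\<lambda>z. rest_at N (?t (fst z)) (snd z)) -` C \<inter> space (?P0 \<Otimes>\<^sub>M ?P1))"
      by (auto simp: G_def)
    ultimately show ?thesis using A C by (auto intro: measurable_sets)
  qed
  have main: "emeasure M {\<omega> \<in> space M. first_exc N (\<theta> \<omega>) \<in> A \<and> rest N (\<theta> \<omega>) \<in> C}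
      = (\<integral>\<^sup>+p. emeasure ?D1 (Pair p -` G C) \<partial>?D0)" if C: "C \<in> sets (Ing N)" for C
  proof -
    have "(\<lambda>\<omega>. (?X0 \<omega>, ?X1 \<omega>)) -` G C \<inter> space M = {\<omega> \<in> space M. first_exc N (\<theta> \<omega>) \<in> A \<and> rest N (\<theta> \<omega>) \<in> C}"
      using measurable_space[OF X0] measurable_space[OF X1]
      by (auto simp: G_def space_pair_measure first_exc_at_restrict rest_at_restrict first_exc_def rest_def)
    then have "emeasure M {\<omega> \<in> space M. first_exc N (\<theta> \<omega>) \<in> A \<and> rest N (\<theta> \<omega>) \<in> C} = emeasure (?D0 \<Otimes>\<^sub>M ?D1) (G C)"
      unfolding D using X0 X1 Gm[OF C] by (subst emeasure_distr) auto
    also have "\<dots> = (\<integral>\<^sup>+p. emeasure ?D1 (Pair p -` G C) \<partial>?D0)"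
      using Gm[OF C] by (intro D1.emeasure_pair_measure_alt) (simp cong: sets_pair_measure_cong)
    finally show ?thesis .
  qed
  have inner: "emeasure ?D1 (Pair p -` G C) = emeasure M {\<omega> \<in> space M. stopped_exc N (?t p) k B \<omega> \<in> A} * emeasure M {\<omega> \<in> space M. \<theta> \<omega> \<in> C}"
    if p: "p \<in> space ?P0" "?t p \<ge> 0" and C: "C \<in> sets (Ing N)" for p C
  proof -
    have Gp: "Pair p -` G C \<in> sets ?P1" using Gm[OF C] by (rule sets_Pair1)
    have "emeasure ?D1 (Pair p -` G C) = emeasure M (?X1 -` (Pair p -` G C) \<inter> space M)"
      by (rule emeasure_distr[OF X1 Gp])
    also have "?X1 -` (Pair p -` G C) \<inter> space M = {\<omega> \<in> space M. first_exc_at N (?t p) (\<theta> \<omega>) \<in> A \<and> rest_at N (?t p) (\<theta> \<omega>) \<in> C}"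
      using p measurable_space[OF X1] by (auto simp: G_def space_pair_measure first_exc_at_restrict rest_at_restrict)
    also have "emeasure M \<dots> = emeasure M {\<omega> \<in> space M. stopped_exc N (?t p) k B \<omega> \<in> A \<and> shifted_elem N (?t p) g k B \<omega> \<in> C}"
    proof (rule emeasure_eq_AE)
      show "AE \<omega> in M. (\<omega> \<in> {\<omega> \<in> space M. first_exc_at N (?t p) (\<theta> \<omega>) \<in> A \<and> rest_at N (?t p) (\<theta> \<omega>) \<in> C}) =
        (\<omega> \<in> {\<omega> \<in> space M. stopped_exc N (?t p) k B \<omega> \<in> A \<and> shifted_elem N (?t p) g k B \<omega> \<in> C})"
        using ingredients_AE_continuous[OF I]
      proof eventually_elim
        case (elim \<omega>)
        then show ?case
          unfolding \<theta>_def using first_exc_at_eq[of N B \<omega> "?t p" g k] rest_at_eq[of N B \<omega> "?t p" g k] p by simp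
      qed
      have c: "(\<lambda>\<omega>. \<theta> \<omega> x) \<in> measurable M Path" if "x \<in> ing_later N" for x
        using that by (intro measurable_compose[OF \<theta> Ing_component]) (simp add: ing_later_def)
      have "{\<omega> \<in> space M. first_exc_at N (?t p) (\<theta> \<omega>) \<in> A \<and> rest_at N (?t p) (\<theta> \<omega>) \<in> C} =
          ((\<lambda>\<omega>. first_exc_at N (?t p) (\<theta> \<omega>)) -` A \<inter> space M) \<inter> ((\<lambda>\<omega>. rest_at N (?t p) (\<theta> \<omega>)) -` C \<inter> space M)" by auto
      then show "{\<omega> \<in> space M. first_exc_at N (?t p) (\<theta> \<omega>) \<in> A \<and> rest_at N (?t p) (\<theta> \<omega>) \<in> C} \<in> events"
        using measurable_sets[OF measurable_first_exc_at[OF _ c] A, of "\<lambda>_. ?t p"]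
          measurable_sets[OF measurable_rest_at[OF _ c] C, of "\<lambda>_. ?t p"] by auto
      have "stopped_exc N (?t p) k B \<in> measurable M (Exc N)"
        unfolding stopped_exc_def[abs_def] Exc_def
        by (intro measurable_Pair measurable_const ingredientsD(4)[OF I] measurable_restrict measurable_traj is_std_BM_D(1)[OF ingredientsD(6)[OF I]]) auto
      moreover have "shifted_elem N (?t p) g k B \<in> measurable M (Ing N)"
        unfolding shifted_elem_def by (rule ingredients_measurable_elem[OF deterministic_markov(2)[OF I p(2)]])
      moreover have "{\<omega> \<in> space M. stopped_exc N (?t p) k B \<omega> \<in> A \<and> shifted_elem N (?t p) g k B \<omega> \<in> C}
        = (stopped_exc N (?t p) k B -` A \<inter> space M) \<inter> (shifted_elem N (?t p) g k B -` C \<inter> space M)" by auto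
      ultimately show "{\<omega> \<in> space M. stopped_exc N (?t p) k B \<omega> \<in> A \<and> shifted_elem N (?t p) g k B \<omega> \<in> C} \<in> events"
        using A C by (auto intro: measurable_sets)
    qed
    also have "\<dots> = emeasure M {\<omega> \<in> space M. stopped_exc N (?t p) k B \<omega> \<in> A} * emeasure M {\<omega> \<in> space M. shifted_elem N (?t p) g k B \<omega> \<in> C}"
      using deterministic_markov(1)[OF I p(2) A C] by (simp add: emeasure_eq_measure ennreal_mult)
    also have "emeasure M {\<omega> \<in> space M. shifted_elem N (?t p) g k B \<omega> \<in> C} = emeasure M {\<omega> \<in> space M. \<theta> \<omega> \<in> C}"
    proof -
      note I' = deterministic_markov(2)[OF I p(2)]
      have "emeasure (distr M (Ing N) (shifted_elem N (?t p) g k B)) C = emeasure (distr M (Ing N) \<theta>) C"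
        unfolding shifted_elem_def \<theta>_def using ingredients_law_unique[OF I' I] by simp
      moreover have "shifted_elem N (?t p) g k B \<in> measurable M (Ing N)"
        unfolding shifted_elem_def by (rule ingredients_measurable_elem[OF I'])
      moreover have "{\<omega> \<in> space M. f \<omega> \<in> C} = f -` C \<inter> space M" for f by auto
      ultimately show ?thesis using \<theta> C by (simp add: emeasure_distr)
    qed
    finally show ?thesis .
  qed
  \<comment> \<open>With the whole space in place of \<open>C\<close> the same formulas describe the
    first excursion alone. Comparing both cases shows that the integrands differ by the factor
    P(\<open>\<theta>\<close> in \<open>C\<close>), which does not depend on
    \<open>p\<close>.\<close>
  have sp: "space (Ing N) \<in> sets (Ing N)" by simp
  have "AE \<omega> in M. 0 \<le> \<theta> \<omega> (Inl 0) 0"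
    using AE_exponential_pos[OF ingredientsD(2)[OF I, of 0]]
    by eventually_elim (simp add: \<theta>_def ing_elem_def ing_path_simps traj_def)
  then have pos: "AE p in ?D0. 0 \<le> ?t p"
    using X0 by (subst AE_distr_iff) auto
  have full: "emeasure M {\<omega> \<in> space M. \<theta> \<omega> \<in> space (Ing N)} = 1"
    using measurable_space[OF \<theta>] by (simp add: emeasure_space_1 cong: conj_cong)
  have "(\<integral>\<^sup>+p. emeasure ?D1 (Pair p -` G C) \<partial>?D0) =
      (\<integral>\<^sup>+p. emeasure ?D1 (Pair p -` G (space (Ing N))) * emeasure M {\<omega> \<in> space M. \<theta> \<omega> \<in> C} \<partial>?D0)"
  proof (rule nn_integral_cong_AE)
    show "AE p in ?D0. emeasure ?D1 (Pair p -` G C) = emeasure ?D1 (Pair p -` G (space (Ing N))) * emeasure M {\<omega> \<in> space M. \<theta> \<omega> \<in> C}"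
      using pos AE_space
    proof eventually_elim
      case (elim p)
      then have p: "p \<in> space ?P0" "?t p \<ge> 0" by simp_all
      show ?case unfolding inner[OF p C] inner[OF p sp] full by simp
    qed
  qed
  also have "\<dots> = (\<integral>\<^sup>+p. emeasure ?D1 (Pair p -` G (space (Ing N))) \<partial>?D0) * emeasure M {\<omega> \<in> space M. \<theta> \<omega> \<in> C}"
    using Gm[OF sp] by (intro nn_integral_multc D1.measurable_emeasure_Pair) (simp cong: sets_pair_measure_cong)
  also have "(\<integral>\<^sup>+p. emeasure ?D1 (Pair p -` G (space (Ing N))) \<partial>?D0) = emeasure M {\<omega> \<in> space M. first_exc N (\<theta> \<omega>) \<in> A}"
    unfolding main[OF sp, symmetric]
    using measurable_space[OF measurable_compose[OF \<theta> measurable_rest]] by (intro arg_cong2[where f=emeasure]) auto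
  finally show ?thesis unfolding main[OF C] .
qed

lemma sets_Collect_mem:
  assumes "f \<in> measurable M N" "A \<in> sets N"
  shows "{x \<in> space M. f x \<in> A} \<in> sets M"
proof -
  have "{x \<in> space M. f x \<in> A} = f -` A \<inter> space M" by blast
  then show ?thesis using measurable_sets[OF assms] by (simp only:)
qed

subsection \<open>Independent identically distributed sequences\<close>

text \<open>Only initial segments are tested, since that is what an induction along the sequence
  delivers. \<open>iid_seq_prob\<close> passes to arbitrary finite index sets by filling the holes
  with the whole space.\<close>

definition iid_seq :: "'a measure \<Rightarrow> 'b measure \<Rightarrow> (nat \<Rightarrow> 'a \<Rightarrow> 'b) \<Rightarrow> bool" where
  "iid_seq M Q X \<longleftrightarrow> (\<forall>l. X l \<in> measurable M Q) \<and>
     (\<forall>n A. (\<forall>l<n. A l \<in> sets Q) \<longrightarrow>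
        measure M {\<omega> \<in> space M. \<forall>l<n. X l \<omega> \<in> A l} = (\<Prod>l<n. measure Q (A l)))"

lemma iid_seq_measurable: "iid_seq M Q X \<Longrightarrow> X l \<in> measurable M Q"
  by (simp add: iid_seq_def)

lemma iid_seq_prob:
  assumes X: "iid_seq M Q X" and Q: "prob_space Q" and J: "finite J" "\<And>l. l \<in> J \<Longrightarrow> A l \<in> sets Q"
  shows "measure M {\<omega> \<in> space M. \<forall>l\<in>J. X l \<omega> \<in> A l} = (\<Prod>l\<in>J. measure Q (A l))"
proof -
  interpret Q: prob_space Q by (rule Q)
  obtain n where n: "J \<subseteq> {..<n}" using J(1) by (metis finite_nat_iff_bounded)
  define A' where "A' l = (if l \<in> J then A l else space Q)" for l
  have "{\<omega> \<in> space M. \<forall>l\<in>J. X l \<omega> \<in> A l} = {\<omega> \<in> space M. \<forall>l<n. X l \<omega> \<in> A' l}"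
    using n measurable_space[OF iid_seq_measurable[OF X]] by (auto simp: A'_def)
  also have "measure M \<dots> = (\<Prod>l<n. measure Q (A' l))"
    using X J by (auto simp: iid_seq_def A'_def)
  also have "\<dots> = (\<Prod>l\<in>J. measure Q (A' l))"
    using n by (intro prod.mono_neutral_right) (auto simp: A'_def Q.prob_space)
  also have "\<dots> = (\<Prod>l\<in>J. measure Q (A l))"
    by (intro prod.cong) (auto simp: A'_def)
  finally show ?thesis .
qed

lemma iid_seq_distr:
  assumes X: "iid_seq M Q X" and Q: "prob_space Q" and M: "prob_space M"
  shows "distr M Q (X l) = Q"
proof (rule measure_eqI)
  interpret M: prob_space M by (rule M)
  interpret Q: prob_space Q by (rule Q)
  fix A assume "A \<in> sets (distr M Q (X l))"
  then have A: "A \<in> sets Q" by simp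
  have "measure M (X l -` A \<inter> space M) = measure M {\<omega> \<in> space M. \<forall>i\<in>{l}. X i \<omega> \<in> A}"
    by (intro arg_cong[where f="measure M"]) auto
  also have "\<dots> = measure Q A"
    using A by (subst iid_seq_prob[OF X Q]) auto
  finally show "emeasure (distr M Q (X l)) A = emeasure Q A"
    using A iid_seq_measurable[OF X] by (simp add: emeasure_distr M.emeasure_eq_measure Q.emeasure_eq_measure)
qed simp

lemma iid_seq_indep:
  assumes X: "iid_seq M Q X" and Q: "prob_space Q" and M: "prob_space M"
  shows "prob_space.indep_vars M (\<lambda>_. Q) X UNIV"
proof -
  interpret M: prob_space M by (rule M)
  have m: "X l \<in> measurable M Q" for l by (rule iid_seq_measurable[OF X])
  have pr: "measure M (X j -` C \<inter> space M) = measure Q C" if "C \<in> sets Q" for j C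
    using arg_cong[OF iid_seq_distr[OF X Q M, of j], of "\<lambda>m. measure m C"] that m by (simp add: measure_distr)
  show ?thesis
    unfolding M.indep_vars_def2
  proof (intro conjI ballI M.indep_setsI m)
    fix i show "{X i -` A \<inter> space M |A. A \<in> sets Q} \<subseteq> M.events"
      using m by (auto intro: measurable_sets)
  next
    fix A and J :: "nat set" assume J: "J \<noteq> {}" "finite J"
      and "\<forall>j\<in>J. A j \<in> {X j -` A \<inter> space M |A. A \<in> sets Q}"
    then have "\<forall>j\<in>J. \<exists>C. A j = X j -` C \<inter> space M \<and> C \<in> sets Q" by auto
    then obtain C where C: "\<And>j. j \<in> J \<Longrightarrow> A j = X j -` C j \<inter> space M" "\<And>j. j \<in> J \<Longrightarrow> C j \<in> sets Q" by metis
    have "\<Inter> (A ` J) = {\<omega> \<in> space M. \<forall>j\<in>J. X j \<omega> \<in> C j}" using C J by auto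
    then have "measure M (\<Inter> (A ` J)) = (\<Prod>j\<in>J. measure Q (C j))"
      using iid_seq_prob[OF X Q J(2)] C by simp
    also have "\<dots> = (\<Prod>j\<in>J. measure M (A j))" using C by (intro prod.cong refl) (simp add: pr)
    finally show "measure M (\<Inter> (A ` J)) = (\<Prod>j\<in>J. measure M (A j))" .
  qed
qed

lemma iid_seq_law_unique:
  assumes X: "iid_seq M Q X" and Y: "iid_seq M Q Y" and Q: "prob_space Q" and M: "prob_space M"
  shows "distr M (PiM UNIV (\<lambda>_. Q)) (\<lambda>\<omega> l. X l \<omega>) = distr M (PiM UNIV (\<lambda>_. Q)) (\<lambda>\<omega> l. Y l \<omega>)"
proof (rule measure_eqI_PiM_infinite)
  interpret M: prob_space M by (rule M)
  have m: "(\<lambda>\<omega> l. Z l \<omega>) \<in> measurable M (PiM UNIV (\<lambda>_. Q))" if "iid_seq M Q Z" for Z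
  proof -
    have "(\<lambda>\<omega>. \<lambda>l\<in>UNIV. Z l \<omega>) \<in> measurable M (PiM UNIV (\<lambda>_. Q))"
      by (intro measurable_restrict iid_seq_measurable[OF that])
    then show ?thesis by (simp add: restrict_def)
  qed
  show "finite_measure (distr M (PiM UNIV (\<lambda>_. Q)) (\<lambda>\<omega> l. X l \<omega>))"
    using m[OF X] by (rule M.finite_measure_distr)
  fix A and J :: "nat set" assume J: "finite J" "\<And>i. i \<in> J \<Longrightarrow> A i \<in> sets Q"
  have "emeasure (distr M (PiM UNIV (\<lambda>_. Q)) (\<lambda>\<omega> l. Z l \<omega>)) (prod_emb UNIV (\<lambda>_. Q) J (Pi\<^sub>E J A)) = ennreal (\<Prod>l\<in>J. measure Q (A l))"
    if Z: "iid_seq M Q Z" for Z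
    using J by (subst emeasure_distr[OF m[OF Z]])
      (auto simp: vimage_prod_emb[OF m[OF Z]] M.emeasure_eq_measure iid_seq_prob[OF Z Q] intro!: sets_PiM_I)
  then show "emeasure (distr M (PiM UNIV (\<lambda>_. Q)) (\<lambda>\<omega> l. X l \<omega>)) (prod_emb UNIV (\<lambda>_. Q) J (Pi\<^sub>E J A)) =
     emeasure (distr M (PiM UNIV (\<lambda>_. Q)) (\<lambda>\<omega> l. Y l \<omega>)) (prod_emb UNIV (\<lambda>_. Q) J (Pi\<^sub>E J A))"
    using X Y by simp
qed auto

text \<open>The history strictly before index \<open>n\<close>: it is generated by the elements with
  index below \<open>n\<close>, and \<open>X n\<close> is independent of it.\<close>

definition past :: "'a measure \<Rightarrow> 'b measure \<Rightarrow> (nat \<Rightarrow> 'a \<Rightarrow> 'b) \<Rightarrow> nat \<Rightarrow> 'a measure" where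
  "past M Q X n = vimage_algebra (space M) (\<lambda>\<omega>. \<lambda>l\<in>{..<n}. X l \<omega>) (PiM {..<n} (\<lambda>_. Q))"

lemma space_past [simp]: "space (past M Q X n) = space M"
  by (simp add: past_def)

lemma sets_past:
  assumes "\<And>l. X l \<in> measurable M Q"
  shows "sets (past M Q X n) = {(\<lambda>\<omega>. \<lambda>l\<in>{..<n}. X l \<omega>) -` D \<inter> space M |D. D \<in> sets (PiM {..<n} (\<lambda>_. Q))}"
  unfolding past_def using measurable_space[OF assms]
  by (intro sets_vimage_algebra2) (auto simp: space_PiM)

lemma past_measurable:
  assumes "\<And>l. X l \<in> measurable M Q" "l < n"
  shows "X l \<in> measurable (past M Q X n) Q"
proof -
  have "(\<lambda>\<omega>. \<lambda>l\<in>{..<n}. X l \<omega>) \<in> measurable (past M Q X n) (PiM {..<n} (\<lambda>_. Q))"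
    unfolding past_def using measurable_space[OF assms(1)]
    by (intro measurable_vimage_algebra1) (auto simp: space_PiM)
  from measurable_compose[OF this measurable_component_singleton, of l] assms(2)
  show ?thesis by simp
qed

lemma past_mono:
  assumes X: "\<And>l. X l \<in> measurable M Q" and mn: "m \<le> n"
  shows "sets (past M Q X m) \<subseteq> sets (past M Q X n)"
proof -
  have "(\<lambda>\<omega>. \<lambda>l\<in>{..<m}. X l \<omega>) \<in> measurable (past M Q X n) (PiM {..<m} (\<lambda>_. Q))"
    using mn by (intro measurable_restrict past_measurable[OF X]) auto
  from measurable_sets[OF this] show ?thesis unfolding sets_past[OF X, where n=m] by auto
qed

lemma past_subset:
  assumes "\<And>l. X l \<in> measurable M Q"
  shows "sets (past M Q X n) \<subseteq> sets M"
proof -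
  have "(\<lambda>\<omega>. \<lambda>l\<in>{..<n}. X l \<omega>) \<in> measurable M (PiM {..<n} (\<lambda>_. Q))"
    by (intro measurable_restrict assms)
  from measurable_sets[OF this] show ?thesis unfolding sets_past[OF assms] by auto
qed

lemma measurable_past_mono:
  assumes "\<And>l. X l \<in> measurable M Q" "m \<le> n" "f \<in> measurable (past M Q X m) T"
  shows "f \<in> measurable (past M Q X n) T"
proof (rule measurableI)
  fix A assume "A \<in> sets T"
  from measurable_sets[OF assms(3) this]
  show "f -` A \<inter> space (past M Q X n) \<in> sets (past M Q X n)" using past_mono[where X=X, OF assms(1,2)] by auto
qed (use measurable_space[OF assms(3)] in simp)

lemma measurable_past:
  assumes "\<And>l. X l \<in> measurable M Q" "f \<in> measurable (past M Q X n) T"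
  shows "f \<in> measurable M T"
proof (rule measurableI)
  fix A assume "A \<in> sets T"
  from measurable_sets[OF assms(2) this]
  show "f -` A \<inter> space M \<in> sets M" using past_subset[where X=X, OF assms(1)] by auto
qed (use measurable_space[OF assms(2)] in simp)

lemma iid_seq_past_indep:
  assumes X: "iid_seq M Q X" and Q: "prob_space Q" and M: "prob_space M"
    and D: "D \<in> sets (past M Q X n)" and A: "A \<in> sets Q"
  shows "measure M (D \<inter> {\<omega> \<in> space M. X n \<omega> \<in> A}) = measure M D * measure Q A"
proof -
  interpret M: prob_space M by (rule M)
  have m: "X l \<in> measurable M Q" for l by (rule iid_seq_measurable[OF X])
  obtain D' where D': "D' \<in> sets (PiM {..<n} (\<lambda>_. Q))" "D = (\<lambda>\<omega>. \<lambda>l\<in>{..<n}. X l \<omega>) -` D' \<inter> space M"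
    using D unfolding sets_past[OF m] by auto
  have iv: "M.indep_var (PiM {..<n} (\<lambda>_. Q)) (\<lambda>\<omega>. \<lambda>l\<in>{..<n}. X l \<omega>) (PiM {n} (\<lambda>_. Q)) (\<lambda>\<omega>. \<lambda>l\<in>{n}. X l \<omega>)"
    by (rule M.indep_var_restrict[OF iid_seq_indep[OF X Q M]]) auto
  have A': "(\<lambda>d. d n) -` A \<inter> space (PiM {n} (\<lambda>_. Q)) \<in> sets (PiM {n} (\<lambda>_. Q))"
    using A by (intro measurable_sets[OF measurable_component_singleton]) auto
  have e: "(\<lambda>\<omega>. \<lambda>l\<in>{n}. X l \<omega>) -` ((\<lambda>d. d n) -` A \<inter> space (PiM {n} (\<lambda>_. Q))) \<inter> space M = X n -` A \<inter> space M"
    using measurable_space[OF m] by (auto simp: space_PiM)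
  have "D \<inter> {\<omega> \<in> space M. X n \<omega> \<in> A} =
     (\<lambda>\<omega>. (\<lambda>l\<in>{..<n}. X l \<omega>, \<lambda>l\<in>{n}. X l \<omega>)) -` (D' \<times> ((\<lambda>d. d n) -` A \<inter> space (PiM {n} (\<lambda>_. Q)))) \<inter> space M"
    unfolding D'(2) using measurable_space[OF m] by (auto simp: space_PiM)
  then have "measure M (D \<inter> {\<omega> \<in> space M. X n \<omega> \<in> A}) = measure M D * measure M (X n -` A \<inter> space M)"
    using M.indep_varD[OF iv D'(1) A'] unfolding e D'(2)[symmetric] by (simp only:)
  also have "measure M (X n -` A \<inter> space M) = measure Q A"
    using arg_cong[OF iid_seq_distr[OF X Q M, of n], of "\<lambda>m. measure m A"] A m by (simp add: measure_distr)
  finally show ?thesis .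
qed

text \<open>Conditionally on the past, the transformation applied to the next element is a fixed
  measure-preserving map.\<close>

theorem iid_seq_adapted_action:
  assumes X: "iid_seq M Q X" and Q: "prob_space Q" and M: "prob_space M"
    and P: "finite P" and act: "\<And>\<tau>. \<tau> \<in> P \<Longrightarrow> act \<tau> \<in> measurable Q Q"
      "\<And>\<tau>. \<tau> \<in> P \<Longrightarrow> distr Q Q (act \<tau>) = Q"
    and \<sigma>: "\<And>n. \<sigma> n \<in> measurable (past M Q X n) (count_space P)"
  shows "iid_seq M Q (\<lambda>n \<omega>. act (\<sigma> n \<omega>) (X n \<omega>))"
proof -
  interpret M: prob_space M by (rule M)
  let ?Y = "\<lambda>n \<omega>. act (\<sigma> n \<omega>) (X n \<omega>)"
  have m: "X l \<in> measurable M Q" for l by (rule iid_seq_measurable[OF X])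
  have Ym: "?Y l \<in> measurable (past M Q X n) Q" if "l < n" for l n
  proof (rule measurable_compose_countable'[where f="\<lambda>\<tau> \<omega>. act \<tau> (X l \<omega>)" and I=P])
    show "\<sigma> l \<in> measurable (past M Q X n) (count_space P)"
      using that by (intro measurable_past_mono[OF m _ \<sigma>[of l]]) auto
    show "(\<lambda>\<omega>. act \<tau> (X l \<omega>)) \<in> measurable (past M Q X n) Q" if "\<tau> \<in> P" for \<tau>
      using measurable_compose[OF past_measurable[OF m \<open>l < n\<close>] act(1)[OF that]] .
  qed (use P in \<open>simp add: countable_finite\<close>)
  have YM: "?Y l \<in> measurable M Q" for l
    by (rule measurable_past[OF m Ym[of l "Suc l"]]) simp
  have "measure M {\<omega> \<in> space M. \<forall>l<n. ?Y l \<omega> \<in> A l} = (\<Prod>l<n. measure Q (A l))"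
    if "\<forall>l<n. A l \<in> sets Q" for n A
    using that
  proof (induction n)
    case 0
    then show ?case by (simp add: M.prob_space)
  next
    case (Suc n)
    let ?D = "{\<omega> \<in> space M. \<forall>l<n. ?Y l \<omega> \<in> A l}"
    let ?S = "\<lambda>\<tau>. {\<omega> \<in> space M. \<sigma> n \<omega> = \<tau>}"
    have D: "?D \<in> sets (past M Q X n)"
    proof -
      have "{\<omega> \<in> space (past M Q X n). \<forall>l\<in>{..<n}. ?Y l \<omega> \<in> A l} \<in> sets (past M Q X n)"
      proof (intro sets.sets_Collect_finite_All)
        fix l assume "l \<in> {..<n}"
        then show "{\<omega> \<in> space (past M Q X n). ?Y l \<omega> \<in> A l} \<in> sets (past M Q X n)"
          using Suc.prems by (intro sets_Collect_mem[OF Ym]) auto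
      qed simp
      also have "{\<omega> \<in> space (past M Q X n). \<forall>l\<in>{..<n}. ?Y l \<omega> \<in> A l} = ?D"
        unfolding space_past by blast
      finally show ?thesis .
    qed
    have S: "?S \<tau> \<in> sets (past M Q X n)" if "\<tau> \<in> P" for \<tau>
      using sets_Collect_mem[OF \<sigma>[of n], of "{\<tau>}"] that by simp
    have \<sigma>P: "\<sigma> n \<omega> \<in> P" if "\<omega> \<in> space M" for \<omega>
      using measurable_space[OF \<sigma>[of n]] that by simp
    have An: "A n \<in> sets Q" using Suc.prems by simp
    have E: "act \<tau> -` A n \<inter> space Q \<in> sets Q" if "\<tau> \<in> P" for \<tau>
      using act(1)[OF that] An by (rule measurable_sets)
    have inv: "measure Q (act \<tau> -` A n \<inter> space Q) = measure Q (A n)" if "\<tau> \<in> P" for \<tau>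
      using arg_cong[OF act(2)[OF that], of "\<lambda>m. measure m (A n)"] An act(1)[OF that] by (simp add: measure_distr)
    \<comment> \<open>As \<open>P\<close> is finite, conditioning on \<open>\<sigma> n\<close> is a
      finite disjoint union. Each piece intersects a past event with an event on \<open>X n\<close>
      that involves one fixed map, and invariance gives the latter the probability of
      \<open>A n\<close>.\<close>
    have eq: "{\<omega> \<in> space M. \<forall>l<Suc n. ?Y l \<omega> \<in> A l} =
       (\<Union>\<tau>\<in>P. (?D \<inter> ?S \<tau>) \<inter> {\<omega> \<in> space M. X n \<omega> \<in> act \<tau> -` A n \<inter> space Q})"
      using \<sigma>P measurable_space[OF m[of n]] by (auto simp: less_Suc_eq)
    have ev: "?D \<inter> ?S \<tau> \<in> sets (past M Q X n)" if "\<tau> \<in> P" for \<tau>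
      by (rule sets.Int[OF D S[OF that]])
    have ev2: "{\<omega> \<in> space M. X n \<omega> \<in> act \<tau> -` A n \<inter> space Q} \<in> sets M" if "\<tau> \<in> P" for \<tau>
      by (rule sets_Collect_mem[OF m E[OF that]])
    have "measure M {\<omega> \<in> space M. \<forall>l<Suc n. ?Y l \<omega> \<in> A l} =
       (\<Sum>\<tau>\<in>P. measure M ((?D \<inter> ?S \<tau>) \<inter> {\<omega> \<in> space M. X n \<omega> \<in> act \<tau> -` A n \<inter> space Q}))"
      unfolding eq
    proof (rule M.finite_measure_finite_Union[OF P])
      show "(\<lambda>\<tau>. (?D \<inter> ?S \<tau>) \<inter> {\<omega> \<in> space M. X n \<omega> \<in> act \<tau> -` A n \<inter> space Q}) ` P \<subseteq> M.events"
        by (intro image_subsetI sets.Int[OF subsetD[OF past_subset[where X=X, OF m] ev] ev2])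
    qed (auto simp: disjoint_family_on_def)
    also have "\<dots> = (\<Sum>\<tau>\<in>P. measure M (?D \<inter> ?S \<tau>) * measure Q (A n))"
    proof (rule sum.cong[OF refl])
      fix \<tau> assume \<tau>: "\<tau> \<in> P"
      show "measure M ((?D \<inter> ?S \<tau>) \<inter> {\<omega> \<in> space M. X n \<omega> \<in> act \<tau> -` A n \<inter> space Q}) = measure M (?D \<inter> ?S \<tau>) * measure Q (A n)"
        using iid_seq_past_indep[OF X Q M ev[OF \<tau>] E[OF \<tau>]] inv[OF \<tau>] by simp
    qed
    also have "\<dots> = (\<Sum>\<tau>\<in>P. measure M (?D \<inter> ?S \<tau>)) * measure Q (A n)"
      by (simp add: sum_distrib_right)
    also have "(\<Sum>\<tau>\<in>P. measure M (?D \<inter> ?S \<tau>)) = measure M (\<Union>\<tau>\<in>P. ?D \<inter> ?S \<tau>)"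
    proof (rule M.finite_measure_finite_Union[OF P, symmetric])
      show "(\<lambda>\<tau>. ?D \<inter> ?S \<tau>) ` P \<subseteq> M.events"
        by (intro image_subsetI subsetD[OF past_subset[where X=X, OF m] ev])
    qed (auto simp: disjoint_family_on_def)
    also have "(\<Union>\<tau>\<in>P. ?D \<inter> ?S \<tau>) = ?D" using \<sigma>P by blast
    also have "measure M ?D = (\<Prod>l<n. measure Q (A l))"
      using Suc by simp
    finally show ?case by simp
  qed
  then show ?thesis unfolding iid_seq_def using YM by blast
qed

text \<open>An event about the first \<open>n + 1\<close> elements is a condition on the first
  element together with an event about \<open>n\<close> elements of the shifted noise. The renewal
  identity separates the two and replaces the shifted noise by the original one, to which the
  induction hypothesis applies with the conditions moved by one.\<close>

lemma iid_seq_of_renewal: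
  assumes M: "prob_space M" and \<theta>: "\<theta> \<in> measurable M S" and F: "F \<in> measurable S E" and R: "R \<in> measurable S S"
    and renew: "\<And>A C. A \<in> sets E \<Longrightarrow> C \<in> sets S \<Longrightarrow>
      emeasure M {\<omega> \<in> space M. F (\<theta> \<omega>) \<in> A \<and> R (\<theta> \<omega>) \<in> C} =
      emeasure M {\<omega> \<in> space M. F (\<theta> \<omega>) \<in> A} * emeasure M {\<omega> \<in> space M. \<theta> \<omega> \<in> C}"
  shows "iid_seq M (distr M E (\<lambda>\<omega>. F (\<theta> \<omega>))) (\<lambda>l \<omega>. F ((R ^^ l) (\<theta> \<omega>)))"
proof -
  interpret M: prob_space M by (rule M)
  let ?Q = "distr M E (\<lambda>\<omega>. F (\<theta> \<omega>))"
  have Rl: "R ^^ l \<in> measurable S S" for l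
  proof (induction l)
    case (Suc l)
    then show ?case using measurable_compose[OF Suc.IH R] by (simp add: comp_def)
  qed (simp add: id_def)
  have FR: "(\<lambda>s. F ((R ^^ l) s)) \<in> measurable S E" for l
    using measurable_compose[OF Rl F] .
  have F\<theta>: "(\<lambda>\<omega>. F (\<theta> \<omega>)) \<in> measurable M E" using measurable_compose[OF \<theta> F] .
  have "emeasure M {\<omega> \<in> space M. \<forall>l<n. F ((R ^^ l) (\<theta> \<omega>)) \<in> A l} = (\<Prod>l<n. emeasure M {\<omega> \<in> space M. F (\<theta> \<omega>) \<in> A l})"
    if "\<forall>l<n. A l \<in> sets E" for n A
    using that
  proof (induction n arbitrary: A)
    case 0
    then show ?case by (simp add: M.emeasure_space_1)
  next
    case (Suc n)
    let ?C = "{s \<in> space S. \<forall>l\<in>{..<n}. F ((R ^^ l) s) \<in> A (Suc l)}"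
    have C: "?C \<in> sets S"
    proof (intro sets.sets_Collect_finite_All)
      fix l assume "l \<in> {..<n}"
      then show "{s \<in> space S. F ((R ^^ l) s) \<in> A (Suc l)} \<in> sets S"
        using Suc.prems by (intro sets_Collect_mem[OF FR]) auto
    qed simp
    have "{\<omega> \<in> space M. \<forall>l<Suc n. F ((R ^^ l) (\<theta> \<omega>)) \<in> A l} = {\<omega> \<in> space M. F (\<theta> \<omega>) \<in> A 0 \<and> R (\<theta> \<omega>) \<in> ?C}"
      using measurable_space[OF measurable_compose[OF \<theta> R]]
      by (auto simp: All_less_Suc2 funpow_swap1)
    also have "emeasure M \<dots> = emeasure M {\<omega> \<in> space M. F (\<theta> \<omega>) \<in> A 0} * emeasure M {\<omega> \<in> space M. \<theta> \<omega> \<in> ?C}"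
      using Suc.prems C by (intro renew) auto
    also have "{\<omega> \<in> space M. \<theta> \<omega> \<in> ?C} = {\<omega> \<in> space M. \<forall>l<n. F ((R ^^ l) (\<theta> \<omega>)) \<in> A (Suc l)}"
      using measurable_space[OF \<theta>] by auto
    also have "emeasure M \<dots> = (\<Prod>l<n. emeasure M {\<omega> \<in> space M. F (\<theta> \<omega>) \<in> A (Suc l)})"
      using Suc.prems by (intro Suc.IH) auto
    finally show ?case by (subst prod.lessThan_Suc_shift) simp
  qed
  note emeas = this
  have "measure M {\<omega> \<in> space M. \<forall>l<n. F ((R ^^ l) (\<theta> \<omega>)) \<in> A l} = (\<Prod>l<n. measure ?Q (A l))"
    if A: "\<forall>l<n. A l \<in> sets E" for n A
  proof -
    have "measure ?Q (A l) = measure M {\<omega> \<in> space M. F (\<theta> \<omega>) \<in> A l}" if "l < n" for l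
      using A that F\<theta> by (simp add: measure_distr vimage_def Int_def conj_commute)
    then have "(\<Prod>l<n. measure ?Q (A l)) = (\<Prod>l<n. measure M {\<omega> \<in> space M. F (\<theta> \<omega>) \<in> A l})" by simp
    moreover have "ennreal (measure M {\<omega> \<in> space M. \<forall>l<n. F ((R ^^ l) (\<theta> \<omega>)) \<in> A l}) = ennreal (\<Prod>l<n. measure M {\<omega> \<in> space M. F (\<theta> \<omega>) \<in> A l})"
      using emeas[OF A] by (simp add: M.emeasure_eq_measure prod_ennreal)
    ultimately show ?thesis by (simp add: prod_nonneg)
  qed
  then show ?thesis
    unfolding iid_seq_def using measurable_compose[OF \<theta> FR] by simp
qed

subsection \<open>Laws of large numbers\<close>

lemma (in prob_space) indep_second_moment_sum:
  fixes X :: "'i \<Rightarrow> 'a \<Rightarrow> real"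
  assumes "finite I" "indep_vars (\<lambda>_. borel) X I"
    and "\<And>i. i \<in> I \<Longrightarrow> integrable M (X i)" "\<And>i. i \<in> I \<Longrightarrow> integrable M (\<lambda>\<omega>. (X i \<omega>)\<^sup>2)"
    and "\<And>i. i \<in> I \<Longrightarrow> expectation (X i) = 0"
  shows "integrable M (\<lambda>\<omega>. (\<Sum>i\<in>I. X i \<omega>)\<^sup>2) \<and>
    expectation (\<lambda>\<omega>. (\<Sum>i\<in>I. X i \<omega>)\<^sup>2) = (\<Sum>i\<in>I. expectation (\<lambda>\<omega>. (X i \<omega>)\<^sup>2))"
  using assms
proof (induction I rule: finite_induct)
  case (insert i I)
  have IH: "integrable M (\<lambda>\<omega>. (\<Sum>i\<in>I. X i \<omega>)\<^sup>2)"
    "expectation (\<lambda>\<omega>. (\<Sum>i\<in>I. X i \<omega>)\<^sup>2) = (\<Sum>i\<in>I. expectation (\<lambda>\<omega>. (X i \<omega>)\<^sup>2))"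
    using insert.IH indep_vars_subset[OF insert.prems(1), of I] insert.prems by auto
  have ind: "indep_var borel (X i) borel (\<lambda>\<omega>. \<Sum>i\<in>I. X i \<omega>)"
    by (rule indep_vars_sum[OF insert.hyps(1,2) insert.prems(1)])
  have int: "integrable M (X i)" "integrable M (\<lambda>\<omega>. \<Sum>i\<in>I. X i \<omega>)"
    using insert.prems by auto
  have cross: "integrable M (\<lambda>\<omega>. X i \<omega> * (\<Sum>i\<in>I. X i \<omega>))"
    "expectation (\<lambda>\<omega>. X i \<omega> * (\<Sum>i\<in>I. X i \<omega>)) = 0"
    using indep_var_integrable[OF ind int] indep_var_lebesgue_integral[OF ind int] insert.prems by auto
  have eq: "(\<Sum>j\<in>insert i I. X j \<omega>)\<^sup>2 = (X i \<omega>)\<^sup>2 + 2 * (X i \<omega> * (\<Sum>i\<in>I. X i \<omega>)) + (\<Sum>i\<in>I. X i \<omega>)\<^sup>2" for \<omega>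
    using insert.hyps by (simp add: power2_sum algebra_simps)
  show ?case
    unfolding eq using IH cross insert.prems insert.hyps by simp
qed simp

lemma (in prob_space) second_moment_tail:
  fixes f :: "'a \<Rightarrow> real"
  assumes [measurable]: "f \<in> borel_measurable M" and int: "integrable M (\<lambda>\<omega>. (f \<omega>)\<^sup>2)" and a: "a > 0"
  shows "prob {\<omega> \<in> space M. a \<le> \<bar>f \<omega>\<bar>} \<le> expectation (\<lambda>\<omega>. (f \<omega>)\<^sup>2) / a\<^sup>2"
proof -
  have "{\<omega> \<in> space M. a \<le> \<bar>f \<omega>\<bar>} = {\<omega> \<in> space M. a\<^sup>2 \<le> (f \<omega>)\<^sup>2}"
    using a by (auto simp flip: abs_le_square_iff)
  then show ?thesis
    using integral_Markov_inequality_measure[OF int, of "{}" "a\<^sup>2"] a by simp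
qed

text \<open>\<open>A k\<close> is the event that the partial sums reach the level
  \<open>2 * a\<close> for the first time at \<open>k\<close>. It is independent of the remaining
  increments, whose sum is below \<open>a\<close> with probability at least 1/2 (event
  \<open>C k\<close>). On both events the full sum is still at least \<open>a\<close>, and the sets
  \<open>A k\<close> are disjoint.\<close>

theorem (in prob_space) ottaviani:
  fixes X :: "nat \<Rightarrow> 'a \<Rightarrow> real"
  assumes ind: "indep_vars (\<lambda>_. borel) X {..<n}" and half: "\<And>k. k \<le> n \<Longrightarrow> prob {\<omega> \<in> space M. a \<le> \<bar>\<Sum>i=k..<n. X i \<omega>\<bar>} \<le> 1/2"
  shows "prob {\<omega> \<in> space M. \<exists>k\<le>n. 2 * a \<le> \<bar>\<Sum>i<k. X i \<omega>\<bar>} \<le> 2 * prob {\<omega> \<in> space M. a \<le> \<bar>\<Sum>i<n. X i \<omega>\<bar>}"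
proof -
  have X [measurable]: "X i \<in> borel_measurable M" if "i < n" for i
    using ind that by (auto simp: indep_vars_def2)
  let ?S = "\<lambda>k \<omega>. \<Sum>i<k. X i \<omega>"
  have S [measurable]: "?S k \<in> borel_measurable M" if "k \<le> n" for k
    using that by (intro borel_measurable_sum X) auto
  have R [measurable]: "(\<lambda>\<omega>. \<Sum>i=k..<n. X i \<omega>) \<in> borel_measurable M" for k
    by (intro borel_measurable_sum X) auto
  define A where "A k = {\<omega> \<in> space M. 2 * a \<le> \<bar>?S k \<omega>\<bar> \<and> (\<forall>j<k. \<bar>?S j \<omega>\<bar> < 2 * a)}" for k
  define C where "C k = {\<omega> \<in> space M. \<bar>\<Sum>i=k..<n. X i \<omega>\<bar> < a}" for k
  have Am: "A k \<in> events" if "k \<le> n" for k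
  proof -
    have "{\<omega> \<in> space M. \<forall>j\<in>{..<k}. \<bar>?S j \<omega>\<bar> < 2 * a} \<in> events"
    proof (intro sets.sets_Collect_finite_All)
      fix j assume "j \<in> {..<k}"
      then have "?S j \<in> borel_measurable M" using that by (intro S) auto
      then show "{\<omega> \<in> space M. \<bar>?S j \<omega>\<bar> < 2 * a} \<in> events" by measurable
    qed simp
    moreover have "{\<omega> \<in> space M. 2 * a \<le> \<bar>?S k \<omega>\<bar>} \<in> events" using S[OF that] by measurable
    moreover have "A k = {\<omega> \<in> space M. 2 * a \<le> \<bar>?S k \<omega>\<bar>} \<inter> {\<omega> \<in> space M. \<forall>j\<in>{..<k}. \<bar>?S j \<omega>\<bar> < 2 * a}"
      by (auto simp: A_def)
    ultimately show ?thesis by (simp only: sets.Int)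
  qed
  have Cm: "C k \<in> events" for k unfolding C_def using R[of k] by measurable
  have indAC: "prob (A k \<inter> C k) = prob (A k) * prob (C k)" if k: "k \<le> n" for k
  proof -
    have iv: "indep_var (PiM {..<k} (\<lambda>_. borel)) (\<lambda>\<omega>. \<lambda>i\<in>{..<k}. X i \<omega>) (PiM {k..<n} (\<lambda>_. borel)) (\<lambda>\<omega>. \<lambda>i\<in>{k..<n}. X i \<omega>)"
      using k by (intro indep_var_restrict[OF ind]) auto
    let ?A = "{d \<in> space (PiM {..<k} (\<lambda>_. borel)). 2 * a \<le> \<bar>\<Sum>i<k. d i\<bar> \<and> (\<forall>j\<in>{..<k}. \<bar>\<Sum>i<j. d i\<bar> < 2 * a)} :: (nat \<Rightarrow> real) set"
    let ?C = "{d \<in> space (PiM {k..<n} (\<lambda>_. borel)). \<bar>\<Sum>i=k..<n. d i\<bar> < a} :: (nat \<Rightarrow> real) set"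
    have sm: "(\<lambda>d. \<Sum>i<j. d i) \<in> borel_measurable (PiM {..<k} (\<lambda>_. borel :: real measure))" if "j \<le> k" for j
      using that by (intro borel_measurable_sum measurable_component_singleton) auto
    have A': "?A \<in> sets (PiM {..<k} (\<lambda>_. borel))"
    proof -
      have "{d \<in> space (PiM {..<k} (\<lambda>_. borel)). \<forall>j\<in>{..<k}. \<bar>\<Sum>i<j. d i\<bar> < 2 * a} \<in> sets (PiM {..<k} (\<lambda>_. borel :: real measure))"
      proof (intro sets.sets_Collect_finite_All)
        fix j assume "j \<in> {..<k}"
        then have "(\<lambda>d. \<Sum>i<j. d i) \<in> borel_measurable (PiM {..<k} (\<lambda>_. borel :: real measure))" by (intro sm) auto
        then show "{d \<in> space (PiM {..<k} (\<lambda>_. borel)). \<bar>\<Sum>i<j. d i\<bar> < 2 * a} \<in> sets (PiM {..<k} (\<lambda>_. borel :: real measure))"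
          by measurable
      qed simp
      moreover have "{d \<in> space (PiM {..<k} (\<lambda>_. borel)). 2 * a \<le> \<bar>\<Sum>i<k. d i\<bar>} \<in> sets (PiM {..<k} (\<lambda>_. borel :: real measure))"
        using sm[of k] by measurable
      moreover have "?A = {d \<in> space (PiM {..<k} (\<lambda>_. borel)). 2 * a \<le> \<bar>\<Sum>i<k. d i\<bar>} \<inter>
         {d \<in> space (PiM {..<k} (\<lambda>_. borel)). \<forall>j\<in>{..<k}. \<bar>\<Sum>i<j. d i\<bar> < 2 * a}" by blast
      ultimately show ?thesis by (simp only: sets.Int)
    qed
    have C': "?C \<in> sets (PiM {k..<n} (\<lambda>_. borel))"
    proof -
      have "(\<lambda>d. \<Sum>i=k..<n. d i) \<in> borel_measurable (PiM {k..<n} (\<lambda>_. borel :: real measure))"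
        by (intro borel_measurable_sum measurable_component_singleton) auto
      then show ?thesis by measurable
    qed
    have eS: "(\<Sum>i<j. (\<lambda>i\<in>{..<k}. X i \<omega>) i) = ?S j \<omega>" if "j \<le> k" for j \<omega>
      using that by (intro sum.cong) auto
    have eR: "(\<Sum>i=k..<n. (\<lambda>i\<in>{k..<n}. X i \<omega>) i) = (\<Sum>i=k..<n. X i \<omega>)" for \<omega>
      by (intro sum.cong) auto
    have eA: "(\<lambda>\<omega>. \<lambda>i\<in>{..<k}. X i \<omega>) -` ?A \<inter> space M = A k"
    proof -
      have "(\<lambda>i\<in>{..<k}. X i \<omega>) \<in> ?A \<longleftrightarrow> 2 * a \<le> \<bar>?S k \<omega>\<bar> \<and> (\<forall>j<k. \<bar>?S j \<omega>\<bar> < 2 * a)" for \<omega>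
        by (simp only: mem_Collect_eq eS order.refl) (auto simp: eS space_PiM)
      then show ?thesis unfolding A_def by blast
    qed
    have eC: "(\<lambda>\<omega>. \<lambda>i\<in>{k..<n}. X i \<omega>) -` ?C \<inter> space M = C k"
    proof -
      have "(\<lambda>i\<in>{k..<n}. X i \<omega>) \<in> ?C \<longleftrightarrow> \<bar>\<Sum>i=k..<n. X i \<omega>\<bar> < a" for \<omega>
        by (simp only: mem_Collect_eq eR) (auto simp: space_PiM)
      then show ?thesis unfolding C_def by blast
    qed
    have "(\<lambda>\<omega>. (\<lambda>i\<in>{..<k}. X i \<omega>, \<lambda>i\<in>{k..<n}. X i \<omega>)) -` (?A \<times> ?C) \<inter> space M = A k \<inter> C k"
      unfolding eA[symmetric] eC[symmetric] by blast
    then show ?thesis using indep_varD[OF iv A' C'] unfolding eA eC by (simp only:)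
  qed
  have half': "1/2 \<le> prob (C k)" if "k \<le> n" for k
  proof -
    have "C k = space M - {\<omega> \<in> space M. a \<le> \<bar>\<Sum>i=k..<n. X i \<omega>\<bar>}" by (auto simp: C_def)
    moreover have "{\<omega> \<in> space M. a \<le> \<bar>\<Sum>i=k..<n. X i \<omega>\<bar>} \<in> events" using R[of k] by measurable
    ultimately show ?thesis using half[OF that] by (simp add: prob_compl)
  qed
  have disj: "disjoint_family_on A {..n}"
  proof -
    have "A i \<inter> A j = {}" if "i < j" for i j using that by (force simp: A_def)
    then show ?thesis unfolding disjoint_family_on_def by (metis Int_commute nat_neq_iff)
  qed
  have U: "{\<omega> \<in> space M. \<exists>k\<le>n. 2 * a \<le> \<bar>?S k \<omega>\<bar>} = (\<Union>k\<in>{..n}. A k)"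
  proof (intro equalityI subsetI)
    fix \<omega> assume "\<omega> \<in> {\<omega> \<in> space M. \<exists>k\<le>n. 2 * a \<le> \<bar>?S k \<omega>\<bar>}"
    then obtain k where k: "\<omega> \<in> space M" "k \<le> n" "2 * a \<le> \<bar>?S k \<omega>\<bar>" by auto
    define k0 where "k0 = (LEAST k. 2 * a \<le> \<bar>?S k \<omega>\<bar>)"
    have "2 * a \<le> \<bar>?S k0 \<omega>\<bar>" unfolding k0_def using k(3) by (rule LeastI)
    moreover have "k0 \<le> k" unfolding k0_def using k(3) by (rule Least_le)
    moreover have "\<bar>?S j \<omega>\<bar> < 2 * a" if "j < k0" for j
      using not_less_Least[of j "\<lambda>k. 2 * a \<le> \<bar>?S k \<omega>\<bar>"] that unfolding k0_def by simp
    ultimately show "\<omega> \<in> (\<Union>k\<in>{..n}. A k)" using k by (auto simp: A_def intro!: bexI[of _ k0])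
  qed (auto simp: A_def)
  have "prob {\<omega> \<in> space M. \<exists>k\<le>n. 2 * a \<le> \<bar>?S k \<omega>\<bar>} = (\<Sum>k\<le>n. prob (A k))"
    unfolding U using Am disj by (intro finite_measure_finite_Union) auto
  also have "\<dots> \<le> (\<Sum>k\<le>n. 2 * prob (A k \<inter> C k))"
  proof (rule sum_mono)
    fix k assume "k \<in> {..n}"
    then have k: "k \<le> n" by simp
    have "prob (A k) * 1 \<le> prob (A k) * (2 * prob (C k))" using half'[OF k] by (intro mult_left_mono) auto
    then show "prob (A k) \<le> 2 * prob (A k \<inter> C k)" unfolding indAC[OF k] by simp
  qed
  also have "\<dots> = 2 * prob (\<Union>k\<in>{..n}. A k \<inter> C k)"
  proof -
    have "disjoint_family_on (\<lambda>k. A k \<inter> C k) {..n}" using disj unfolding disjoint_family_on_def by blast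
    then have "(\<Sum>k\<le>n. prob (A k \<inter> C k)) = prob (\<Union>k\<in>{..n}. A k \<inter> C k)"
      using Am Cm by (intro finite_measure_finite_Union[symmetric]) auto
    then show ?thesis by (simp add: sum_distrib_left[symmetric])
  qed
  also have "\<dots> \<le> 2 * prob {\<omega> \<in> space M. a \<le> \<bar>?S n \<omega>\<bar>}"
  proof -
    have "(\<Union>k\<in>{..n}. A k \<inter> C k) \<subseteq> {\<omega> \<in> space M. a \<le> \<bar>?S n \<omega>\<bar>}"
    proof
      fix \<omega> assume "\<omega> \<in> (\<Union>k\<in>{..n}. A k \<inter> C k)"
      then obtain k where k: "k \<le> n" "\<omega> \<in> A k" "\<omega> \<in> C k" by auto
      have "?S n \<omega> = ?S k \<omega> + (\<Sum>i=k..<n. X i \<omega>)"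
        using sum.atLeastLessThan_concat[of 0 k n "\<lambda>i. X i \<omega>"] k(1) by (simp add: atLeast0LessThan)
      then show "\<omega> \<in> {\<omega> \<in> space M. a \<le> \<bar>?S n \<omega>\<bar>}" using k by (auto simp: A_def C_def)
    qed
    moreover have "{\<omega> \<in> space M. a \<le> \<bar>?S n \<omega>\<bar>} \<in> events" using S[of n] by measurable
    ultimately show ?thesis by (simp add: finite_measure_mono)
  qed
  finally show ?thesis .
qed

text \<open>Chebyshev bounds every block sum by the total variance over \<open>a\<close> squared. If
  this is at most 1/2, Ottaviani's inequality applies; otherwise the right-hand side exceeds 1 and
  there is nothing to show.\<close>

corollary (in prob_space) maximal_second_moment:
  fixes X :: "nat \<Rightarrow> 'a \<Rightarrow> real"
  assumes ind: "indep_vars (\<lambda>_. borel) X {..<n}" and a: "a > 0"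
    and X: "\<And>i. i < n \<Longrightarrow> integrable M (X i)" "\<And>i. i < n \<Longrightarrow> integrable M (\<lambda>\<omega>. (X i \<omega>)\<^sup>2)"
      "\<And>i. i < n \<Longrightarrow> expectation (X i) = 0"
  shows "prob {\<omega> \<in> space M. \<exists>k\<le>n. 2 * a \<le> \<bar>\<Sum>i<k. X i \<omega>\<bar>} \<le> 2 * (\<Sum>i<n. expectation (\<lambda>\<omega>. (X i \<omega>)\<^sup>2)) / a\<^sup>2"
proof -
  let ?V = "\<Sum>i<n. expectation (\<lambda>\<omega>. (X i \<omega>)\<^sup>2)"
  have tail: "prob {\<omega> \<in> space M. a \<le> \<bar>\<Sum>i\<in>I. X i \<omega>\<bar>} \<le> ?V / a\<^sup>2" if I: "I \<subseteq> {..<n}" for I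
  proof -
    have fin: "finite I" using I finite_subset by blast
    have m: "integrable M (\<lambda>\<omega>. (\<Sum>i\<in>I. X i \<omega>)\<^sup>2)"
      "expectation (\<lambda>\<omega>. (\<Sum>i\<in>I. X i \<omega>)\<^sup>2) = (\<Sum>i\<in>I. expectation (\<lambda>\<omega>. (X i \<omega>)\<^sup>2))"
      using indep_second_moment_sum[OF fin indep_vars_subset[OF ind I]] X I by auto
    have "(\<lambda>\<omega>. \<Sum>i\<in>I. X i \<omega>) \<in> borel_measurable M"
      using X(1) I by (intro borel_measurable_sum) auto
    from second_moment_tail[OF this m(1) a]
    have "prob {\<omega> \<in> space M. a \<le> \<bar>\<Sum>i\<in>I. X i \<omega>\<bar>} \<le> (\<Sum>i\<in>I. expectation (\<lambda>\<omega>. (X i \<omega>)\<^sup>2)) / a\<^sup>2"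
      unfolding m(2) .
    also have "\<dots> \<le> ?V / a\<^sup>2"
      using I by (intro divide_right_mono sum_mono2) auto
    finally show ?thesis .
  qed
  show ?thesis
  proof (cases "?V / a\<^sup>2 \<le> 1/2")
    case True
    have "prob {\<omega> \<in> space M. \<exists>k\<le>n. 2 * a \<le> \<bar>\<Sum>i<k. X i \<omega>\<bar>} \<le> 2 * prob {\<omega> \<in> space M. a \<le> \<bar>\<Sum>i<n. X i \<omega>\<bar>}"
    proof (rule ottaviani[OF ind])
      fix k show "prob {\<omega> \<in> space M. a \<le> \<bar>\<Sum>i=k..<n. X i \<omega>\<bar>} \<le> 1/2"
        by (rule order_trans[OF tail True]) auto
    qed
    also have "\<dots> \<le> 2 * ?V / a\<^sup>2" using tail[of "{..<n}"] by simp
    finally show ?thesis .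
  next
    case False
    then have "1 \<le> 2 * (?V / a\<^sup>2)" by linarith
    then have "1 \<le> 2 * ?V / a\<^sup>2" by (simp only: times_divide_eq_right)
    then show ?thesis by (rule order_trans[OF prob_le_1])
  qed
qed

text \<open>For \<open>t \<ge> 1\<close> the least power of two above \<open>t\<close> is at most
  \<open>2 * t\<close>, so a bound relative to that power is a bound relative to \<open>t\<close>
  with an extra factor 2. Starting from \<open>e/4\<close> gives \<open>e * t / 2\<close>, strictly
  below \<open>e * t\<close>.\<close>

lemma tendsto_over_id_of_dyadic_bound:
  fixes f :: "real \<Rightarrow> real"
  assumes "\<And>e. e > 0 \<Longrightarrow> \<forall>\<^sub>F m in sequentially. \<forall>s. 0 \<le> s \<longrightarrow> s \<le> 2 ^ m \<longrightarrow> \<bar>f s\<bar> \<le> e * 2 ^ m"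
  shows "((\<lambda>t. f t / t) \<longlongrightarrow> 0) at_top"
proof (rule tendstoI)
  fix e :: real assume e: "e > 0"
  obtain m0 where m0: "\<And>m s. m \<ge> m0 \<Longrightarrow> 0 \<le> s \<Longrightarrow> s \<le> 2 ^ m \<Longrightarrow> \<bar>f s\<bar> \<le> (e/4) * 2 ^ m"
    using assms[of "e/4"] e by (auto simp: eventually_sequentially)
  show "\<forall>\<^sub>F t in at_top. dist (f t / t) 0 < e"
    using eventually_ge_at_top[of "2 ^ m0 :: real"]
  proof eventually_elim
    fix t :: real assume t: "2 ^ m0 \<le> t"
    then have t1: "1 \<le> t" using one_le_power[of "2::real" m0] by linarith
    obtain m1 where "t < 2 ^ m1" using real_arch_pow[of 2 t] by auto
    define m where "m = (LEAST m. t \<le> 2 ^ m)"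
    have m: "t \<le> 2 ^ m" unfolding m_def using \<open>t < 2 ^ m1\<close> by (intro LeastI[of "\<lambda>m. t \<le> 2 ^ m" m1]) simp
    have "m0 \<le> m"
    proof (rule ccontr)
      assume "\<not> m0 \<le> m"
      then have "(2::real) ^ m < 2 ^ m0" by (intro power_strict_increasing) auto
      then show False using t m by linarith
    qed
    have b: "\<bar>f t\<bar> \<le> (e/4) * 2 ^ m" using m0[OF \<open>m0 \<le> m\<close> _ m] t1 by simp
    have "2 ^ m \<le> 2 * t"
    proof (cases m)
      case (Suc m')
      then have "\<not> t \<le> 2 ^ m'" using not_less_Least[of m' "\<lambda>m. t \<le> 2 ^ m"] by (simp add: m_def)
      then show ?thesis using Suc by simp
    qed (use t1 in simp)
    then have "(e/4) * 2 ^ m \<le> (e/4) * (2 * t)" using e by (intro mult_left_mono) auto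
    moreover have "(e/4) * (2 * t) = e * t / 2" by simp
    moreover have "0 < e * t" using e t1 by simp
    ultimately have "\<bar>f t\<bar> < e * t" using b by linarith
    then show "dist (f t / t) 0 < e" using t1 by (simp add: abs_divide divide_less_eq)
  qed
qed

text \<open>\<open>G m a\<close> is the bad event for the level \<open>a\<close> on the time
  interval up to \<open>2 ^ m\<close>. At the level \<open>a = e * 2 ^ m\<close> its probability is
  at most a constant times \<open>(1/2) ^ m\<close>, which is summable, and Borel-Cantelli applies.
  Random walks and Brownian motion share this argument and differ only in \<open>G\<close>.\<close>

lemma (in prob_space) AE_tendsto_of_dyadic_tail:
  fixes f :: "real \<Rightarrow> 'a \<Rightarrow> real"
  assumes ev: "\<And>m a. a > 0 \<Longrightarrow> G m a \<in> events"
    and pr: "\<And>m a. a > 0 \<Longrightarrow> prob (G m a) \<le> c * 2 ^ m / a\<^sup>2"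
    and G: "AE \<omega> in M. \<forall>m a s. a > 0 \<longrightarrow> \<omega> \<notin> G m a \<longrightarrow> 0 \<le> s \<longrightarrow> s \<le> 2 ^ m \<longrightarrow> \<bar>f s \<omega>\<bar> \<le> 2 * a"
  shows "AE \<omega> in M. ((\<lambda>t. f t \<omega> / t) \<longlongrightarrow> 0) at_top"
proof -
  have "AE \<omega> in M. \<forall>\<^sub>F m in sequentially. \<omega> \<in> space M - G m (e * 2 ^ m)" if e: "e > 0" for e :: real
  proof (rule borel_cantelli_AE1)
    fix m show "G m (e * 2 ^ m) \<in> events" using e by (intro ev) auto
    show "emeasure M (G m (e * 2 ^ m)) < \<infinity>" by (simp add: less_top[symmetric])
  next
    have bd: "prob (G m (e * 2 ^ m)) \<le> (c / e\<^sup>2) * (1/2) ^ m" for m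
    proof -
      have "prob (G m (e * 2 ^ m)) \<le> c * 2 ^ m / (e * 2 ^ m)\<^sup>2" using e by (intro pr) auto
      also have "\<dots> = (c / e\<^sup>2) * (1/2) ^ m" using e by (simp add: field_simps power2_eq_square power_divide)
      finally show ?thesis .
    qed
    have "summable (\<lambda>m. (c / e\<^sup>2) * (1/2::real) ^ m)"
      by (rule summable_mult[OF summable_geometric]) simp
    then show "summable (\<lambda>m. prob (G m (e * 2 ^ m)))"
    proof (rule summable_comparison_test'[of _ 0])
      fix m show "norm (prob (G m (e * 2 ^ m))) \<le> (c / e\<^sup>2) * (1/2) ^ m"
        unfolding real_norm_def abs_of_nonneg[OF measure_nonneg] by (rule bd)
    qed
  qed
  note BC = this
  \<comment> \<open>A single null set must serve all \<open>e\<close>, so \<open>e\<close> is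
    restricted to reciprocals of positive integers.\<close>
  have "AE \<omega> in M. \<forall>q::nat. \<forall>\<^sub>F m in sequentially. \<omega> \<in> space M - G m (1 / real (Suc q) * 2 ^ m)"
    unfolding AE_all_countable by (intro allI BC) simp
  then show ?thesis using G
  proof eventually_elim
    case (elim \<omega>)
    show ?case
    proof (rule tendsto_over_id_of_dyadic_bound)
      fix e :: real assume e: "e > 0"
      then obtain q where q: "1 / real (Suc q) < e / 2" using nat_approx_posE[of "e/2"] by auto
      show "\<forall>\<^sub>F m in sequentially. \<forall>s. 0 \<le> s \<longrightarrow> s \<le> 2 ^ m \<longrightarrow> \<bar>f s \<omega>\<bar> \<le> e * 2 ^ m"
        using elim(1)[rule_format, of q]
      proof eventually_elim
        fix m assume m: "\<omega> \<in> space M - G m (1 / real (Suc q) * 2 ^ m)"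
        show "\<forall>s. 0 \<le> s \<longrightarrow> s \<le> 2 ^ m \<longrightarrow> \<bar>f s \<omega>\<bar> \<le> e * 2 ^ m"
        proof (intro allI impI)
          fix s :: real assume s: "0 \<le> s" "s \<le> 2 ^ m"
          have "\<bar>f s \<omega>\<bar> \<le> 2 * (1 / real (Suc q) * 2 ^ m)"
            using elim(2)[rule_format, of "1 / real (Suc q) * 2 ^ m" m s] m s by simp
          also have "\<dots> = (2 * (1 / real (Suc q))) * 2 ^ m" by (simp only: mult.assoc)
          also have "\<dots> \<le> e * 2 ^ m" using q by (intro mult_right_mono) auto
          finally show "\<bar>f s \<omega>\<bar> \<le> e * 2 ^ m" .
        qed
      qed
    qed
  qed
qed


text \<open>Bounded variances give the dyadic tail bound through
  \<open>maximal_second_moment\<close>. The walk is read as a step function of real time so that the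
  continuous-time criterion covers it.\<close>

lemma (in prob_space) slln_centred:
  fixes X :: "nat \<Rightarrow> 'a \<Rightarrow> real"
  assumes ind: "indep_vars (\<lambda>_. borel) X UNIV"
    and X: "\<And>i. integrable M (X i)" "\<And>i. integrable M (\<lambda>\<omega>. (X i \<omega>)\<^sup>2)" "\<And>i. expectation (X i) = 0"
    and V: "\<And>i. expectation (\<lambda>\<omega>. (X i \<omega>)\<^sup>2) \<le> V"
  shows "AE \<omega> in M. (\<lambda>n. (\<Sum>i<n. X i \<omega>) / real n) \<longlonglongrightarrow> 0"
proof -
  have Xm [measurable]: "X i \<in> borel_measurable M" for i using X(1)[of i] by simp
  define G where "G m a = {\<omega> \<in> space M. \<exists>k\<le>2 ^ m. 2 * a \<le> \<bar>\<Sum>i<k. X i \<omega>\<bar>}" for m and a :: real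
  have "AE \<omega> in M. ((\<lambda>t. (\<Sum>i<nat \<lfloor>t\<rfloor>. X i \<omega>) / t) \<longlongrightarrow> 0) at_top"
  proof (rule AE_tendsto_of_dyadic_tail[where G=G and c="2 * V" and f="\<lambda>t \<omega>. \<Sum>i<nat \<lfloor>t\<rfloor>. X i \<omega>"])
    fix m and a :: real assume a: "a > 0"
    have "{\<omega> \<in> space M. \<exists>k\<in>{..2 ^ m}. 2 * a \<le> \<bar>\<Sum>i<k. X i \<omega>\<bar>} \<in> events"
      by (intro sets.sets_Collect_finite_Ex) auto
    then show "G m a \<in> events" unfolding G_def by (simp add: Bex_def conj_commute)
    have "prob (G m a) \<le> 2 * (\<Sum>i<2 ^ m. expectation (\<lambda>\<omega>. (X i \<omega>)\<^sup>2)) / a\<^sup>2"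
      unfolding G_def by (rule maximal_second_moment[OF indep_vars_subset[OF ind] a X]) auto
    also have "(\<Sum>i<2 ^ m. expectation (\<lambda>\<omega>. (X i \<omega>)\<^sup>2)) \<le> (\<Sum>i<(2::nat) ^ m. V)"
      by (intro sum_mono V)
    finally show "prob (G m a) \<le> 2 * V * 2 ^ m / a\<^sup>2"
      by (simp add: divide_right_mono mult_ac)
  next
    show "AE \<omega> in M. \<forall>m a s. a > 0 \<longrightarrow> \<omega> \<notin> G m a \<longrightarrow> 0 \<le> (s::real) \<longrightarrow> s \<le> 2 ^ m \<longrightarrow> \<bar>\<Sum>i<nat \<lfloor>s\<rfloor>. X i \<omega>\<bar> \<le> 2 * a"
    proof (rule AE_I2, intro allI impI)
      fix \<omega> m and a s :: real assume *: "\<omega> \<in> space M" "a > 0" "\<omega> \<notin> G m a" "0 \<le> s" "s \<le> 2 ^ m"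
      have "real (nat \<lfloor>s\<rfloor>) \<le> 2 ^ m" using of_nat_floor[OF *(4)] *(5) by linarith
      then have "real (nat \<lfloor>s\<rfloor>) \<le> real (2 ^ m)" by (simp only: of_nat_power of_nat_numeral)
      then have "nat \<lfloor>s\<rfloor> \<le> 2 ^ m" unfolding of_nat_le_iff .
      then have "\<not> 2 * a \<le> \<bar>\<Sum>i<nat \<lfloor>s\<rfloor>. X i \<omega>\<bar>" using *(1,3) unfolding G_def by blast
      then show "\<bar>\<Sum>i<nat \<lfloor>s\<rfloor>. X i \<omega>\<bar> \<le> 2 * a" by linarith
    qed
  qed
  then show ?thesis
  proof eventually_elim
    case (elim \<omega>)
    from filterlim_compose[OF elim filterlim_real_sequentially] show ?case by simp
  qed
qed

lemma (in prob_space) normal_second_moment: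
  assumes D: "distributed M lborel X (normal_density 0 \<sigma>)" and \<sigma>: "\<sigma> > 0"
  shows "integrable M X" "integrable M (\<lambda>\<omega>. (X \<omega>)\<^sup>2)" "expectation X = 0" "expectation (\<lambda>\<omega>. (X \<omega>)\<^sup>2) = \<sigma>\<^sup>2"
proof -
  have "integrable M (\<lambda>\<omega>. (X \<omega>) ^ k)" for k
    using integrable_normal_moment[OF \<sigma>, of 0 k] by (subst distributed_integrable[OF D, symmetric]) auto
  from this[of 1] this[of 2] show "integrable M X" "integrable M (\<lambda>\<omega>. (X \<omega>)\<^sup>2)" by simp_all
  show E: "expectation X = 0" by (rule normal_distributed_expectation[OF \<sigma> D])
  show "expectation (\<lambda>\<omega>. (X \<omega>)\<^sup>2) = \<sigma>\<^sup>2" using normal_distributed_variance[OF \<sigma> D] E by simp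
qed

text \<open>On the interval up to \<open>2 ^ m\<close> the path is observed on grids of mesh
  \<open>h m l\<close>. The increments form a walk of total variance \<open>2 ^ m\<close> for every
  \<open>l\<close>, so the maximal inequality is uniform in \<open>l\<close>. It survives the union
  over all refinements, and continuity carries it from the grid points to all times.\<close>

theorem (in prob_space) std_BM_sublinear:
  assumes W: "is_std_BM M W"
  shows "AE \<omega> in M. ((\<lambda>t. W t \<omega> / t) \<longlongrightarrow> 0) at_top"
proof -
  have Wm [measurable]: "W t \<in> borel_measurable M" for t by (rule is_std_BM_D(1)[OF W])
  define h where "h m l = (2 ^ m / 2 ^ l :: real)" for m l :: nat
  define G where "G m l a = {\<omega> \<in> space M. \<exists>k\<le>2 ^ l. 2 * a \<le> \<bar>W (real k * h m l) \<omega>\<bar>}" for m l and a :: real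
  have Gm: "G m l a \<in> events" for m l a
  proof -
    have "{\<omega> \<in> space M. \<exists>k\<in>{..2 ^ l}. 2 * a \<le> \<bar>W (real k * h m l) \<omega>\<bar>} \<in> events"
      by (intro sets.sets_Collect_finite_Ex) auto
    then show ?thesis unfolding G_def by (simp add: Bex_def conj_commute)
  qed
  have Gp: "prob (G m l a) \<le> 2 * 2 ^ m / a\<^sup>2" if a: "a > 0" for m l a
  proof -
    let ?n = "2 ^ l :: nat"
    have h: "h m l > 0" by (simp add: h_def)
    let ?X = "\<lambda>i \<omega>. W (real (Suc i) * h m l) \<omega> - W (real i * h m l) \<omega>"
    let ?ts = "map (\<lambda>i. real i * h m l) [0..<Suc ?n]"
    have nth: "?ts ! i = real i * h m l" if "i < Suc ?n" for i
      using that by (simp del: upt_Suc)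
    have len: "length ?ts - 1 = ?n" by (simp del: upt_Suc)
    have "sorted_wrt (<) ?ts" unfolding sorted_wrt_map
      using h by (intro sorted_wrt_mono_rel[OF _ sorted_wrt_upt]) auto
    moreover have "0 \<le> t" if "t \<in> set ?ts" for t using that h by (auto simp del: upt_Suc)
    ultimately have "indep_vars (\<lambda>_. borel) (\<lambda>i \<omega>. W (?ts ! Suc i) \<omega> - W (?ts ! i) \<omega>) {..<?n}"
      using is_std_BM_D(5)[OF W, of ?ts] unfolding len by blast
    also have "?this \<longleftrightarrow> indep_vars (\<lambda>_. borel) ?X {..<?n}"
      by (intro indep_vars_cong refl) (simp add: nth del: upt_Suc of_nat_Suc)
    finally have ind: "indep_vars (\<lambda>_. borel) ?X {..<?n}" .
    have D: "distributed M lborel (?X i) (normal_density 0 (sqrt (h m l)))" for i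
      using is_std_BM_D(4)[OF W, of "real i * h m l" "real (Suc i) * h m l"] h by (simp add: algebra_simps)
    have hs: "sqrt (h m l) > 0" using h by simp
    note mom = normal_second_moment[OF D hs]
    have S: "(\<Sum>i<k. ?X i \<omega>) = W (real k * h m l) \<omega>" if "\<omega> \<in> space M" for k \<omega>
      using sum_lessThan_telescope[of "\<lambda>i. W (real i * h m l) \<omega>" k] is_std_BM_D(2)[OF W that] by simp
    have "G m l a = {\<omega> \<in> space M. \<exists>k\<le>?n. 2 * a \<le> \<bar>\<Sum>i<k. ?X i \<omega>\<bar>}"
      unfolding G_def by (rule Collect_cong) (use S in \<open>auto simp del: of_nat_Suc\<close>)
    also have "prob \<dots> \<le> 2 * (\<Sum>i<?n. expectation (\<lambda>\<omega>. (?X i \<omega>)\<^sup>2)) / a\<^sup>2"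
      by (rule maximal_second_moment[OF ind a mom(1-3)])
    also have "(\<Sum>i<?n. expectation (\<lambda>\<omega>. (?X i \<omega>)\<^sup>2)) = 2 ^ m"
      unfolding mom(4) using h by (simp add: h_def)
    finally show ?thesis .
  qed
  \<comment> \<open>The grid point \<open>k\<close> of level \<open>l\<close> is the grid point
    \<open>2 * k\<close> of level \<open>Suc l\<close>.\<close>
  have inc: "incseq (\<lambda>l. G m l a)" for m a
  proof (rule incseq_SucI, rule subsetI)
    fix l \<omega> assume "\<omega> \<in> G m l a"
    then obtain k where k: "\<omega> \<in> space M" "k \<le> 2 ^ l" "2 * a \<le> \<bar>W (real k * h m l) \<omega>\<bar>" by (auto simp: G_def)
    moreover have "real (2 * k) * h m (Suc l) = real k * h m l" by (simp add: h_def)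
    moreover have "2 * k \<le> 2 ^ Suc l" using k(2) by simp
    ultimately show "\<omega> \<in> G m (Suc l) a" unfolding G_def by (metis (mono_tags, lifting) mem_Collect_eq)
  qed
  have "prob (\<Union>l. G m l a) \<le> 2 * 2 ^ m / a\<^sup>2" if a: "a > 0" for m a
  proof (rule LIMSEQ_le_const2)
    show "(\<lambda>l. prob (G m l a)) \<longlonglongrightarrow> prob (\<Union>l. G m l a)"
      using Gm inc by (intro finite_Lim_measure_incseq) auto
    show "\<exists>N. \<forall>l\<ge>N. prob (G m l a) \<le> 2 * 2 ^ m / a\<^sup>2" using Gp[OF a] by blast
  qed
  note UP = this
  show ?thesis
  proof (rule AE_tendsto_of_dyadic_tail[where G="\<lambda>m a. \<Union>l. G m l a" and c=2])
    show "(\<Union>l. G m l a) \<in> events" for m a using Gm by auto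
    show "prob (\<Union>l. G m l a) \<le> 2 * 2 ^ m / a\<^sup>2" if "a > 0" for m a by (rule UP[OF that])
    show "AE \<omega> in M. \<forall>m a s. a > 0 \<longrightarrow> \<omega> \<notin> (\<Union>l. G m l a) \<longrightarrow> 0 \<le> s \<longrightarrow> s \<le> 2 ^ m \<longrightarrow> \<bar>W s \<omega>\<bar> \<le> 2 * a"
      using is_std_BM_D(3)[OF W] AE_space
    proof eventually_elim
      case (elim \<omega>)
      show ?case
      proof (intro allI impI)
        fix m and a s :: real assume *: "a > 0" "\<omega> \<notin> (\<Union>l. G m l a)" "0 \<le> s" "s \<le> 2 ^ m"
        \<comment> \<open>The last grid point of level \<open>l\<close> not after \<open>s\<close>.
          These points stay below \<open>2 ^ m\<close> and converge to \<open>s\<close>.\<close>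
        define k where "k l = nat \<lfloor>s / h m l\<rfloor>" for l
        have h: "h m l > 0" for l by (simp add: h_def)
        have k1: "real (k l) * h m l \<le> s" for l
        proof -
          have "real (k l) \<le> s / h m l" using *(3) h[of l] unfolding k_def by (intro of_nat_floor) simp
          then show ?thesis using h[of l] by (simp add: field_simps)
        qed
        have k2: "s - h m l \<le> real (k l) * h m l" for l
        proof -
          have "s / h m l - 1 \<le> real (k l)" using *(3) h[of l] unfolding k_def by linarith
          then have "(s / h m l - 1) * h m l \<le> real (k l) * h m l" using h[of l] by (intro mult_right_mono) auto
          then show ?thesis using h[of l] by (simp add: left_diff_distrib)
        qed
        have k3: "k l \<le> 2 ^ l" for l
        proof -
          have "s / h m l \<le> 2 ^ l" using *(4) by (simp add: h_def field_simps)
          moreover have "real (k l) \<le> s / h m l" using *(3) h[of l] unfolding k_def by (intro of_nat_floor) simp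
          ultimately have "real (k l) \<le> 2 ^ l" by linarith
          then have "real (k l) \<le> real (2 ^ l)" by (simp only: of_nat_power of_nat_numeral)
          then show ?thesis unfolding of_nat_le_iff .
        qed
        have "(\<lambda>l. s - h m l) \<longlonglongrightarrow> s - 0"
        proof -
          have "(\<lambda>l. 2 ^ m * (1/2::real) ^ l) \<longlonglongrightarrow> 2 ^ m * 0"
            by (intro tendsto_intros LIMSEQ_power_zero) simp
          then show ?thesis by (intro tendsto_intros) (simp add: h_def power_divide)
        qed
        then have lim: "(\<lambda>l. s - h m l) \<longlonglongrightarrow> s" by (simp only: diff_zero)
        have "(\<lambda>l. real (k l) * h m l) \<longlonglongrightarrow> s"
          by (rule tendsto_sandwich[OF always_eventually always_eventually lim tendsto_const]) (use k1 k2 in blast)+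
        then have "(\<lambda>l. W (real (k l) * h m l) \<omega>) \<longlonglongrightarrow> W s \<omega>"
        proof (rule continuous_on_tendsto_compose[OF elim(1)])
          show "s \<in> {0..}" using *(3) by simp
          have "real (k l) * h m l \<in> {0..}" for l using h[of l] by simp
          then show "\<forall>\<^sub>F l in sequentially. real (k l) * h m l \<in> {0..}" by (simp only: eventually_True)
        qed
        then have "(\<lambda>l. \<bar>W (real (k l) * h m l) \<omega>\<bar>) \<longlonglongrightarrow> \<bar>W s \<omega>\<bar>" by (rule tendsto_rabs)
        moreover have "\<bar>W (real (k l) * h m l) \<omega>\<bar> \<le> 2 * a" for l
        proof -
          have "\<omega> \<notin> G m l a" using *(2) by blast
          then have "\<not> 2 * a \<le> \<bar>W (real (k l) * h m l) \<omega>\<bar>" using k3[of l] elim(2) unfolding G_def by blast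
          then show ?thesis by linarith
        qed
        ultimately show "\<bar>W s \<omega>\<bar> \<le> 2 * a" by (intro LIMSEQ_le_const2) auto
      qed
    qed
  qed
qed

theorem ingredients_lln:
  assumes I: "ingredients M N g k B" and N: "N > 0"
  shows "AE \<omega> in M. (\<lambda>n. (\<Sum>i<n. g i \<omega>) / real n) \<longlonglongrightarrow> 1 / real N"
    and "r \<in> {1..N} \<Longrightarrow> AE \<omega> in M. (\<lambda>n. (\<Sum>i<n. of_bool (k i \<omega> = r)) / real n) \<longlonglongrightarrow> 1 / real N"
    and "n \<in> {1..N} \<Longrightarrow> AE \<omega> in M. ((\<lambda>t. B n t \<omega> / t) \<longlongrightarrow> 0) at_top"
proof -
  interpret prob_space M by (rule ingredientsD(1)[OF I])
  have aux: "AE \<omega> in M. (\<lambda>n. (\<Sum>i<n. Y i \<omega>) / real n) \<longlonglongrightarrow> c"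
    if Y: "indep_vars (\<lambda>_. borel) Y UNIV" "\<And>i. integrable M (Y i)" "\<And>i. integrable M (\<lambda>\<omega>. (Y i \<omega>)\<^sup>2)"
      "\<And>i. expectation (Y i) = c" "\<And>i. variance (Y i) \<le> V" for Y :: "nat \<Rightarrow> 'a \<Rightarrow> real" and c V
  proof -
    have sq: "(Y i \<omega> - c)\<^sup>2 = (Y i \<omega>)\<^sup>2 - 2 * c * Y i \<omega> + c\<^sup>2" for i \<omega>
      by (simp add: power2_diff mult_ac)
    have "AE \<omega> in M. (\<lambda>n. (\<Sum>i<n. Y i \<omega> - c) / real n) \<longlonglongrightarrow> 0"
    proof (rule slln_centred[where V=V])
      show "indep_vars (\<lambda>_. borel) (\<lambda>i \<omega>. Y i \<omega> - c) UNIV"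
        by (rule indep_vars_compose2[OF Y(1)]) simp
      show "integrable M (\<lambda>\<omega>. Y i \<omega> - c)" "integrable M (\<lambda>\<omega>. (Y i \<omega> - c)\<^sup>2)" for i
        using Y(2,3)[of i] unfolding sq by auto
      show "expectation (\<lambda>\<omega>. Y i \<omega> - c) = 0" for i using Y(2,4)[of i] by (simp add: prob_space)
      show "expectation (\<lambda>\<omega>. (Y i \<omega> - c)\<^sup>2) \<le> V" for i using Y(5)[of i] Y(4)[of i] by simp
    qed
    then show ?thesis
    proof eventually_elim
      case (elim \<omega>)
      have "(\<lambda>n. (\<Sum>i<n. Y i \<omega> - c) / real n + c) \<longlonglongrightarrow> 0 + c" by (intro tendsto_intros elim)
      moreover have "\<forall>\<^sub>F n in sequentially. (\<Sum>i<n. Y i \<omega> - c) / real n + c = (\<Sum>i<n. Y i \<omega>) / real n"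
        using eventually_gt_at_top[of 0] by eventually_elim (simp add: sum_subtractf field_simps)
      ultimately show ?case by (simp add: tendsto_cong)
    qed
  qed
  show "AE \<omega> in M. (\<lambda>n. (\<Sum>i<n. g i \<omega>) / real n) \<longlonglongrightarrow> 1 / real N"
  proof (rule aux[of g "1 / real N" "1 / (real N)\<^sup>2"])
    have "indep_vars (\<lambda>_. Path) (ing_path g k B) (range Inl)"
      by (rule indep_vars_subset[OF ingredientsD(7)[OF I]]) auto
    then have "indep_vars (\<lambda>_. Path) (\<lambda>i. ing_path g k B (Inl i)) UNIV"
      by (rule indep_vars_reindex) simp
    from indep_vars_compose2[OF this, of "\<lambda>_ p. p 0" "\<lambda>_. borel"]
    show "indep_vars (\<lambda>_. borel) g UNIV" by (simp add: ing_path_simps traj_def)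
    fix i
    have D: "distributed M lborel (g i) (erlang_density 0 (real N))"
      using ingredientsD(2)[OF I, of i] by (simp add: exponential_density_def[abs_def] erlang_density_def)
    show "integrable M (g i)" "integrable M (\<lambda>\<omega>. (g i \<omega>)\<^sup>2)"
      using erlang_ith_moment_integrable[OF _ D, of 1] erlang_ith_moment_integrable[OF _ D, of 2] N by simp_all
    show "expectation (g i) = 1 / real N" using N by (intro exponential_distributed_expectation ingredientsD[OF I]) simp
    show "variance (g i) \<le> 1 / (real N)\<^sup>2"
      using exponential_distributed_variance[OF _ ingredientsD(2)[OF I, of i]] N by simp
  qed
  show "AE \<omega> in M. (\<lambda>n. (\<Sum>i<n. of_bool (k i \<omega> = r)) / real n) \<longlonglongrightarrow> 1 / real N" if r: "r \<in> {1..N}"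
  proof (rule aux[of "\<lambda>i \<omega>. of_bool (k i \<omega> = r)" "1 / real N" 1])
    have "indep_vars (\<lambda>_. Path) (ing_path g k B) (range (\<lambda>i. Inr (Inl i)))"
      by (rule indep_vars_subset[OF ingredientsD(7)[OF I]]) auto
    then have "indep_vars (\<lambda>_. Path) (\<lambda>i. ing_path g k B (Inr (Inl i))) UNIV"
      by (rule indep_vars_reindex) (simp add: inj_on_def)
    from indep_vars_compose2[OF this, of "\<lambda>_ p. of_bool (p 0 = real r)" "\<lambda>_. borel"]
    show "indep_vars (\<lambda>_. borel) (\<lambda>i \<omega>. of_bool (k i \<omega> = r)) UNIV" by (simp add: ing_path_simps traj_def)
    fix i
    have km [measurable]: "k i \<in> measurable M (count_space UNIV)" by (rule ingredientsD(4)[OF I])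
    have sqb: "(of_bool b :: real)\<^sup>2 = of_bool b" for b by simp
    show int: "integrable M (\<lambda>\<omega>. of_bool (k i \<omega> = r) :: real)" by (intro integrable_const_bound[where B=1]) auto
    show int2: "integrable M (\<lambda>\<omega>. (of_bool (k i \<omega> = r) :: real)\<^sup>2)" 
      using int unfolding sqb .
    have "expectation (\<lambda>\<omega>. of_bool (k i \<omega> = r)) = expectation (indicat_real (k i -` {r} \<inter> space M))"
      by (intro Bochner_Integration.integral_cong refl) (simp add: indicator_def)
    also have "\<dots> = prob (k i -` {r} \<inter> space M)" by simp
    also have "\<dots> = measure (measure_pmf (pmf_of_set {1..N})) {r}"
      unfolding ingredientsD(5)[OF I, of i, symmetric] by (simp add: measure_distr)
    also have "\<dots> = 1 / real N" using r N by (simp add: measure_pmf_single)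
    finally show E: "expectation (\<lambda>\<omega>. of_bool (k i \<omega> = r)) = 1 / real N" .
    have "1 / real N \<le> 1" using N by simp
    then have "1 / real N - (1 / real N)\<^sup>2 \<le> 1" using zero_le_power2[of "1 / real N"] by linarith
    then have "expectation (\<lambda>\<omega>. (of_bool (k i \<omega> = r) :: real)\<^sup>2) - (expectation (\<lambda>\<omega>. of_bool (k i \<omega> = r)))\<^sup>2 \<le> 1"
      unfolding sqb E .
    then show "variance (\<lambda>\<omega>. of_bool (k i \<omega> = r) :: real) \<le> 1"
      by (rule ord_eq_le_trans[OF variance_eq[OF int int2]])
  qed
  show "AE \<omega> in M. ((\<lambda>t. B n t \<omega> / t) \<longlongrightarrow> 0) at_top" if "n \<in> {1..N}"
    by (rule std_BM_sublinear[OF ingredientsD(6)[OF I that]])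
qed

section \<open>Symmetries of the driving noise: permutation of labels and reflection\<close>

lemma map_ingredients:
  assumes I: "ingredients M N g k B"
    and \<psi>: "inj_on \<psi> (ing_index N)" "\<psi> ` ing_index N \<subseteq> ing_index N"
    and c: "\<And>x. x \<in> ing_index N \<Longrightarrow> c x \<in> measurable Path Path"
      "\<And>x \<omega>. x \<in> ing_index N \<Longrightarrow> ing_path g' k' B' x \<omega> = c x (ing_path g k B (\<psi> x) \<omega>)"
    and g': "\<And>i. distributed M lborel (g' i) (exponential_density (real N))"
    and k': "\<And>i. k' i \<in> measurable M (count_space UNIV)"
      "\<And>i. distr M (count_space UNIV) (k' i) = measure_pmf (pmf_of_set {1..N})"
    and B': "\<And>n. n \<in> {1..N} \<Longrightarrow> is_std_BM M (B' n)"
  shows "ingredients M N g' k' B'"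
proof -
  interpret prob_space M by (rule ingredientsD(1)[OF I])
  have "indep_vars (\<lambda>_. Path) (\<lambda>x. ing_path g k B (\<psi> x)) (ing_index N)"
    by (rule indep_vars_reindex[OF indep_vars_subset[OF ingredientsD(7)[OF I] \<psi>(2)] \<psi>(1)])
  from indep_vars_compose2[OF this c(1)]
  have "indep_vars (\<lambda>_. Path) (\<lambda>x \<omega>. c x (ing_path g k B (\<psi> x) \<omega>)) (ing_index N)" .
  also have "?this \<longleftrightarrow> indep_vars (\<lambda>_. Path) (ing_path g' k' B') (ing_index N)"
    by (rule indep_vars_cong[OF refl _ refl]) (rule ext, rule c(2)[symmetric])
  finally show ?thesis
    unfolding ingredients_def using prob_space_axioms g' k' B' by blast
qed

text \<open>Label \<open>n\<close> is now driven by the motion formerly called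
  \<open>\<tau> n\<close>, so a parent drawn under its old name must be translated back by
  \<open>inv \<tau>\<close>. Independence is kept because the coordinates are merely rearranged, and
  the uniform law is invariant under bijections.\<close>

lemma permuted_ingredients:
  assumes I: "ingredients M N g k B" and \<tau>: "\<tau> permutes {1..N}"
  shows "ingredients M N g (\<lambda>i \<omega>. inv \<tau> (k i \<omega>)) (\<lambda>n. B (\<tau> n))"
proof -
  define \<psi> where "\<psi> x = (case x of Inr (Inr n) \<Rightarrow> Inr (Inr (\<tau> n)) | _ \<Rightarrow> x)" for x :: "nat + nat + nat"
  define c where "c x p = (case x of Inr (Inl i) \<Rightarrow> (\<lambda>t\<in>{0..}. real (inv \<tau> (nat \<lfloor>p 0\<rfloor>))) | _ \<Rightarrow> p)"
    for x :: "nat + nat + nat" and p :: "real \<Rightarrow> real"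
  have c: "c (Inl i) = (\<lambda>p. p)" "c (Inr (Inl i)) = (\<lambda>p. \<lambda>t\<in>{0..}. real (inv \<tau> (nat \<lfloor>p 0\<rfloor>)))" "c (Inr (Inr n)) = (\<lambda>p. p)" for i n
    by (rule ext, simp only: c_def sum.case)+
  have \<psi>: "\<psi> (Inl i) = Inl i" "\<psi> (Inr (Inl i)) = Inr (Inl i)" "\<psi> (Inr (Inr n)) = Inr (Inr (\<tau> n))" for i n
    by (simp_all only: \<psi>_def sum.case)
  have \<tau>in: "\<tau> n \<in> {1..N} \<longleftrightarrow> n \<in> {1..N}" for n using permutes_in_image[OF \<tau>] .
  show ?thesis
  proof (rule map_ingredients[OF I, where \<psi>=\<psi> and c=c])
    show "inj_on \<psi> (ing_index N)"
    proof (rule inj_on_inverseI)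
      fix x
      show "(case \<psi> x of Inr (Inr n) \<Rightarrow> Inr (Inr (inv \<tau> n)) | _ \<Rightarrow> \<psi> x) = x"
        by (auto simp: \<psi>_def permutes_inverses[OF \<tau>] split: sum.split)
    qed
    show "\<psi> ` ing_index N \<subseteq> ing_index N"
    proof (rule image_subsetI)
      fix x assume "x \<in> ing_index N"
      then show "\<psi> x \<in> ing_index N" by (cases rule: ing_index_cases) (use \<tau>in in \<open>simp_all add: \<psi>\<close>)
    qed
    fix x assume x: "x \<in> ing_index N"
    have [measurable]: "(\<lambda>p. p (0::real)) \<in> borel_measurable Path"
      by (rule measurable_Path_component[OF measurable_ident_sets[OF refl]])
    have "(\<lambda>p. nat \<lfloor>p (0::real)\<rfloor>) \<in> measurable Path (count_space UNIV)"
      by measurable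
    then have "(\<lambda>p. real (inv \<tau> (nat \<lfloor>p 0\<rfloor>))) \<in> borel_measurable Path"
      by (rule measurable_compose) simp
    then have K: "(\<lambda>p. \<lambda>t\<in>{0..}. real (inv \<tau> (nat \<lfloor>p 0\<rfloor>))) \<in> measurable Path Path"
      by (intro measurable_Path_I)
    from x show "c x \<in> measurable Path Path"
      by (cases rule: ing_index_cases) (simp_all add: c K)
    show "ing_path g (\<lambda>i \<omega>. inv \<tau> (k i \<omega>)) (\<lambda>n. B (\<tau> n)) x \<omega> = c x (ing_path g k B (\<psi> x) \<omega>)" for \<omega>
      using x by (cases rule: ing_index_cases) (simp_all add: c \<psi> ing_path_simps traj_def)
  next
    fix i
    show "distributed M lborel (g i) (exponential_density (real N))" by (rule ingredientsD(2)[OF I])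
    show "(\<lambda>\<omega>. inv \<tau> (k i \<omega>)) \<in> measurable M (count_space UNIV)"
      by (rule measurable_compose[OF ingredientsD(4)[OF I]]) simp
    have "distr M (count_space UNIV) (\<lambda>\<omega>. inv \<tau> (k i \<omega>)) = distr (distr M (count_space UNIV) (k i)) (count_space UNIV) (inv \<tau>)"
      by (subst distr_distr[OF _ ingredientsD(4)[OF I]]) (auto simp: comp_def)
    also have "\<dots> = measure_pmf (map_pmf (inv \<tau>) (pmf_of_set {1..N}))"
      unfolding ingredientsD(5)[OF I] by (simp add: map_pmf_rep_eq)
    also have "map_pmf (inv \<tau>) (pmf_of_set {1..N}) = pmf_of_set {1..N}"
    \<comment> \<open>\<open>pmf_of_set\<close> has its meaning only on nonempty sets. For
      \<open>N = 0\<close> the permutation is the identity, and no computation with it is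
      required.\<close>
    proof (cases "N = 0")
      case True
      then have "inv \<tau> = id" using \<tau> by simp
      then show ?thesis by simp
    next
      case False
      have "map_pmf (inv \<tau>) (pmf_of_set {1..N}) = pmf_of_set (inv \<tau> ` {1..N})"
        using False by (intro map_pmf_of_set_inj permutes_inj_on[OF permutes_inv[OF \<tau>]]) auto
      then show ?thesis using permutes_image[OF permutes_inv[OF \<tau>]] by simp
    qed
    finally show "distr M (count_space UNIV) (\<lambda>\<omega>. inv \<tau> (k i \<omega>)) = measure_pmf (pmf_of_set {1..N})" .
  next
    fix n assume "n \<in> {1..N}"
    then show "is_std_BM M (B (\<tau> n))" using \<tau>in by (intro ingredientsD(6)[OF I]) simp
  qed
qed

lemma (in prob_space) std_BM_uminus:
  assumes W: "is_std_BM M W"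
  shows "is_std_BM M (\<lambda>t \<omega>. - W t \<omega>)"
  unfolding is_std_BM_def
proof (intro conjI allI impI ballI)
  show "(\<lambda>\<omega>. - W t \<omega>) \<in> borel_measurable M" for t using is_std_BM_D(1)[OF W] by simp
  show "- W 0 \<omega> = 0" if "\<omega> \<in> space M" for \<omega> using is_std_BM_D(2)[OF W that] by simp
  show "AE \<omega> in M. continuous_on {0..} (\<lambda>t. - W t \<omega>)"
    using is_std_BM_D(3)[OF W] by eventually_elim (rule continuous_on_minus)
  fix s t :: real assume st: "0 \<le> s" "s < t"
  have "distributed M lborel (\<lambda>\<omega>. 0 + (-1) * (W t \<omega> - W s \<omega>)) (normal_density (0 + (-1) * 0) (\<bar>-1\<bar> * sqrt (t - s)))"
    using st by (intro normal_density_affine is_std_BM_D(4)[OF W]) auto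
  then show "distributed M lborel (\<lambda>\<omega>. - W t \<omega> - - W s \<omega>) (normal_density 0 (sqrt (t - s)))"
    by (simp add: algebra_simps)
next
  fix ts :: "real list" assume ts: "sorted_wrt (<) ts" "\<forall>t\<in>set ts. 0 \<le> t"
  from ts(2) have "indep_vars (\<lambda>_. borel) (\<lambda>i \<omega>. W (ts ! Suc i) \<omega> - W (ts ! i) \<omega>) {..<length ts - 1}"
    by (intro is_std_BM_D(5)[OF W ts(1)]) auto
  from indep_vars_compose2[OF this, of "\<lambda>_ x. - x" "\<lambda>_. borel"]
  show "indep_vars (\<lambda>_. borel) (\<lambda>i \<omega>. - W (ts ! Suc i) \<omega> - - W (ts ! i) \<omega>) {..<length ts - 1}"
    by (simp add: algebra_simps)
qed

lemma reflected_ingredients: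
  assumes I: "ingredients M N g k B"
  shows "ingredients M N g k (\<lambda>n t \<omega>. - B n t \<omega>)"
proof -
  interpret prob_space M by (rule ingredientsD(1)[OF I])
  define c where "c x p = (case x of Inr (Inr n) \<Rightarrow> (\<lambda>t\<in>{0..}. - p t) | _ \<Rightarrow> p)"
    for x :: "nat + nat + nat" and p :: "real \<Rightarrow> real"
  have c: "c (Inl i) = (\<lambda>p. p)" "c (Inr (Inl i)) = (\<lambda>p. p)" "c (Inr (Inr n)) = (\<lambda>p. \<lambda>t\<in>{0..}. - p t)" for i n
    by (rule ext, simp only: c_def sum.case)+
  show ?thesis
  proof (rule map_ingredients[OF I, where \<psi>="\<lambda>x. x" and c=c])
    fix x assume x: "x \<in> ing_index N"
    have R: "(\<lambda>p. \<lambda>t\<in>{0..}. - p t) \<in> measurable Path Path"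
      by (rule measurable_Path_I) measurable
    from x show "c x \<in> measurable Path Path"
      by (cases rule: ing_index_cases) (simp_all add: c R)
    show "ing_path g k (\<lambda>n t \<omega>. - B n t \<omega>) x \<omega> = c x (ing_path g k B x \<omega>)" for \<omega>
      using x by (cases rule: ing_index_cases) (auto simp: c ing_path_simps traj_def fun_eq_iff)
  next
    show "is_std_BM M (\<lambda>t \<omega>. - B n t \<omega>)" if "n \<in> {1..N}" for n
      by (rule std_BM_uminus[OF ingredientsD(6)[OF I that]])
  qed (auto intro: ingredientsD(2,4)[OF I] ingredientsD(5)[OF I, simplified])
qed

subsection \<open>Excursions between jumps\<close>

text \<open>Iterating \<open>rest\<close> defines the excursions at every sample point, which is the
  form that \<open>iid_seq_of_renewal\<close> treats. Their explicit description in
  \<open>exc_seq_eq\<close> requires continuous paths and nonnegative gaps.\<close>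

definition exc_seq where
  "exc_seq N g k B l \<omega> = first_exc N ((rest N ^^ l) (ing_elem N g k B \<omega>))"

definition exc_law where
  "exc_law M N g k B = distr M (Exc N) (exc_seq N g k B 0)"

lemma exc_seq_iid:
  assumes I: "ingredients M N g k B"
  shows "iid_seq M (exc_law M N g k B) (exc_seq N g k B)"
  unfolding exc_law_def exc_seq_def[abs_def] funpow_0
  by (rule iid_seq_of_renewal[OF ingredientsD(1)[OF I] ingredients_measurable_elem[OF I] measurable_first_exc measurable_rest
      markov_at_first_jump[OF I]])

lemma sets_exc_law: "sets (exc_law M N g k B) = sets (Exc N)"
  by (simp add: exc_law_def)

lemma prob_space_exc_law:
  assumes I: "ingredients M N g k B"
  shows "prob_space (exc_law M N g k B)"
  unfolding exc_law_def exc_seq_def[abs_def] funpow_0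
  by (rule prob_space.prob_space_distr[OF ingredientsD(1)[OF I]])
    (rule measurable_compose[OF ingredients_measurable_elem[OF I] measurable_first_exc])

definition relabel :: "nat \<Rightarrow> (nat \<Rightarrow> nat) \<Rightarrow> real \<times> nat \<times> (nat \<Rightarrow> real \<Rightarrow> real) \<Rightarrow> real \<times> nat \<times> (nat \<Rightarrow> real \<Rightarrow> real)" where
  "relabel N \<tau> e = (fst e, inv \<tau> (fst (snd e)), \<lambda>n\<in>{1..N}. snd (snd e) (\<tau> n))"

lemma measurable_relabel:
  assumes "\<tau> permutes {1..N}"
  shows "relabel N \<tau> \<in> measurable (Exc N) (Exc N)"
proof -
  have "(\<lambda>e. \<lambda>n\<in>{1..N}. snd (snd e) (\<tau> n)) \<in> measurable (Exc N) (PiM {1..N} (\<lambda>_. Path))"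
  proof (rule measurable_restrict)
    fix n assume "n \<in> {1..N}"
    then have "(\<lambda>p. p (\<tau> n)) \<in> measurable (PiM {1..N} (\<lambda>_. Path)) Path"
      using permutes_in_image[OF assms] by (intro measurable_component_singleton) simp
    then show "(\<lambda>e. snd (snd e) (\<tau> n)) \<in> measurable (Exc N) Path" unfolding Exc_def by measurable
  qed
  then show ?thesis unfolding relabel_def[abs_def] Exc_def by measurable
qed

text \<open>The relabelled first excursion is the first excursion of the permuted noise, and
  permuting the noise does not change its law.\<close>

lemma relabel_exc_law:
  assumes I: "ingredients M N g k B" and \<tau>: "\<tau> permutes {1..N}"
  shows "distr (exc_law M N g k B) (exc_law M N g k B) (relabel N \<tau>) = exc_law M N g k B"
proof -
  note I' = permuted_ingredients[OF I \<tau>]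
  note m = ingredients_measurable_elem[OF I] and m' = ingredients_measurable_elem[OF I']
  have eq: "relabel N \<tau> (exc_seq N g k B 0 \<omega>) = exc_seq N g (\<lambda>i \<omega>. inv \<tau> (k i \<omega>)) (\<lambda>n. B (\<tau> n)) 0 \<omega>" for \<omega>
    using permutes_in_image[OF \<tau>]
    by (auto simp: exc_seq_def first_exc_def first_exc_at_def relabel_def ing_elem_def ing_path_simps traj_def fun_eq_iff)
  have x: "exc_seq N g k B 0 \<in> measurable M (Exc N)"
    unfolding exc_seq_def[abs_def] using measurable_compose[OF m measurable_first_exc] by simp
  have "distr (exc_law M N g k B) (exc_law M N g k B) (relabel N \<tau>) = distr (exc_law M N g k B) (Exc N) (relabel N \<tau>)"
    by (rule distr_cong) (simp_all add: sets_exc_law)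
  also have "\<dots> = distr M (Exc N) (\<lambda>\<omega>. relabel N \<tau> (exc_seq N g k B 0 \<omega>))"
    unfolding exc_law_def by (subst distr_distr[OF measurable_relabel[OF \<tau>] x]) (simp add: comp_def)
  also have "\<dots> = distr (distr M (Ing N) (ing_elem N g (\<lambda>i \<omega>. inv \<tau> (k i \<omega>)) (\<lambda>n. B (\<tau> n)))) (Exc N) (first_exc N)"
    unfolding eq by (subst distr_distr[OF measurable_first_exc m']) (simp add: comp_def exc_seq_def[abs_def])
  also have "\<dots> = distr (distr M (Ing N) (ing_elem N g k B)) (Exc N) (first_exc N)"
    unfolding ingredients_law_unique[OF I' I] ..
  also have "\<dots> = exc_law M N g k B"
    unfolding exc_law_def by (subst distr_distr[OF measurable_first_exc m]) (simp add: comp_def exc_seq_def[abs_def])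
  finally show ?thesis .
qed

definition jump_time :: "(nat \<Rightarrow> 'a \<Rightarrow> real) \<Rightarrow> nat \<Rightarrow> 'a \<Rightarrow> real" where
  "jump_time g i \<omega> = (\<Sum>l<i. g l \<omega>)"

lemma ing_elem_cong:
  assumes "\<And>i. g i \<omega> = g' i \<omega>'" "\<And>i. k i \<omega> = k' i \<omega>'" "\<And>n t. n \<in> {1..N} \<Longrightarrow> t \<ge> 0 \<Longrightarrow> B n t \<omega> = B' n t \<omega>'"
  shows "ing_elem N g k B \<omega> = ing_elem N g' k' B' \<omega>'"
  unfolding ing_elem_def
proof (rule restrict_ext)
  fix x assume "x \<in> ing_index N"
  then show "ing_path g k B x \<omega> = ing_path g' k' B' x \<omega>'"
  proof (cases rule: ing_index_cases)
    case (1 i)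
    show ?thesis unfolding 1 ing_path_simps traj_def assms(1) ..
  next
    case (2 i)
    show ?thesis unfolding 2 ing_path_simps traj_def assms(2) ..
  next
    case (3 n)
    show ?thesis unfolding 3(1) ing_path_simps traj_def by (rule restrict_ext) (use assms(3)[OF 3(2)] in simp)
  qed
qed

text \<open>Each application of \<open>rest\<close> shifts by the first gap that is left, so
  \<open>l\<close> of them add up to a shift by the jump time \<open>l\<close>. The start at 0 makes
  the unshifted noise agree with the formula for \<open>l = 0\<close>.\<close>

lemma funpow_rest:
  assumes cont: "\<And>n. n \<in> {1..N} \<Longrightarrow> continuous_on {0..} (\<lambda>t. B n t \<omega>)"
    and B0: "\<And>n. n \<in> {1..N} \<Longrightarrow> B n 0 \<omega> = 0" and g: "\<And>i. g i \<omega> \<ge> 0"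
  shows "(rest N ^^ l) (ing_elem N g k B \<omega>) =
    ing_elem N (\<lambda>i. g (l + i)) (\<lambda>i. k (l + i)) (\<lambda>n s \<omega>'. B n (jump_time g l \<omega> + s) \<omega>' - B n (jump_time g l \<omega>) \<omega>') \<omega>"
proof (induction l)
  case 0
  show ?case unfolding funpow.simps id_apply jump_time_def
    by (rule ing_elem_cong) (use B0 in simp_all)
next
  case (Suc l)
  let ?J = "jump_time g l \<omega>" and ?a = "g l \<omega>"
  let ?g = "\<lambda>i. g (l + i)" and ?k = "\<lambda>i. k (l + i)" and ?B = "\<lambda>n s \<omega>'. B n (?J + s) \<omega>' - B n ?J \<omega>'"
  have J: "?J \<ge> 0" unfolding jump_time_def using g by (intro sum_nonneg) simp
  have a: "ing_elem N ?g ?k ?B \<omega> (Inl 0) 0 = ?a"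
    by (simp add: ing_elem_def ing_path_simps traj_def)
  have "(rest N ^^ Suc l) (ing_elem N g k B \<omega>) = rest_at N ?a (ing_elem N ?g ?k ?B \<omega>)"
    unfolding funpow.simps comp_def Suc.IH rest_def a ..
  also have "\<dots> = shifted_elem N ?a ?g ?k ?B \<omega>"
  proof (rule rest_at_eq[OF _ g])
    fix n assume "n \<in> {1..N}"
    note c = cont[OF this]
    show "continuous_on {0..} (\<lambda>t. B n (?J + t) \<omega> - B n ?J \<omega>)"
      by (intro continuous_intros continuous_on_compose2[OF c]) (use J in auto)
  qed
  also have "\<dots> = ing_elem N (\<lambda>i. g (Suc l + i)) (\<lambda>i. k (Suc l + i))
      (\<lambda>n s \<omega>'. B n (jump_time g (Suc l) \<omega> + s) \<omega>' - B n (jump_time g (Suc l) \<omega>) \<omega>') \<omega>"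
    unfolding shifted_elem_def by (rule ing_elem_cong) (simp_all add: jump_time_def add.assoc)
  finally show ?case .
qed

lemma exc_seq_eq:
  assumes cont: "\<And>n. n \<in> {1..N} \<Longrightarrow> continuous_on {0..} (\<lambda>t. B n t \<omega>)"
    and B0: "\<And>n. n \<in> {1..N} \<Longrightarrow> B n 0 \<omega> = 0" and g: "\<And>i. g i \<omega> \<ge> 0"
  shows "exc_seq N g k B l \<omega> = (g l \<omega>, k l \<omega>,
    \<lambda>n\<in>{1..N}. \<lambda>s\<in>{0..}. B n (jump_time g l \<omega> + min s (g l \<omega>)) \<omega> - B n (jump_time g l \<omega>) \<omega>)"
proof -
  let ?J = "jump_time g l \<omega>" and ?a = "g l \<omega>"
  let ?g = "\<lambda>i. g (l + i)" and ?k = "\<lambda>i. k (l + i)" and ?B = "\<lambda>n s \<omega>'. B n (?J + s) \<omega>' - B n ?J \<omega>'"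
  have J: "?J \<ge> 0" unfolding jump_time_def using g by (intro sum_nonneg) simp
  have a: "ing_elem N ?g ?k ?B \<omega> (Inl 0) 0 = ?a"
    by (simp add: ing_elem_def ing_path_simps traj_def)
  have fr: "(rest N ^^ l) (ing_elem N g k B \<omega>) = ing_elem N ?g ?k ?B \<omega>"
    by (rule funpow_rest; fact)
  have "exc_seq N g k B l \<omega> = first_exc_at N ?a (ing_elem N ?g ?k ?B \<omega>)"
    unfolding exc_seq_def fr first_exc_def a ..
  also have "\<dots> = stopped_exc N ?a ?k ?B \<omega>"
  proof (rule first_exc_at_eq[OF _ g])
    fix n assume "n \<in> {1..N}"
    note c = cont[OF this]
    show "continuous_on {0..} (\<lambda>t. B n (?J + t) \<omega> - B n ?J \<omega>)"
      by (intro continuous_intros continuous_on_compose2[OF c]) (use J in auto)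
  qed
  finally show ?thesis by (simp add: stopped_exc_def traj_def)
qed

text \<open>The sum has only finitely many nonzero terms as soon as the excursions start at 0 and the jump
  times diverge.\<close>

definition glue :: "(nat \<Rightarrow> real \<times> nat \<times> (nat \<Rightarrow> real \<Rightarrow> real)) \<Rightarrow> nat \<Rightarrow> real \<Rightarrow> real" where
  "glue es n t = (\<Sum>i. evalp (snd (snd (es i)) n) (max 0 (t - (\<Sum>l<i. fst (es l)))))"

definition good_excs :: "nat \<Rightarrow> (nat \<Rightarrow> real \<times> nat \<times> (nat \<Rightarrow> real \<Rightarrow> real)) \<Rightarrow> bool" where
  "good_excs N es \<longleftrightarrow> (\<forall>i. fst (es i) > 0) \<and> filterlim (\<lambda>i. \<Sum>l<i. fst (es l)) at_top sequentially \<and>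
     (\<forall>i. \<forall>n\<in>{1..N}. continuous_on {0..} (snd (snd (es i)) n) \<and> snd (snd (es i)) n 0 = 0 \<and>
        (\<forall>s\<ge>fst (es i). snd (snd (es i)) n s = snd (snd (es i)) n (fst (es i))))"

text \<open>Excursions later than \<open>i\<close> are evaluated at time 0, where they vanish.
  Excursions earlier than \<open>i\<close> have passed their end and are frozen at their final
  value.\<close>

lemma glue_eq:
  assumes good: "good_excs N es" and n: "n \<in> {1..N}"
    and t: "(\<Sum>l<i. fst (es l)) \<le> t" "t \<le> (\<Sum>l<Suc i. fst (es l))"
  shows "glue es n t = (\<Sum>l<i. snd (snd (es l)) n (fst (es l))) + snd (snd (es i)) n (t - (\<Sum>l<i. fst (es l)))"
proof -
  let ?J = "\<lambda>i. \<Sum>l<i. fst (es l)" and ?e = "\<lambda>l. snd (snd (es l)) n"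
  have pos: "fst (es l) > 0" for l using good unfolding good_excs_def by blast
  have e: "continuous_on {0..} (?e l)" "?e l 0 = 0" "\<And>s. s \<ge> fst (es l) \<Longrightarrow> ?e l s = ?e l (fst (es l))" for l
    using good n unfolding good_excs_def by blast+
  have mono: "?J l \<le> ?J m" if "l \<le> m" for l m
    using that pos by (intro sum_mono2) (auto intro: less_imp_le)
  have ev: "evalp (?e l) (max 0 (t - ?J l)) = ?e l (max 0 (t - ?J l))" for l
    by (rule evalp_eq[OF e(1)]) simp
  have late: "?e l (max 0 (t - ?J l)) = 0" if "l > i" for l
  proof -
    have "?J (Suc i) \<le> ?J l" using that by (intro mono) simp
    then have "max 0 (t - ?J l) = 0" using t(2) by simp
    then show ?thesis using e(2) by simp
  qed
  have early: "?e l (max 0 (t - ?J l)) = ?e l (fst (es l))" if "l < i" for l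
  proof -
    have "?J (Suc l) \<le> ?J i" using that by (intro mono) simp
    then have "max 0 (t - ?J l) \<ge> fst (es l)" using t(1) by simp
    then show ?thesis by (rule e(3))
  qed
  have "glue es n t = (\<Sum>l. ?e l (max 0 (t - ?J l)))" unfolding glue_def ev ..
  also have "\<dots> = (\<Sum>l\<in>{..<Suc i}. ?e l (max 0 (t - ?J l)))"
    by (rule suminf_finite) (use late in auto)
  also have "\<dots> = (\<Sum>l<i. ?e l (fst (es l))) + ?e i (t - ?J i)"
    using early t(1) by simp
  finally show ?thesis .
qed

lemma continuous_on_increasing_union:
  fixes f :: "real \<Rightarrow> real" and J :: "nat \<Rightarrow> real"
  assumes J: "filterlim J at_top sequentially" and c: "\<And>i. continuous_on {0..J i} f"
  shows "continuous_on {0..} f"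
  unfolding continuous_on_eq_continuous_within
proof
  fix t :: real assume t: "t \<in> {0..}"
  obtain i where i: "t < J i"
    using filterlim_at_top_dense[THEN iffD1, OF J, rule_format, of t] by (auto simp: eventually_sequentially)
  have "continuous (at t within {0..J i}) f"
    using c[of i] t i by (auto simp: continuous_on_eq_continuous_within)
  moreover have "at t within {0..J i} = at t within {0..}"
    using i by (intro at_within_nhd[of _ "{..<J i}"]) auto
  ultimately show "continuous (at t within {0..}) f" by (simp add: continuous_within)
qed

lemma continuous_on_glue:
  assumes good: "good_excs N es" and n: "n \<in> {1..N}"
  shows "continuous_on {0..} (glue es n)"
proof (rule continuous_on_increasing_union)
  let ?J = "\<lambda>i. \<Sum>l<i. fst (es l)" and ?e = "\<lambda>l. snd (snd (es l)) n"
  show "filterlim ?J at_top sequentially" using good unfolding good_excs_def by blast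
  have pos: "fst (es l) > 0" for l using good unfolding good_excs_def by blast
  have J0: "?J i \<ge> 0" for i using pos by (intro sum_nonneg) (auto intro: less_imp_le)
  have e: "continuous_on {0..} (?e l)" for l using good n unfolding good_excs_def by blast
  show "continuous_on {0..?J i} (glue es n)" for i
  proof (induction i)
    case (Suc i)
    have "continuous_on {?J i..?J (Suc i)} (\<lambda>t. (\<Sum>l<i. ?e l (fst (es l))) + ?e i (t - ?J i))"
      by (intro continuous_intros continuous_on_compose2[OF e]) auto
    then have "continuous_on {?J i..?J (Suc i)} (glue es n)"
      by (rule continuous_on_eq) (rule glue_eq[OF good n, symmetric]; simp)
    from continuous_on_closed_Un[OF closed_real_atLeastAtMost closed_real_atLeastAtMost Suc this]
    have "continuous_on ({0..?J i} \<union> {?J i..?J (Suc i)}) (glue es n)" .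
    moreover have "?J i \<le> ?J (Suc i)" using pos[of i] by simp
    then have "{0..?J i} \<union> {?J i..?J (Suc i)} = {0..?J (Suc i)}"
      using J0[of i] by (intro ivl_disj_un_two_touch(4))
    ultimately show ?case by (simp only:)
  qed simp
qed

lemma measurable_glue:
  assumes es: "\<And>l. (\<lambda>\<omega>. es \<omega> l) \<in> measurable Q (Exc N)" and n: "n \<in> {1..N}"
  shows "(\<lambda>\<omega>. glue (es \<omega>) n t) \<in> borel_measurable Q"
proof -
  have [measurable]: "(\<lambda>\<omega>. fst (es \<omega> l)) \<in> borel_measurable Q" for l
    using es[of l] unfolding Exc_def by measurable
  have [measurable]: "(\<lambda>\<omega>. snd (snd (es \<omega> l)) n) \<in> measurable Q Path" for l
  proof -
    have "(\<lambda>\<omega>. snd (snd (es \<omega> l))) \<in> measurable Q (PiM {1..N} (\<lambda>_. Path))"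
      using es[of l] unfolding Exc_def by measurable
    from measurable_compose[OF this measurable_component_singleton[OF n]] show ?thesis .
  qed
  show ?thesis unfolding glue_def by measurable
qed

lemma jump_interval:
  fixes J :: "nat \<Rightarrow> real"
  assumes "J 0 \<le> t" "filterlim J at_top sequentially"
  obtains i where "J i \<le> t" "t < J (Suc i)"
proof -
  obtain j where j: "t < J j"
    using filterlim_at_top_dense[THEN iffD1, OF assms(2), rule_format, of t] by (auto simp: eventually_sequentially)
  define i where "i = (LEAST j. t < J j)"
  have i: "t < J i" unfolding i_def using j by (rule LeastI)
  then obtain i' where i': "i = Suc i'" using assms(1) by (cases i) auto
  have "\<not> t < J i'" using not_less_Least[of i' "\<lambda>j. t < J j"] i' by (simp add: i_def)
  with that[of i'] i i' show thesis by simp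
qed

definition good_sample where
  "good_sample N g k B \<omega> \<longleftrightarrow> (\<forall>i. g i \<omega> > 0) \<and> (\<forall>i. k i \<omega> \<in> {1..N}) \<and>
     filterlim (\<lambda>i. jump_time g i \<omega>) at_top sequentially \<and>
     (\<forall>n\<in>{1..N}. continuous_on {0..} (\<lambda>t. B n t \<omega>) \<and> B n 0 \<omega> = 0)"

lemma AE_good_sample:
  assumes I: "ingredients M N g k B" and N: "N > 0"
  shows "AE \<omega> in M. good_sample N g k B \<omega>"
proof -
  interpret prob_space M by (rule ingredientsD(1)[OF I])
  have "AE \<omega> in M. \<forall>i. g i \<omega> > 0"
    unfolding AE_all_countable by (intro allI AE_exponential_pos[OF ingredientsD(2)[OF I]])
  moreover have "AE \<omega> in M. \<forall>i. k i \<omega> \<in> {1..N}"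
    unfolding AE_all_countable
  proof
    fix i
    have "AE x in distr M (count_space UNIV) (k i). x \<in> {1..N}"
      unfolding ingredientsD(5)[OF I] using N by (simp add: AE_measure_pmf_iff)
    then show "AE \<omega> in M. k i \<omega> \<in> {1..N}"
      using ingredientsD(4)[OF I, of i] by (subst (asm) AE_distr_iff) auto
  qed
  \<comment> \<open>The average gap converges to \<open>1 / real N\<close>, a positive number, so
    the jump times grow linearly and do not accumulate.\<close>
  moreover have "AE \<omega> in M. filterlim (\<lambda>i. jump_time g i \<omega>) at_top sequentially"
    using ingredients_lln(1)[OF I N]
  proof eventually_elim
    case (elim \<omega>)
    have "filterlim (\<lambda>n. (\<Sum>i<n. g i \<omega>) / real n * real n) at_top sequentially"
      using N by (intro filterlim_tendsto_pos_mult_at_top[OF elim] filterlim_real_sequentially) simp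
    moreover have "\<forall>\<^sub>F n in sequentially. (\<Sum>i<n. g i \<omega>) / real n * real n = jump_time g n \<omega>"
      using eventually_gt_at_top[of 0] by eventually_elim (simp add: jump_time_def)
    ultimately show ?case by (rule filterlim_mono_eventually[OF _ order_refl order_refl])
  qed
  ultimately show ?thesis
    using ingredients_AE_continuous[OF I] AE_space
  proof eventually_elim
    case (elim \<omega>)
    then show ?case unfolding good_sample_def using is_std_BM_D(2)[OF ingredientsD(6)[OF I]] by blast
  qed
qed

lemma good_sample_exc_seq:
  assumes good: "good_sample N g k B \<omega>"
  shows "exc_seq N g k B l \<omega> = (g l \<omega>, k l \<omega>,
    \<lambda>n\<in>{1..N}. \<lambda>s\<in>{0..}. B n (jump_time g l \<omega> + min s (g l \<omega>)) \<omega> - B n (jump_time g l \<omega>) \<omega>)"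
  by (rule exc_seq_eq) (use good in \<open>auto simp: good_sample_def intro: less_imp_le\<close>)

lemma good_sample_jump_nonneg:
  assumes "good_sample N g k B \<omega>"
  shows "jump_time g l \<omega> \<ge> 0"
  unfolding jump_time_def using assms by (intro sum_nonneg) (auto simp: good_sample_def intro: less_imp_le)

lemma good_excs_relabel:
  assumes good: "good_sample N g k B \<omega>" and \<sigma>: "\<And>l. \<sigma> l permutes {1..N}"
  shows "good_excs N (\<lambda>l. relabel N (\<sigma> l) (exc_seq N g k B l \<omega>))"
  unfolding good_excs_def
proof (intro conjI allI ballI impI)
  fix i
  have g: "g i \<omega> > 0" using good by (simp add: good_sample_def)
  show "fst (relabel N (\<sigma> i) (exc_seq N g k B i \<omega>)) > 0"
    using g by (simp add: relabel_def good_sample_exc_seq[OF good])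
  have "filterlim (\<lambda>i. jump_time g i \<omega>) at_top sequentially" using good by (simp add: good_sample_def)
  then show "filterlim (\<lambda>i. \<Sum>l<i. fst (relabel N (\<sigma> l) (exc_seq N g k B l \<omega>))) at_top sequentially"
    by (simp add: relabel_def good_sample_exc_seq[OF good] jump_time_def)
  fix n assume n: "n \<in> {1..N}"
  then have sn: "\<sigma> i n \<in> {1..N}" using permutes_in_image[OF \<sigma>] by blast
  let ?J = "jump_time g i \<omega>"
  have J: "?J \<ge> 0" by (rule good_sample_jump_nonneg[OF good])
  have e: "snd (snd (relabel N (\<sigma> i) (exc_seq N g k B i \<omega>))) n =
      (\<lambda>s\<in>{0..}. B (\<sigma> i n) (?J + min s (g i \<omega>)) \<omega> - B (\<sigma> i n) ?J \<omega>)"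
    using n sn by (simp add: relabel_def good_sample_exc_seq[OF good])
  have f: "fst (relabel N (\<sigma> i) (exc_seq N g k B i \<omega>)) = g i \<omega>"
    by (simp add: relabel_def good_sample_exc_seq[OF good])
  have c: "continuous_on {0..} (\<lambda>t. B (\<sigma> i n) t \<omega>)" using good sn by (simp add: good_sample_def)
  have "continuous_on {0..} (\<lambda>s. B (\<sigma> i n) (?J + min s (g i \<omega>)) \<omega> - B (\<sigma> i n) ?J \<omega>)"
    by (intro continuous_intros continuous_on_compose2[OF c]) (use J g in auto)
  then show "continuous_on {0..} (snd (snd (relabel N (\<sigma> i) (exc_seq N g k B i \<omega>))) n)"
    unfolding e by (rule continuous_on_eq) simp
  show "snd (snd (relabel N (\<sigma> i) (exc_seq N g k B i \<omega>))) n 0 = 0"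
    unfolding e using g by simp
  fix s assume "fst (relabel N (\<sigma> i) (exc_seq N g k B i \<omega>)) \<le> s"
  then show "snd (snd (relabel N (\<sigma> i) (exc_seq N g k B i \<omega>))) n s =
      snd (snd (relabel N (\<sigma> i) (exc_seq N g k B i \<omega>))) n (fst (relabel N (\<sigma> i) (exc_seq N g k B i \<omega>)))"
    unfolding e f using g by simp
qed

lemma glue_relabel:
  assumes good: "good_sample N g k B \<omega>" and \<sigma>: "\<And>l. \<sigma> l permutes {1..N}" and n: "n \<in> {1..N}"
    and t: "jump_time g i \<omega> \<le> t" "t \<le> jump_time g (Suc i) \<omega>"
  shows "glue (\<lambda>l. relabel N (\<sigma> l) (exc_seq N g k B l \<omega>)) n t =
    (\<Sum>l<i. B (\<sigma> l n) (jump_time g (Suc l) \<omega>) \<omega> - B (\<sigma> l n) (jump_time g l \<omega>) \<omega>) +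
      (B (\<sigma> i n) t \<omega> - B (\<sigma> i n) (jump_time g i \<omega>) \<omega>)"
proof -
  let ?e = "\<lambda>l. relabel N (\<sigma> l) (exc_seq N g k B l \<omega>)"
  have f: "fst (?e l) = g l \<omega>" for l by (simp add: relabel_def good_sample_exc_seq[OF good])
  have sn: "\<sigma> l n \<in> {1..N}" for l using n permutes_in_image[OF \<sigma>] by blast
  have e: "snd (snd (?e l)) n = (\<lambda>s\<in>{0..}. B (\<sigma> l n) (jump_time g l \<omega> + min s (g l \<omega>)) \<omega> - B (\<sigma> l n) (jump_time g l \<omega>) \<omega>)" for l
    using n sn by (simp add: relabel_def good_sample_exc_seq[OF good])
  have g: "g l \<omega> > 0" for l using good by (simp add: good_sample_def)
  have "glue ?e n t = (\<Sum>l<i. snd (snd (?e l)) n (fst (?e l))) + snd (snd (?e i)) n (t - (\<Sum>l<i. fst (?e l)))"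
    using t by (intro glue_eq[OF good_excs_relabel[OF good \<sigma>] n]) (simp_all only: f jump_time_def)
  also have "\<dots> = (\<Sum>l<i. B (\<sigma> l n) (jump_time g (Suc l) \<omega>) \<omega> - B (\<sigma> l n) (jump_time g l \<omega>) \<omega>) +
      (B (\<sigma> i n) t \<omega> - B (\<sigma> i n) (jump_time g i \<omega>) \<omega>)"
    using t less_imp_le[OF g] unfolding e f by (simp add: jump_time_def)
  finally show ?thesis .
qed

text \<open>The renaming used on excursion \<open>l\<close> is a function of earlier excursions, so
  the renamed excursions are again i.i.d. with the old law by \<open>iid_seq_adapted_action\<close>.
  Reassembled by a fixed measurable map they have the law of the original noise, and
  \<open>ingredients_of_law\<close> applies. The second conclusion says that on each gap the new
  motion \<open>n\<close> moves like the old motion \<open>\<sigma> i \<omega> n\<close>.\<close>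

theorem relabelled_ingredients:
  assumes I: "ingredients M N g k B" and N: "N > 0"
    and \<sigma>: "\<And>l. \<sigma> l \<in> measurable (past M (exc_law M N g k B) (exc_seq N g k B) l) (count_space {\<tau>. \<tau> permutes {1..N}})"
  obtains g' k' B' where "ingredients M N g' k' B'"
    "AE \<omega> in M. (\<forall>i. g' i \<omega> = g i \<omega> \<and> k' i \<omega> = inv (\<sigma> i \<omega>) (k i \<omega>)) \<and>
       (\<forall>i. \<forall>n\<in>{1..N}. \<forall>t. jump_time g i \<omega> \<le> t \<longrightarrow> t \<le> jump_time g (Suc i) \<omega> \<longrightarrow>
          B' n t \<omega> - B' n (jump_time g i \<omega>) \<omega> = B (\<sigma> i \<omega> n) t \<omega> - B (\<sigma> i \<omega> n) (jump_time g i \<omega>) \<omega>)"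
proof -
  interpret prob_space M by (rule ingredientsD(1)[OF I])
  let ?P = "{\<tau>. \<tau> permutes {1..N}}"
  let ?Q = "exc_law M N g k B"
  let ?X = "exc_seq N g k B"
  let ?X' = "\<lambda>l \<omega>. relabel N (\<sigma> l \<omega>) (?X l \<omega>)"
  have iid: "iid_seq M ?Q ?X" by (rule exc_seq_iid[OF I])
  have Q: "prob_space ?Q" by (rule prob_space_exc_law[OF I])
  have iid': "iid_seq M ?Q ?X'"
  proof (rule iid_seq_adapted_action[OF iid Q prob_space_axioms, where P="?P"])
    show "finite ?P" by (rule finite_permutations) simp
    fix \<tau> assume "\<tau> \<in> ?P"
    then have \<tau>: "\<tau> permutes {1..N}" by simp
    show "relabel N \<tau> \<in> measurable ?Q ?Q"
      using measurable_relabel[OF \<tau>] by (simp add: measurable_cong_sets[OF sets_exc_law sets_exc_law])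
    show "distr ?Q ?Q (relabel N \<tau>) = ?Q" by (rule relabel_exc_law[OF I \<tau>])
  qed (rule \<sigma>)
  have \<sigma>p: "\<sigma> l \<omega> permutes {1..N}" if "\<omega> \<in> space M" for l \<omega>
    using measurable_space[OF \<sigma>[of l]] that by simp
  \<comment> \<open>The reassembling map, from sequences of excursions to noise. Applied to the
    original excursions it returns the original noise almost surely, so equal laws of excursion
    sequences give equal laws of noise.\<close>
  define R where "R = ing_elem N (\<lambda>i es. fst (es i)) (\<lambda>i es. fst (snd (es i)) :: nat) (\<lambda>n t es. glue es n t)"
  have comp: "(\<lambda>es. es i) \<in> measurable (PiM UNIV (\<lambda>_. ?Q)) (Exc N)" for i
  proof -
    have "(\<lambda>es. es i) \<in> measurable (PiM UNIV (\<lambda>_. ?Q)) ?Q" by (rule measurable_component_singleton) simp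
    then show ?thesis by (simp only: measurable_cong_sets[OF refl sets_exc_law])
  qed
  have Rm: "R \<in> measurable (PiM UNIV (\<lambda>_. ?Q)) (Ing N)"
    unfolding R_def
  proof (rule measurable_ing_elem)
    fix i
    show "(\<lambda>es. fst (es i)) \<in> borel_measurable (PiM UNIV (\<lambda>_. ?Q))"
      using comp[of i] unfolding Exc_def by measurable
    show "(\<lambda>es. fst (snd (es i))) \<in> measurable (PiM UNIV (\<lambda>_. ?Q)) (count_space UNIV)"
      using comp[of i] unfolding Exc_def by measurable
    show "(\<lambda>es. glue es n t) \<in> borel_measurable (PiM UNIV (\<lambda>_. ?Q))" if "n \<in> {1..N}" for n t
      by (rule measurable_glue[OF comp that])
  qed
  have seqm: "(\<lambda>\<omega> l. Z l \<omega>) \<in> measurable M (PiM UNIV (\<lambda>_. ?Q))" if "iid_seq M ?Q Z" for Z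
  proof -
    have "(\<lambda>\<omega>. \<lambda>l\<in>UNIV. Z l \<omega>) \<in> measurable M (PiM UNIV (\<lambda>_. ?Q))"
      by (intro measurable_restrict iid_seq_measurable[OF that])
    then show ?thesis by (simp add: restrict_def)
  qed
  define g' where "g' i \<omega> = fst (?X' i \<omega>)" for i \<omega>
  define k' where "k' i \<omega> = fst (snd (?X' i \<omega>))" for i \<omega>
  \<comment> \<open>\<open>is_std_BM\<close> demands the value 0 at time 0 for every sample point,
    while the glued path is only known to start there on good samples. Hence the value is
    imposed.\<close>
  define B' where "B' n t \<omega> = (if t \<le> 0 then 0 else glue (\<lambda>l. ?X' l \<omega>) n t)" for n t \<omega>
  have X'm: "?X' l \<in> measurable M (Exc N)" for l
    using iid_seq_measurable[OF iid', of l] by (simp only: measurable_cong_sets[OF refl sets_exc_law])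
  have g'm: "g' i \<in> borel_measurable M" for i
    unfolding g'_def using X'm[of i] unfolding Exc_def by measurable
  have k'm: "k' i \<in> measurable M (count_space UNIV)" for i
    unfolding k'_def using X'm[of i] unfolding Exc_def by measurable
  have B'm: "B' n t \<in> borel_measurable M" if "n \<in> {1..N}" for n t
    unfolding B'_def using measurable_glue[where es="\<lambda>\<omega> l. ?X' l \<omega>" and t=t, OF X'm that] by measurable
  have good: "AE \<omega> in M. good_sample N g k B \<omega>" by (rule AE_good_sample[OF I N])
  have exI: "\<exists>i. jump_time g i \<omega> \<le> t \<and> t \<le> jump_time g (Suc i) \<omega>" if "good_sample N g k B \<omega>" "t \<ge> 0" for t \<omega>
  proof -
    have "jump_time g 0 \<omega> \<le> t" using that(2) by (simp add: jump_time_def)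
    moreover have "filterlim (\<lambda>i. jump_time g i \<omega>) at_top sequentially" using that(1) by (simp add: good_sample_def)
    ultimately obtain i where "jump_time g i \<omega> \<le> t" "t < jump_time g (Suc i) \<omega>" by (rule jump_interval)
    then show ?thesis by (auto intro: less_imp_le)
  qed
  have B'glue: "B' n t \<omega> = glue (\<lambda>l. ?X' l \<omega>) n t" if "good_sample N g k B \<omega>" "\<omega> \<in> space M" "n \<in> {1..N}" "t \<ge> 0" for n t \<omega>
  proof (cases "t = 0")
    case True
    have "jump_time g 0 \<omega> \<le> t" "t \<le> jump_time g (Suc 0) \<omega>"
      using that(1) True by (auto simp: jump_time_def good_sample_def intro: less_imp_le)
    from glue_relabel[OF that(1) \<sigma>p[OF that(2)] that(3) this] show ?thesis
      using True by (simp add: B'_def jump_time_def)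
  qed (use that(4) in \<open>simp add: B'_def\<close>)
  have law: "distr M (Ing N) (ing_elem N g' k' B') = distr M (Ing N) (ing_elem N g k B)"
  proof -
    have "distr M (Ing N) (ing_elem N g' k' B') = distr M (Ing N) (\<lambda>\<omega>. R (\<lambda>l. ?X' l \<omega>))"
    proof (rule distr_cong_AE[OF refl refl])
      show "AE \<omega> in M. ing_elem N g' k' B' \<omega> = R (\<lambda>l. ?X' l \<omega>)"
        using good AE_space
      proof eventually_elim
        case (elim \<omega>)
        show ?case unfolding R_def
          by (rule ing_elem_cong) (simp_all add: g'_def k'_def B'glue[OF elim])
      qed
      show "ing_elem N g' k' B' \<in> measurable M (Ing N)" by (rule measurable_ing_elem[OF g'm k'm B'm])
      show "(\<lambda>\<omega>. R (\<lambda>l. ?X' l \<omega>)) \<in> measurable M (Ing N)" by (rule measurable_compose[OF seqm[OF iid'] Rm])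
    qed
    also have "\<dots> = distr (distr M (PiM UNIV (\<lambda>_. ?Q)) (\<lambda>\<omega> l. ?X' l \<omega>)) (Ing N) R"
      by (subst distr_distr[OF Rm seqm[OF iid']]) (simp add: comp_def)
    also have "\<dots> = distr (distr M (PiM UNIV (\<lambda>_. ?Q)) (\<lambda>\<omega> l. ?X l \<omega>)) (Ing N) R"
      unfolding iid_seq_law_unique[OF iid' iid Q prob_space_axioms] ..
    also have "\<dots> = distr M (Ing N) (\<lambda>\<omega>. R (\<lambda>l. ?X l \<omega>))"
      by (subst distr_distr[OF Rm seqm[OF iid]]) (simp add: comp_def)
    also have "\<dots> = distr M (Ing N) (ing_elem N g k B)"
    proof (rule distr_cong_AE[OF refl refl])
      show "AE \<omega> in M. R (\<lambda>l. ?X l \<omega>) = ing_elem N g k B \<omega>"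
        using good
      proof eventually_elim
        case (elim \<omega>)
        \<comment> \<open>The identity renaming brings the original noise under the lemmas about
          relabelled excursions.\<close>
        have re: "relabel N id (?X l \<omega>) = ?X l \<omega>" for l
          by (auto simp: relabel_def good_sample_exc_seq[OF elim] fun_eq_iff)
        show ?case unfolding R_def
        proof (rule ing_elem_cong)
          show "fst (?X i \<omega>) = g i \<omega>" "fst (snd (?X i \<omega>)) = k i \<omega>" for i by (simp_all add: good_sample_exc_seq[OF elim])
          fix n and t :: real assume n: "n \<in> {1..N}" and t: "t \<ge> 0"
          obtain i where i: "jump_time g i \<omega> \<le> t" "t \<le> jump_time g (Suc i) \<omega>" using exI[OF elim t] by blast
          from glue_relabel[OF elim permutes_id n i]
          have "glue (\<lambda>l. ?X l \<omega>) n t = (\<Sum>l<i. B n (jump_time g (Suc l) \<omega>) \<omega> - B n (jump_time g l \<omega>) \<omega>) +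
              (B n t \<omega> - B n (jump_time g i \<omega>) \<omega>)"
            unfolding re by simp
          also have "(\<Sum>l<i. B n (jump_time g (Suc l) \<omega>) \<omega> - B n (jump_time g l \<omega>) \<omega>) = B n (jump_time g i \<omega>) \<omega> - B n (jump_time g 0 \<omega>) \<omega>"
            by (rule sum_lessThan_telescope)
          also have "B n (jump_time g 0 \<omega>) \<omega> = 0" using elim n by (simp add: jump_time_def good_sample_def)
          finally show "glue (\<lambda>l. ?X l \<omega>) n t = B n t \<omega>" by simp
        qed
      qed
      show "(\<lambda>\<omega>. R (\<lambda>l. ?X l \<omega>)) \<in> measurable M (Ing N)" by (rule measurable_compose[OF seqm[OF iid] Rm])
      show "ing_elem N g k B \<in> measurable M (Ing N)" by (rule ingredients_measurable_elem[OF I])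
    qed
    finally show ?thesis .
  qed
  show thesis
  proof (rule that)
    show "ingredients M N g' k' B'"
    proof (rule ingredients_of_law[OF I g'm k'm B'm _ _ law])
      show "B' n 0 \<omega> = 0" for n \<omega> by (simp add: B'_def)
      fix n assume n: "n \<in> {1..N}"
      show "AE \<omega> in M. continuous_on {0..} (\<lambda>t. B' n t \<omega>)"
        using good AE_space
      proof eventually_elim
        case (elim \<omega>)
        have "continuous_on {0..} (glue (\<lambda>l. ?X' l \<omega>) n)"
          by (rule continuous_on_glue[OF good_excs_relabel[OF elim(1) \<sigma>p[OF elim(2)]] n])
        then show ?case by (rule continuous_on_eq) (simp add: B'glue[OF elim n])
      qed
    qed
    show "AE \<omega> in M. (\<forall>i. g' i \<omega> = g i \<omega> \<and> k' i \<omega> = inv (\<sigma> i \<omega>) (k i \<omega>)) \<and>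
       (\<forall>i. \<forall>n\<in>{1..N}. \<forall>t. jump_time g i \<omega> \<le> t \<longrightarrow> t \<le> jump_time g (Suc i) \<omega> \<longrightarrow>
          B' n t \<omega> - B' n (jump_time g i \<omega>) \<omega> = B (\<sigma> i \<omega> n) t \<omega> - B (\<sigma> i \<omega> n) (jump_time g i \<omega>) \<omega>)"
      using good AE_space
    proof eventually_elim
      case (elim \<omega>)
      note gr = glue_relabel[OF elim(1) \<sigma>p[OF elim(2)]]
      have "B' n t \<omega> - B' n (jump_time g i \<omega>) \<omega> = B (\<sigma> i \<omega> n) t \<omega> - B (\<sigma> i \<omega> n) (jump_time g i \<omega>) \<omega>"
        if n: "n \<in> {1..N}" and t: "jump_time g i \<omega> \<le> t" "t \<le> jump_time g (Suc i) \<omega>" for i n t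
      proof -
        have J: "jump_time g i \<omega> \<ge> 0" by (rule good_sample_jump_nonneg[OF elim(1)])
        have J': "jump_time g i \<omega> \<le> jump_time g (Suc i) \<omega>" using t by linarith
        have "B' n t \<omega> = glue (\<lambda>l. ?X' l \<omega>) n t" using J t by (intro B'glue[OF elim n]) linarith
        moreover have "B' n (jump_time g i \<omega>) \<omega> = glue (\<lambda>l. ?X' l \<omega>) n (jump_time g i \<omega>)" by (rule B'glue[OF elim n J])
        ultimately show ?thesis using gr[OF n t] gr[OF n order_refl J'] by simp
      qed
      moreover have "g' i \<omega> = g i \<omega> \<and> k' i \<omega> = inv (\<sigma> i \<omega>) (k i \<omega>)" for i
        by (simp add: g'_def k'_def relabel_def good_sample_exc_seq[OF elim(1)])
      ultimately show ?case by blast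
    qed
  qed
qed

subsection \<open>The coupled systems at jump times\<close>

text \<open>The displacement of particle \<open>n\<close> during an excursion. The value 0 outside
  the labels makes it measurable for every \<open>n\<close> without a side condition.\<close>

definition inc :: "nat \<Rightarrow> real \<times> nat \<times> (nat \<Rightarrow> real \<Rightarrow> real) \<Rightarrow> nat \<Rightarrow> real" where
  "inc N e n = (if n \<in> {1..N} then evalp (snd (snd e) n) (fst e) else 0)"

lemma measurable_inc:
  assumes e: "e \<in> measurable Q (Exc N)"
  shows "(\<lambda>q. inc N (e q) n) \<in> borel_measurable Q"
proof (cases "n \<in> {1..N}")
  case True
  have [measurable]: "(\<lambda>q. fst (e q)) \<in> borel_measurable Q" using e unfolding Exc_def by measurable
  have "(\<lambda>q. snd (snd (e q))) \<in> measurable Q (PiM {1..N} (\<lambda>_. Path))" using e unfolding Exc_def by measurable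
  from measurable_compose[OF this measurable_component_singleton[OF True]]
  have [measurable]: "(\<lambda>q. snd (snd (e q)) n) \<in> measurable Q Path" .
  have "(\<lambda>q. evalp (snd (snd (e q)) n) (fst (e q))) \<in> borel_measurable Q" by measurable
  then show ?thesis using True by (simp add: inc_def)
next
  case False
  show ?thesis unfolding inc_def if_not_P[OF False] by simp
qed

text \<open>Among several minimisers the smallest label is taken. \<open>bd_path\<close> leaves this
  choice open, but the renaming has to be a measurable function of the noise.\<close>

definition argmin :: "nat \<Rightarrow> (nat \<Rightarrow> real) \<Rightarrow> nat" where
  "argmin N f = (LEAST n. n \<in> {1..N} \<and> (\<forall>j\<in>{1..N}. f n \<le> f j))"

lemma argmin:
  assumes "N > 0"
  shows "argmin N f \<in> {1..N}" "j \<in> {1..N} \<Longrightarrow> f (argmin N f) \<le> f j"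
proof -
  have "finite (f ` {1..N})" "f ` {1..N} \<noteq> {}" using assms by auto
  from Min_in[OF this] obtain n where n: "n \<in> {1..N}" "f n = Min (f ` {1..N})" by auto
  have "\<exists>n. n \<in> {1..N} \<and> (\<forall>j\<in>{1..N}. f n \<le> f j)"
    using n by (intro exI[of _ n]) auto
  then have "argmin N f \<in> {1..N} \<and> (\<forall>j\<in>{1..N}. f (argmin N f) \<le> f j)"
    unfolding argmin_def by (rule LeastI_ex)
  then show "argmin N f \<in> {1..N}" "j \<in> {1..N} \<Longrightarrow> f (argmin N f) \<le> f j" by auto
qed

lemma measurable_argmin:
  assumes f: "\<And>n. (\<lambda>q. f q n) \<in> borel_measurable Q"
  shows "(\<lambda>q. argmin N (f q)) \<in> measurable Q (count_space UNIV)"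
  unfolding argmin_def
proof (rule measurable_Least)
  fix n
  have "Measurable.pred Q (\<lambda>q. f q n \<le> f q j)" for j using f[of n] f[of j] by measurable
  then show "Measurable.pred Q (\<lambda>q. n \<in> {1..N} \<and> (\<forall>j\<in>{1..N}. f q n \<le> f q j))"
    by (intro pred_intros_logic pred_intros_finite) auto
qed

text \<open>The state consists of the positions of both systems, listed by the labels of the first one,
  and of the map from the own labels of the second system to those labels. In the step the first
  system kills \<open>m\<close>, the second one \<open>m'\<close>; exchanging the names of \<open>m\<close> and \<open>m'\<close> in the second system
  keeps it above the first one.\<close>

definition couple_step where
  "couple_step N s mu e c = (case c of (y, z, \<sigma>) \<Rightarrow>
     let p = (\<lambda>n. y n + inc N e n + mu * fst e); w = (\<lambda>n. z n + inc N e n + mu * fst e);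
         m = argmin N (\<lambda>n. s (p n)); m' = argmin N w; k = fst (snd e)
     in (p(m := p k), (w(m' := w m))(m := w k), Transposition.transpose m m' \<circ> \<sigma>))"

fun couple where
  "couple N s mu x0 es 0 = (x0, x0, id)"
| "couple N s mu x0 es (Suc i) = couple_step N s mu (es i) (couple N s mu x0 es i)"

definition "cy c = fst c"
definition "cz c = fst (snd c)"
definition "cs c = snd (snd c)"

text \<open>State \<open>i\<close> is computed from the excursions before \<open>i\<close>. The
  naming it contains is thus fixed before excursion \<open>i\<close> is seen, as
  \<open>relabelled_ingredients\<close> requires. Positions and naming are treated in one induction
  because the killed labels depend on the positions.\<close>

lemma couple_measurable:
  assumes N: "N > 0" and s: "s \<in> borel_measurable borel"
    and X: "\<And>l. X l \<in> measurable M Q" and Q: "sets Q = sets (Exc N)"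
  shows "(\<lambda>\<omega>. cy (couple N s mu x0 (\<lambda>l. X l \<omega>) i) n) \<in> borel_measurable (past M Q X i)"
    "(\<lambda>\<omega>. cz (couple N s mu x0 (\<lambda>l. X l \<omega>) i) n) \<in> borel_measurable (past M Q X i)"
    "(\<lambda>\<omega>. cs (couple N s mu x0 (\<lambda>l. X l \<omega>) i)) \<in> measurable (past M Q X i) (count_space {\<tau>. \<tau> permutes {1..N}})"
proof -
  let ?c = "\<lambda>\<omega> i. couple N s mu x0 (\<lambda>l. X l \<omega>) i"
  have "(\<forall>n. (\<lambda>\<omega>. cy (?c \<omega> i) n) \<in> borel_measurable (past M Q X i)) \<and>
    (\<forall>n. (\<lambda>\<omega>. cz (?c \<omega> i) n) \<in> borel_measurable (past M Q X i)) \<and>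
    (\<lambda>\<omega>. cs (?c \<omega> i)) \<in> measurable (past M Q X i) (count_space {\<tau>. \<tau> permutes {1..N}})"
  proof (induction i)
    case 0
    have "id \<in> space (count_space {\<tau>. \<tau> permutes {1..N}})" by (simp add: permutes_id)
    then show ?case
      unfolding couple.simps cy_def cz_def cs_def fst_conv snd_conv
      by (intro conjI allI borel_measurable_const measurable_const)
  next
    case (Suc i)
    let ?P = "past M Q X (Suc i)"
    have e: "X i \<in> measurable ?P (Exc N)"
      using past_measurable[where X=X, OF X lessI[of i]] by (simp only: measurable_cong_sets[OF refl Q])
    have e1 [measurable]: "(\<lambda>\<omega>. fst (X i \<omega>)) \<in> borel_measurable ?P" using e unfolding Exc_def by measurable
    have k [measurable]: "(\<lambda>\<omega>. fst (snd (X i \<omega>))) \<in> measurable ?P (count_space UNIV)" using e unfolding Exc_def by measurable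
    note up = measurable_past_mono[where X=X, OF X le_SucI[OF order_refl]]
    have y: "(\<lambda>\<omega>. cy (?c \<omega> i) n) \<in> borel_measurable ?P" for n using Suc.IH by (intro up) blast
    have z: "(\<lambda>\<omega>. cz (?c \<omega> i) n) \<in> borel_measurable ?P" for n using Suc.IH by (intro up) blast
    have \<sigma>: "(\<lambda>\<omega>. cs (?c \<omega> i)) \<in> measurable ?P (count_space {\<tau>. \<tau> permutes {1..N}})" using Suc.IH by (intro up) blast
    note inc = measurable_inc[OF e]
    let ?p = "\<lambda>\<omega> n. cy (?c \<omega> i) n + inc N (X i \<omega>) n + mu * fst (X i \<omega>)"
    let ?w = "\<lambda>\<omega> n. cz (?c \<omega> i) n + inc N (X i \<omega>) n + mu * fst (X i \<omega>)"
    have p [measurable]: "(\<lambda>\<omega>. ?p \<omega> n) \<in> borel_measurable ?P" for n using y[of n] inc[of n] e1 by measurable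
    have w [measurable]: "(\<lambda>\<omega>. ?w \<omega> n) \<in> borel_measurable ?P" for n using z[of n] inc[of n] e1 by measurable
    let ?m = "\<lambda>\<omega>. argmin N (\<lambda>n. s (?p \<omega> n))" and ?m' = "\<lambda>\<omega>. argmin N (?w \<omega>)"
    have m [measurable]: "?m \<in> measurable ?P (count_space UNIV)"
      by (rule measurable_argmin) (rule measurable_compose[OF p s])
    have m' [measurable]: "?m' \<in> measurable ?P (count_space UNIV)"
      by (rule measurable_argmin) (rule w)
    let ?k = "\<lambda>\<omega>. fst (snd (X i \<omega>))"
    have eq: "?c \<omega> (Suc i) = ((?p \<omega>)(?m \<omega> := ?p \<omega> (?k \<omega>)), ((?w \<omega>)(?m' \<omega> := ?w \<omega> (?m \<omega>)))(?m \<omega> := ?w \<omega> (?k \<omega>)),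
        Transposition.transpose (?m \<omega>) (?m' \<omega>) \<circ> cs (?c \<omega> i))" for \<omega>
      by (simp add: couple_step_def cy_def cz_def cs_def Let_def split_beta)
    have pk: "(\<lambda>\<omega>. ?p \<omega> (?k \<omega>)) \<in> borel_measurable ?P"
      by (rule measurable_compose_countable[OF p k])
    have wk: "(\<lambda>\<omega>. ?w \<omega> (?k \<omega>)) \<in> borel_measurable ?P"
      by (rule measurable_compose_countable[OF w k])
    have wm: "(\<lambda>\<omega>. ?w \<omega> (?m \<omega>)) \<in> borel_measurable ?P"
      by (rule measurable_compose_countable[OF w m])
    have "(\<lambda>\<omega>. if n = ?m \<omega> then ?p \<omega> (?k \<omega>) else ?p \<omega> n) \<in> borel_measurable ?P" for n
      using pk p[of n] m by measurable
    then have Y: "(\<lambda>\<omega>. cy (?c \<omega> (Suc i)) n) \<in> borel_measurable ?P" for n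
      unfolding eq cy_def fst_conv fun_upd_apply .
    have "(\<lambda>\<omega>. if n = ?m \<omega> then ?w \<omega> (?k \<omega>) else if n = ?m' \<omega> then ?w \<omega> (?m \<omega>) else ?w \<omega> n) \<in> borel_measurable ?P" for n
      using wk wm w[of n] m m' by measurable
    then have Z: "(\<lambda>\<omega>. cz (?c \<omega> (Suc i)) n) \<in> borel_measurable ?P" for n
      unfolding eq cz_def fst_conv snd_conv fun_upd_apply .
    have mN: "?m \<in> measurable ?P (count_space {1..N})" "?m' \<in> measurable ?P (count_space {1..N})"
      using measurable_restrict_space2[of "?m" ?P "{1..N}" "count_space UNIV"] measurable_restrict_space2[of "?m'" ?P "{1..N}" "count_space UNIV"]
        m m' argmin(1)[OF N] by (auto simp: restrict_count_space)
    have S: "(\<lambda>\<omega>. cs (?c \<omega> (Suc i))) \<in> measurable ?P (count_space {\<tau>. \<tau> permutes {1..N}})"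
      unfolding eq cs_def snd_conv
    proof (rule measurable_compose_countable'[OF _ mN(1)])
      fix a assume a: "a \<in> {1..N}"
      show "(\<lambda>\<omega>. Transposition.transpose a (?m' \<omega>) \<circ> snd (snd (?c \<omega> i))) \<in> measurable ?P (count_space {\<tau>. \<tau> permutes {1..N}})"
      proof (rule measurable_compose_countable'[OF _ mN(2)])
        fix b assume b: "b \<in> {1..N}"
        have "(\<lambda>\<tau>. Transposition.transpose a b \<circ> \<tau>) \<in> measurable (count_space {\<tau>. \<tau> permutes {1..N}}) (count_space {\<tau>. \<tau> permutes {1..N}})"
          using permutes_compose[OF _ permutes_swap_id[OF a b]] by auto
        from measurable_compose[OF \<sigma> this]
        show "(\<lambda>\<omega>. Transposition.transpose a b \<circ> snd (snd (?c \<omega> i))) \<in> measurable ?P (count_space {\<tau>. \<tau> permutes {1..N}})"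
          by (simp add: cs_def)
      qed simp
    qed simp
    show ?case using Y Z S by blast
  qed
  then show "(\<lambda>\<omega>. cy (?c \<omega> i) n) \<in> borel_measurable (past M Q X i)"
    "(\<lambda>\<omega>. cz (?c \<omega> i) n) \<in> borel_measurable (past M Q X i)"
    "(\<lambda>\<omega>. cs (?c \<omega> i)) \<in> measurable (past M Q X i) (count_space {\<tau>. \<tau> permutes {1..N}})"
    by blast+
qed

subsection \<open>Absence of ties\<close>

text \<open>\<open>c\<close> is a function of the past and therefore independent of
  \<open>d (X n)\<close>. By Fubini the sum vanishes with the probability that an atomless variable
  hits a fixed value, averaged over that value.\<close>

lemma iid_seq_no_hit:
  assumes X: "iid_seq M Q X" and Q: "prob_space Q" and M: "prob_space M"
    and c: "c \<in> borel_measurable (past M Q X n)" and d: "d \<in> borel_measurable Q"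
    and atom: "\<And>x. AE e in Q. d e \<noteq> (x::real)"
  shows "AE \<omega> in M. c \<omega> + d (X n \<omega>) \<noteq> 0"
proof -
  interpret M: prob_space M by (rule M)
  interpret Q: prob_space Q by (rule Q)
  have m: "X l \<in> measurable M Q" for l by (rule iid_seq_measurable[OF X])
  have cM: "c \<in> borel_measurable M" by (rule measurable_past[where X=X, OF m c])
  have dM: "(\<lambda>\<omega>. d (X n \<omega>)) \<in> borel_measurable M" by (rule measurable_compose[OF m d])
  have pairm: "(\<lambda>\<omega>. (c \<omega>, d (X n \<omega>))) \<in> measurable M (borel \<Otimes>\<^sub>M borel)" using cM dM by measurable
  let ?C = "distr M borel c" and ?D = "distr Q borel d"
  interpret C: prob_space ?C by (rule M.prob_space_distr[OF cM])
  interpret D: prob_space ?D by (rule Q.prob_space_distr[OF d])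
  interpret P: pair_sigma_finite ?C ?D ..
  have law: "?C \<Otimes>\<^sub>M ?D = distr M (borel \<Otimes>\<^sub>M borel) (\<lambda>\<omega>. (c \<omega>, d (X n \<omega>)))"
  proof (rule pair_measure_eqI)
    show "sigma_finite_measure ?C" "sigma_finite_measure ?D" by unfold_locales
    show "sets (?C \<Otimes>\<^sub>M ?D) = sets (distr M (borel \<Otimes>\<^sub>M borel) (\<lambda>\<omega>. (c \<omega>, d (X n \<omega>))))"
      by (simp cong: sets_pair_measure_cong)
    fix A B assume "A \<in> sets ?C" "B \<in> sets ?D"
    then have A: "A \<in> sets borel" and B: "B \<in> sets borel" by simp_all
    have A': "{\<omega> \<in> space M. c \<omega> \<in> A} \<in> sets (past M Q X n)"
      using sets_Collect_mem[OF c A] by simp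
    have B': "{e \<in> space Q. d e \<in> B} \<in> sets Q" by (rule sets_Collect_mem[OF d B])
    have "(\<lambda>\<omega>. (c \<omega>, d (X n \<omega>))) -` (A \<times> B) \<inter> space M = {\<omega> \<in> space M. c \<omega> \<in> A} \<inter> {\<omega> \<in> space M. X n \<omega> \<in> {e \<in> space Q. d e \<in> B}}"
      using measurable_space[OF m] by auto
    then have "measure M ((\<lambda>\<omega>. (c \<omega>, d (X n \<omega>))) -` (A \<times> B) \<inter> space M) = measure M {\<omega> \<in> space M. c \<omega> \<in> A} * measure Q {e \<in> space Q. d e \<in> B}"
      using iid_seq_past_indep[OF X Q M A' B'] by (simp only:)
    moreover have "{\<omega> \<in> space M. c \<omega> \<in> A} = c -` A \<inter> space M" "{e \<in> space Q. d e \<in> B} = d -` B \<inter> space Q" by auto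
    ultimately show "emeasure ?C A * emeasure ?D B = emeasure (distr M (borel \<Otimes>\<^sub>M borel) (\<lambda>\<omega>. (c \<omega>, d (X n \<omega>)))) (A \<times> B)"
      using A B cM d pairm by (simp add: emeasure_distr M.emeasure_eq_measure Q.emeasure_eq_measure ennreal_mult)
  qed
  have "AE z in ?C \<Otimes>\<^sub>M ?D. fst z + snd z \<noteq> 0"
  proof (rule P.AE_pair_measure)
    show "{z \<in> space (?C \<Otimes>\<^sub>M ?D). fst z + snd z \<noteq> 0} \<in> sets (?C \<Otimes>\<^sub>M ?D)" by measurable
    have "AE y in ?D. x + y \<noteq> 0" for x
    proof -
      have "AE e in Q. d e \<noteq> - x" by (rule atom)
      then have "AE e in Q. x + d e \<noteq> 0" by eventually_elim linarith
      then show ?thesis using d by (subst AE_distr_iff) auto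
    qed
    then show "AE x in ?C. AE y in ?D. fst (x, y) + snd (x, y) \<noteq> 0" by simp
  qed
  then have "AE \<omega> in M. fst (c \<omega>, d (X n \<omega>)) + snd (c \<omega>, d (X n \<omega>)) \<noteq> 0"
    unfolding law using pairm by (subst (asm) AE_distr_iff) auto
  then show ?thesis by simp
qed

text \<open>Once the first gap and the other Brownian motion are fixed, what remains random is
  \<open>B m\<close> at a fixed positive time, which is Gaussian. The coefficients \<open>s\<close>
  and \<open>b\<close> are free so that both differences and sums of two positions with drift are
  covered.\<close>

lemma ingredients_no_atom:
  assumes I: "ingredients M N g k B" and mn: "m \<in> {1..N}" "n \<in> {1..N}" "m \<noteq> n"
  shows "AE \<omega> in M. B m (g 0 \<omega>) \<omega> + (s * B n (g 0 \<omega>) \<omega> + b * g 0 \<omega>) \<noteq> (x::real)"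
proof -
  interpret prob_space M by (rule ingredientsD(1)[OF I])
  let ?A = "{Inr (Inr m)} :: (nat + nat + nat) set" and ?B = "{Inr (Inr n), Inl 0} :: (nat + nat + nat) set"
  let ?X = "\<lambda>\<omega>. \<lambda>i\<in>?A. ing_path g k B i \<omega>" and ?Y = "\<lambda>\<omega>. \<lambda>i\<in>?B. ing_path g k B i \<omega>"
  let ?PA = "PiM ?A (\<lambda>_. Path)" and ?PB = "PiM ?B (\<lambda>_. Path)"
  have iv: "indep_var ?PA ?X ?PB ?Y"
    by (rule indep_var_restrict[OF ingredientsD(7)[OF I]]) (use mn in auto)
  note Xm = indep_var_rv1[OF iv] and Ym = indep_var_rv2[OF iv]
  let ?C = "distr M ?PA ?X" and ?D = "distr M ?PB ?Y"
  have law: "?C \<Otimes>\<^sub>M ?D = distr M (?PA \<Otimes>\<^sub>M ?PB) (\<lambda>\<omega>. (?X \<omega>, ?Y \<omega>))"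
    using iv unfolding indep_var_distribution_eq by blast
  interpret C: prob_space ?C by (rule prob_space_distr[OF Xm])
  interpret D: prob_space ?D by (rule prob_space_distr[OF Ym])
  interpret P: pair_sigma_finite ?C ?D ..
  have XYm: "(\<lambda>\<omega>. (?X \<omega>, ?Y \<omega>)) \<in> measurable M (?PA \<Otimes>\<^sub>M ?PB)" using Xm Ym by (rule measurable_Pair)
  let ?f = "\<lambda>p q. evalp (p (Inr (Inr m))) (q (Inl 0) 0) + (s * evalp (q (Inr (Inr n))) (q (Inl 0) 0) + b * q (Inl 0) 0)"
  have [measurable]: "(\<lambda>p. p (Inr (Inr m))) \<in> measurable ?PA Path" by (rule measurable_component_singleton) simp
  have [measurable]: "(\<lambda>q. q (Inr (Inr n))) \<in> measurable ?PB Path" "(\<lambda>q. q (Inl 0)) \<in> measurable ?PB Path"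
    by (rule measurable_component_singleton; simp)+
  have t: "(\<lambda>q. q (Inl 0) 0) \<in> borel_measurable ?PB" by (rule measurable_Path_component) measurable
  have fm: "(\<lambda>z. ?f (fst z) (snd z)) \<in> borel_measurable (?PA \<Otimes>\<^sub>M ?PB)"
  proof -
    have p1: "(\<lambda>z. fst z (Inr (Inr m))) \<in> measurable (?PA \<Otimes>\<^sub>M ?PB) Path"
      and p2: "(\<lambda>z. snd z (Inr (Inr n))) \<in> measurable (?PA \<Otimes>\<^sub>M ?PB) Path"
      and p3: "(\<lambda>z. snd z (Inl 0) 0) \<in> borel_measurable (?PA \<Otimes>\<^sub>M ?PB)"
      using t by measurable
    show ?thesis
      using measurable_evalp[OF p1 p3] measurable_evalp[OF p2 p3] p3 by measurable
  qed
  have W: "is_std_BM M (B m)" by (rule ingredientsD(6)[OF I mn(1)])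
  have one: "AE p in ?C. ?f p q \<noteq> x" if q: "q (Inl 0) 0 > 0" for q
  proof -
    let ?t = "q (Inl 0) 0" and ?r = "s * evalp (q (Inr (Inr n))) (q (Inl 0) 0) + b * q (Inl 0) 0"
    have "distributed M lborel (\<lambda>\<omega>. B m ?t \<omega> - B m 0 \<omega>) (normal_density 0 (sqrt (?t - 0)))"
      using q by (intro is_std_BM_D(4)[OF W]) auto
    note D = this
    have "AE y in density lborel (normal_density 0 (sqrt (?t - 0))). y \<noteq> x - ?r"
      by (subst AE_density) (auto intro: AE_mp[OF AE_lborel_singleton[of "x - ?r"]])
    then have "AE y in distr M lborel (\<lambda>\<omega>. B m ?t \<omega> - B m 0 \<omega>). y \<noteq> x - ?r"
      unfolding distributed_distr_eq_density[OF D] .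
    then have "AE \<omega> in M. B m ?t \<omega> - B m 0 \<omega> \<noteq> x - ?r"
      using D by (subst (asm) AE_distr_iff) (auto simp: distributed_def)
    then have "AE \<omega> in M. ?f (?X \<omega>) q \<noteq> x"
      using is_std_BM_D(3)[OF W] AE_space
    proof eventually_elim
      case (elim \<omega>)
      have "evalp (?X \<omega> (Inr (Inr m))) ?t = B m ?t \<omega>"
        using elim(2) q by (simp add: ing_path_simps evalp_eq continuous_traj) (simp add: traj_def)
      then show ?case using elim(1) is_std_BM_D(2)[OF W elim(3)] by auto
    qed
    moreover have "{p \<in> space ?PA. ?f p q \<noteq> x} \<in> sets ?PA"
    proof -
      have "(\<lambda>p. ?f p q) \<in> borel_measurable ?PA" by measurable
      then show ?thesis by measurable
    qed
    ultimately show ?thesis using Xm by (subst AE_distr_iff) auto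
  qed
  have pos: "AE q in ?D. q (Inl 0) 0 > 0"
  proof -
    have "AE \<omega> in M. ?Y \<omega> (Inl 0) 0 > 0"
      using AE_exponential_pos[OF ingredientsD(2)[OF I, of 0]] by eventually_elim (simp add: ing_path_simps traj_def)
    moreover have "{q \<in> space ?PB. q (Inl 0) 0 > 0} \<in> sets ?PB" using t by measurable
    ultimately show ?thesis using Ym by (subst AE_distr_iff) auto
  qed
  have S: "{z \<in> space (?C \<Otimes>\<^sub>M ?D). ?f (fst z) (snd z) \<noteq> x} \<in> sets (?C \<Otimes>\<^sub>M ?D)"
  proof -
    have "sets (?C \<Otimes>\<^sub>M ?D) = sets (?PA \<Otimes>\<^sub>M ?PB)" "space (?C \<Otimes>\<^sub>M ?D) = space (?PA \<Otimes>\<^sub>M ?PB)"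
      by (simp_all add: space_pair_measure cong: sets_pair_measure_cong)
    then show ?thesis using fm by simp
  qed
  have "AE z in ?C \<Otimes>\<^sub>M ?D. ?f (fst z) (snd z) \<noteq> x"
  proof -
    have "AE q in ?D. AE p in ?C. ?f p q \<noteq> x" using pos by eventually_elim (rule one)
    then have "AE p in ?C. AE q in ?D. ?f p q \<noteq> x"
      by (rule P.AE_commute[of "\<lambda>p q. ?f p q \<noteq> x", OF S, THEN iffD2])
    then have "AE p in ?C. AE q in ?D. ?f (fst (p, q)) (snd (p, q)) \<noteq> x" unfolding fst_conv snd_conv .
    then show ?thesis by (rule P.AE_pair_measure[OF S])
  qed
  then have "AE \<omega> in M. ?f (?X \<omega>) (?Y \<omega>) \<noteq> x"
    unfolding law using XYm fm by (subst (asm) AE_distr_iff) auto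
  then show ?thesis
    using ingredients_AE_continuous[OF I] AE_exponential_pos[OF ingredientsD(2)[OF I, of 0]]
  proof eventually_elim
    case (elim \<omega>)
    have c: "continuous_on {0..} (\<lambda>t. B m t \<omega>)" "continuous_on {0..} (\<lambda>t. B n t \<omega>)" using elim(2) mn by auto
    have "evalp (traj (B l) \<omega>) (g 0 \<omega>) = B l (g 0 \<omega>) \<omega>" if "continuous_on {0..} (\<lambda>t. B l t \<omega>)" for l
      using that elim(3) by (simp add: evalp_eq continuous_traj) (simp add: traj_def)
    note this[OF c(1)] this[OF c(2)]
    moreover have "traj (\<lambda>_. g 0) \<omega> 0 = g 0 \<omega>" by (simp add: traj_def)
    ultimately show ?case using elim(1) by (simp add: ing_path_simps)
  qed
qed

subsection \<open>The rightmost particle of an N-BBM\<close>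

definition rightmost :: "nat \<Rightarrow> (real \<Rightarrow> nat \<Rightarrow> real) \<Rightarrow> real \<Rightarrow> real" where
  "rightmost N X t = Max ((\<lambda>n. X t n) ` {1..N})"

lemma leftmost_le: "n \<in> {1..N} \<Longrightarrow> leftmost N X t \<le> X t n"
  unfolding leftmost_def by (rule Min_le) auto

lemma le_rightmost: "n \<in> {1..N} \<Longrightarrow> X t n \<le> rightmost N X t"
  unfolding rightmost_def by (rule Max_ge) auto

lemma leftmost_attained:
  assumes "N > 0" obtains n where "n \<in> {1..N}" "leftmost N X t = X t n"
proof -
  have "Min ((\<lambda>n. X t n) ` {1..N}) \<in> (\<lambda>n. X t n) ` {1..N}" using assms by (intro Min_in) auto
  then show thesis using that unfolding leftmost_def by auto
qed

lemma rightmost_attained: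
  assumes "N > 0" obtains n where "n \<in> {1..N}" "rightmost N X t = X t n"
proof -
  have "Max ((\<lambda>n. X t n) ` {1..N}) \<in> (\<lambda>n. X t n) ` {1..N}" using assms by (intro Max_in) auto
  then show thesis using that unfolding rightmost_def by auto
qed

lemma leftmost_le_rightmost: "N > 0 \<Longrightarrow> leftmost N X t \<le> rightmost N X t"
  by (metis leftmost_attained le_rightmost)

lemma bd_pathD:
  assumes "bd_path N s mu J K B x0 \<omega> X"
  shows "n \<in> {1..N} \<Longrightarrow> X 0 n = x0 n"
    "J i \<omega> \<le> t \<Longrightarrow> t < J (Suc i) \<omega> \<Longrightarrow> n \<in> {1..N} \<Longrightarrow>
      X t n = X (J i \<omega>) n + (B n t \<omega> - B n (J i \<omega>) \<omega>) + mu * (t - J i \<omega>)"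
  using assms unfolding bd_path_def by blast+

lemma bd_path_jump:
  assumes "bd_path N s mu J K B x0 \<omega> X"
  defines "p \<equiv> \<lambda>i n. X (J i \<omega>) n + (B n (J (Suc i) \<omega>) \<omega> - B n (J i \<omega>) \<omega>) + mu * (J (Suc i) \<omega> - J i \<omega>)"
  obtains m where "m \<in> {1..N}" "\<And>n. n \<in> {1..N} \<Longrightarrow> s (p i m) \<le> s (p i n)"
    "\<And>n. n \<in> {1..N} \<Longrightarrow> X (J (Suc i) \<omega>) n = (if n = m then p i (K (Suc i) \<omega>) else p i n)"
  using assms(1) that unfolding bd_path_def Let_def p_def by blast

text \<open>Suppose the leftmost particle stays more than \<open>4 * \<beta>\<close> below the level
  \<open>X t r\<close>. Labels near that level are then never killed, so their set \<open>S\<close>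
  does not shrink. Whenever \<open>r\<close> is the parent, the killed label jumps next to
  \<open>r\<close> and joins \<open>S\<close>. It starts with at least one label, and after
  \<open>N\<close> such events it would have more than \<open>N\<close>.\<close>

lemma nbbm_catch_up:
  assumes path: "bd_path N (\<lambda>x. x) 0 J K B x0 \<omega> X"
    and K: "\<And>i. K (Suc i) \<omega> \<in> {1..N}"
    and a: "J a \<omega> \<le> t" "t < J (Suc a) \<omega>" and ab: "a \<le> b"
    and b: "\<And>i n. a < i \<Longrightarrow> i \<le> b \<Longrightarrow> n \<in> {1..N} \<Longrightarrow> \<bar>B n (J i \<omega>) \<omega>\<bar> \<le> \<beta>"
      "\<And>n. n \<in> {1..N} \<Longrightarrow> \<bar>B n t \<omega>\<bar> \<le> \<beta>"
    and r: "r \<in> {1..N}"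
    and hits: "(\<Sum>i=a..<b. of_bool (K (Suc i) \<omega> = r)) \<ge> N"
  shows "\<exists>i. a < i \<and> i \<le> b \<and> X t r \<le> leftmost N X (J i \<omega>) + 4 * \<beta>"
proof (rule ccontr)
  assume contra: "\<not> ?thesis"
  let ?R = "X t r"
  \<comment> \<open>Without its own Brownian motion a label moves only when it is killed, so
    \<open>base\<close> is constant for survivors. The base of \<open>r\<close> is at least the
    level minus \<open>\<beta>\<close>. A copy of \<open>r\<close> loses another
    \<open>\<beta>\<close> for each of the two motions involved, which gives
    \<open>3 * \<beta>\<close> in \<open>S\<close>, and adding back a motion gives the
    \<open>4 * \<beta>\<close> of the statement.\<close>
  define base where "base i n = X (J i \<omega>) n - B n (J i \<omega>) \<omega>" for i n
  define S where "S i = {n \<in> {1..N}. base i n \<ge> ?R - 3 * \<beta>}" for i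
  have N: "N > 0" using r by auto
  have \<beta>: "\<beta> \<ge> 0" using b(2)[OF r] by linarith
  have "i \<le> b \<longrightarrow> base i r \<ge> ?R - \<beta> \<and> card (S i) \<ge> 1 + (\<Sum>l=a..<i. of_bool (K (Suc l) \<omega> = r))" if "a \<le> i" for i
    using that
  proof (induction i rule: dec_induct)
    case base
    have "base a r = ?R - B r t \<omega>" using bd_pathD(2)[OF path a r] by (simp add: base_def)
    then have br: "base a r \<ge> ?R - \<beta>" using b(2)[OF r] by linarith
    then have "r \<in> S a" using r \<beta> by (simp add: S_def)
    moreover have "finite (S a)" by (simp add: S_def)
    ultimately have "card (S a) \<ge> 1" by (metis One_nat_def Suc_leI card_gt_0_iff empty_iff)
    then show ?case using br by simp
  next
    case (step i)
    show ?case
    proof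
      assume ib: "Suc i \<le> b"
      then have IH: "base i r \<ge> ?R - \<beta>" "card (S i) \<ge> 1 + (\<Sum>l=a..<i. of_bool (K (Suc l) \<omega> = r))" using step.IH by auto
      let ?p = "\<lambda>n. base i n + B n (J (Suc i) \<omega>) \<omega>"
      obtain m where m: "m \<in> {1..N}" "\<And>n. n \<in> {1..N} \<Longrightarrow> ?p m \<le> ?p n"
        "\<And>n. n \<in> {1..N} \<Longrightarrow> X (J (Suc i) \<omega>) n = (if n = m then ?p (K (Suc i) \<omega>) else ?p n)"
      proof (rule bd_path_jump[OF path, of i])
        fix m assume *: "m \<in> {1..N}"
          "\<And>n. n \<in> {1..N} \<Longrightarrow> X (J i \<omega>) m + (B m (J (Suc i) \<omega>) \<omega> - B m (J i \<omega>) \<omega>) + 0 * (J (Suc i) \<omega> - J i \<omega>)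
              \<le> X (J i \<omega>) n + (B n (J (Suc i) \<omega>) \<omega> - B n (J i \<omega>) \<omega>) + 0 * (J (Suc i) \<omega> - J i \<omega>)"
          "\<And>n. n \<in> {1..N} \<Longrightarrow> X (J (Suc i) \<omega>) n = (if n = m
              then X (J i \<omega>) (K (Suc i) \<omega>) + (B (K (Suc i) \<omega>) (J (Suc i) \<omega>) \<omega> - B (K (Suc i) \<omega>) (J i \<omega>) \<omega>) + 0 * (J (Suc i) \<omega> - J i \<omega>)
              else X (J i \<omega>) n + (B n (J (Suc i) \<omega>) \<omega> - B n (J i \<omega>) \<omega>) + 0 * (J (Suc i) \<omega> - J i \<omega>))"
        have e: "X (J i \<omega>) n + (B n (J (Suc i) \<omega>) \<omega> - B n (J i \<omega>) \<omega>) + 0 * (J (Suc i) \<omega> - J i \<omega>) = ?p n" for n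
          by (simp add: base_def)
        show thesis using that[of m] * unfolding e by blast
      qed
      have Kin: "K (Suc i) \<omega> \<in> {1..N}" by (rule K)
      \<comment> \<open>After the jump every particle occupies some position from just before it,
        and the killed position was the lowest of these.\<close>
      have "?p m \<le> leftmost N X (J (Suc i) \<omega>)"
      proof -
        obtain n where n: "n \<in> {1..N}" "leftmost N X (J (Suc i) \<omega>) = X (J (Suc i) \<omega>) n"
          using leftmost_attained[OF N] by blast
        show ?thesis unfolding n(2) m(3)[OF n(1)] using m(2)[OF Kin] m(2)[OF n(1)] by simp
      qed
      moreover have "\<not> ?R \<le> leftmost N X (J (Suc i) \<omega>) + 4 * \<beta>" using contra step.hyps ib by force
      ultimately have pm: "?p m < ?R - 4 * \<beta>" by linarith
      have bnd: "\<bar>B n (J (Suc i) \<omega>) \<omega>\<bar> \<le> \<beta>" if "n \<in> {1..N}" for n using b(1)[OF _ ib that] step.hyps by simp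
      have mS: "m \<notin> S i"
      proof
        assume "m \<in> S i"
        then have "base i m \<ge> ?R - 3 * \<beta>" by (simp add: S_def)
        then show False using pm bnd[OF m(1)] by linarith
      qed
      have rS: "r \<in> S i" using r IH(1) \<beta> by (simp add: S_def)
      have keep: "base (Suc i) n = base i n" if "n \<in> {1..N}" "n \<noteq> m" for n
        using m(3)[OF that(1)] that(2) by (simp add: base_def)
      have sub: "S i \<subseteq> S (Suc i)"
      proof
        fix n assume n: "n \<in> S i"
        then have "n \<in> {1..N}" "n \<noteq> m" using mS by (auto simp: S_def)
        from keep[OF this] n show "n \<in> S (Suc i)" by (simp add: S_def)
      qed
      have fin: "finite (S (Suc i))" by (simp add: S_def)
      have "r \<noteq> m" using mS rS by blast
      from keep[OF r this] have br: "base (Suc i) r \<ge> ?R - \<beta>" using IH(1) by (simp only:)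
      have "card (S (Suc i)) \<ge> card (S i) + of_bool (K (Suc i) \<omega> = r)"
      proof (cases "K (Suc i) \<omega> = r")
        case True
        have "base (Suc i) m = ?p r - B m (J (Suc i) \<omega>) \<omega>" using m(3)[OF m(1)] True by (simp add: base_def)
        also have "\<dots> \<ge> ?R - 3 * \<beta>" using IH(1) bnd[OF m(1)] bnd[OF r] by linarith
        finally have "m \<in> S (Suc i)" using m(1) by (simp add: S_def)
        then have "card (insert m (S i)) \<le> card (S (Suc i))" using sub fin by (intro card_mono) auto
        moreover have "finite (S i)" by (simp add: S_def)
        ultimately show ?thesis using mS True by simp
      qed (use card_mono[OF fin sub] in simp)
      then show "base (Suc i) r \<ge> ?R - \<beta> \<and> card (S (Suc i)) \<ge> 1 + (\<Sum>l=a..<Suc i. of_bool (K (Suc l) \<omega> = r))"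
        using br IH(2) step.hyps by simp
    qed
  qed
  from this[OF ab] hits have "card (S b) \<ge> 1 + N" by simp
  moreover have "card (S b) \<le> card {1..N}" by (intro card_mono) (auto simp: S_def)
  ultimately show False by simp
qed

text \<open>\<open>w a\<close> is about \<open>(1 + e / 2) * a\<close>. Along this window a sequence
  with linear growth gains the factor \<open>1 + e / 2\<close>: this is less than
  \<open>1 + e\<close> for the jump times, and it gives a linearly growing number of hits, beyond
  any constant \<open>C\<close>.\<close>

lemma eventually_window:
  fixes J h :: "nat \<Rightarrow> real"
  assumes c: "c > 0" and J: "(\<lambda>n. J n / real n) \<longlonglongrightarrow> c" and h: "(\<lambda>n. h n / real n) \<longlonglongrightarrow> c" and e: "e > 0"
  defines "w \<equiv> \<lambda>a. a + nat \<lfloor>e / 2 * real a\<rfloor>"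
  shows "\<forall>\<^sub>F a in sequentially. J (w a) \<le> (1 + e) * J a \<and> h (w a) - h a \<ge> C"
proof -
  have wlim: "(\<lambda>a. real (w a) / real a) \<longlonglongrightarrow> 1 + e / 2"
  proof -
    have "(\<lambda>a. real (nat \<lfloor>e / 2 * real a\<rfloor>) / real a) \<longlonglongrightarrow> e / 2"
    proof (rule tendsto_sandwich[where f="\<lambda>a. e / 2 - 1 / real a" and h="\<lambda>_. e / 2"])
      show "\<forall>\<^sub>F a in sequentially. e / 2 - 1 / real a \<le> real (nat \<lfloor>e / 2 * real a\<rfloor>) / real a"
        using eventually_gt_at_top[of 0]
      proof eventually_elim
        fix a :: nat assume a: "a > 0"
        have "e / 2 * real a - 1 \<le> real (nat \<lfloor>e / 2 * real a\<rfloor>)" using e by linarith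
        then have "(e / 2 * real a - 1) / real a \<le> real (nat \<lfloor>e / 2 * real a\<rfloor>) / real a" by (rule divide_right_mono) simp
        then show "e / 2 - 1 / real a \<le> real (nat \<lfloor>e / 2 * real a\<rfloor>) / real a" using a by (simp add: diff_divide_distrib)
      qed
      show "\<forall>\<^sub>F a in sequentially. real (nat \<lfloor>e / 2 * real a\<rfloor>) / real a \<le> e / 2"
        using eventually_gt_at_top[of 0]
      proof eventually_elim
        fix a :: nat assume a: "a > 0"
        have "real (nat \<lfloor>e / 2 * real a\<rfloor>) \<le> e / 2 * real a" using e by (intro of_nat_floor) simp
        then show "real (nat \<lfloor>e / 2 * real a\<rfloor>) / real a \<le> e / 2" using a by (simp add: field_simps)
      qed
      have "(\<lambda>a. e / 2 - 1 / real a) \<longlonglongrightarrow> e / 2 - 0" by (intro tendsto_intros lim_1_over_n)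
      then show "(\<lambda>a. e / 2 - 1 / real a) \<longlonglongrightarrow> e / 2" by simp
    qed simp
    then have "(\<lambda>a. 1 + real (nat \<lfloor>e / 2 * real a\<rfloor>) / real a) \<longlonglongrightarrow> 1 + e / 2" by (rule tendsto_add[OF tendsto_const])
    moreover have "\<forall>\<^sub>F a in sequentially. 1 + real (nat \<lfloor>e / 2 * real a\<rfloor>) / real a = real (w a) / real a"
      using eventually_gt_at_top[of 0] by eventually_elim (simp add: w_def field_simps)
    ultimately show ?thesis by (rule Lim_transform_eventually)
  qed
  have wtop: "filterlim w sequentially sequentially"
    by (rule filterlim_at_top_mono[OF filterlim_ident]) (simp add: w_def)
  have over: "(\<lambda>a. f (w a) / real a) \<longlonglongrightarrow> c * (1 + e / 2)" if f: "(\<lambda>n. f n / real n) \<longlonglongrightarrow> c" for f :: "nat \<Rightarrow> real"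
  proof -
    have "(\<lambda>a. f (w a) / real (w a) * (real (w a) / real a)) \<longlonglongrightarrow> c * (1 + e / 2)"
      by (intro tendsto_mult wlim filterlim_compose[OF f wtop])
    moreover have "\<forall>\<^sub>F a in sequentially. f (w a) / real (w a) * (real (w a) / real a) = f (w a) / real a"
      using eventually_gt_at_top[of 0] by eventually_elim (simp add: w_def)
    ultimately show ?thesis by (rule Lim_transform_eventually)
  qed
  have "(\<lambda>a. (1 + e) * (J a / real a) - J (w a) / real a) \<longlonglongrightarrow> (1 + e) * c - c * (1 + e / 2)"
    by (intro tendsto_intros J over)
  moreover have "(1 + e) * c - c * (1 + e / 2) > 0" using c e by (simp add: algebra_simps)
  ultimately have "\<forall>\<^sub>F a in sequentially. (1 + e) * (J a / real a) - J (w a) / real a > 0"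
    by (rule order_tendstoD(1))
  then have 1: "\<forall>\<^sub>F a in sequentially. J (w a) \<le> (1 + e) * J a"
    using eventually_gt_at_top[of 0]
  proof eventually_elim
    fix a :: nat assume *: "(1 + e) * (J a / real a) - J (w a) / real a > 0" "a > 0"
    then have "((1 + e) * J a - J (w a)) / real a > 0" by (simp add: diff_divide_distrib)
    then show "J (w a) \<le> (1 + e) * J a" using *(2) by (simp add: zero_less_divide_iff)
  qed
  have "(\<lambda>a. h (w a) / real a - h a / real a) \<longlonglongrightarrow> c * (1 + e / 2) - c"
    by (intro tendsto_intros h over)
  moreover have "c * (1 + e / 2) - c > 0" using c e by (simp add: algebra_simps)
  ultimately have "filterlim (\<lambda>a. (h (w a) / real a - h a / real a) * real a) at_top sequentially"
    by (intro filterlim_tendsto_pos_mult_at_top[OF _ _ filterlim_real_sequentially])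
  then have "\<forall>\<^sub>F a in sequentially. (h (w a) / real a - h a / real a) * real a \<ge> C"
    by (simp add: filterlim_at_top)
  then have "\<forall>\<^sub>F a in sequentially. h (w a) - h a \<ge> C"
    using eventually_gt_at_top[of 0] by eventually_elim (simp add: diff_divide_distrib[symmetric])
  with 1 show ?thesis by eventually_elim simp
qed


definition good_times :: "nat \<Rightarrow> (nat \<Rightarrow> 'a \<Rightarrow> real) \<Rightarrow> (nat \<Rightarrow> 'a \<Rightarrow> nat) \<Rightarrow> 'a \<Rightarrow> bool" where
  "good_times N J K \<omega> \<longleftrightarrow> J 0 \<omega> = 0 \<and> (\<forall>i. J i \<omega> < J (Suc i) \<omega>) \<and> filterlim (\<lambda>i. J i \<omega>) at_top sequentially \<and>
     (\<forall>i. K (Suc i) \<omega> \<in> {1..N})"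

lemma good_times_less:
  assumes "good_times N J K \<omega>" "i < j"
  shows "J i \<omega> < J j \<omega>"
  using assms lift_Suc_mono_less[of "\<lambda>i. J i \<omega>" i j] by (auto simp: good_times_def)

lemma good_times_interval:
  assumes "good_times N J K \<omega>" "t \<ge> 0"
  obtains i where "J i \<omega> \<le> t" "t < J (Suc i) \<omega>"
  using jump_interval[of "\<lambda>i. J i \<omega>" t] assms by (auto simp: good_times_def)

lemma good_times_interval_late:
  assumes "good_times N J K \<omega>" "J a \<omega> \<le> t" "t < J (Suc i) \<omega>"
  shows "a \<le> i"
proof (rule ccontr)
  assume "\<not> a \<le> i"
  then have "Suc i = a \<or> Suc i < a" by linarith
  then have "J (Suc i) \<omega> \<le> J a \<omega>" using good_times_less[OF assms(1), of "Suc i" a] by auto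
  then show False using assms by linarith
qed

text \<open>Within the time window from \<open>t\<close> to \<open>(1 + e) * t\<close> every label
  becomes a parent at least \<open>N\<close> times, so by \<open>nbbm_catch_up\<close> the leftmost
  particle nearly attains the level \<open>rightmost N X t\<close> at some time in it. At that time
  it is close to \<open>v\<close> times the time, which is itself close to
  \<open>v * t\<close>.\<close>

theorem nbbm_rightmost_speed:
  assumes N: "N > 0" and path: "bd_path N (\<lambda>x. x) 0 J K B x0 \<omega> X" and good: "good_times N J K \<omega>"
    and J: "(\<lambda>n. J n \<omega> / real n) \<longlonglongrightarrow> 1 / real N"
    and h: "\<And>r. r \<in> {1..N} \<Longrightarrow> (\<lambda>n. (\<Sum>i<n. of_bool (K (Suc i) \<omega> = r)) / real n) \<longlonglongrightarrow> 1 / real N"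
    and B: "\<And>n. n \<in> {1..N} \<Longrightarrow> ((\<lambda>t. B n t \<omega> / t) \<longlongrightarrow> 0) at_top"
    and L: "((\<lambda>t. leftmost N X t / t) \<longlongrightarrow> v) at_top"
  shows "((\<lambda>t. rightmost N X t / t) \<longlongrightarrow> v) at_top"
proof -
  \<comment> \<open>The constant collects three errors, each in units of \<open>e * t\<close>: the
    delay of at most \<open>e * t\<close> costs \<open>\<bar>v\<bar>\<close>, the error of the
    leftmost speed costs 2 because the window ends before \<open>2 * t\<close>, and
    \<open>4 * \<beta>\<close> with \<open>\<beta> = 2 * e * t\<close> costs 8.\<close>
  have upper: "\<forall>\<^sub>F t in at_top. rightmost N X t / t \<le> v + (\<bar>v\<bar> + 10) * e" if e: "0 < e" "e \<le> 1" for e :: real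
  proof -
    let ?h = "\<lambda>r n. \<Sum>i<n. of_bool (K (Suc i) \<omega> = r) :: real"
    let ?w = "\<lambda>a. a + nat \<lfloor>e / 2 * real a\<rfloor>"
    have "\<forall>\<^sub>F a in sequentially. \<forall>r\<in>{1..N}. J (?w a) \<omega> \<le> (1 + e) * J a \<omega> \<and> ?h r (?w a) - ?h r a \<ge> real N"
    proof (intro eventually_ball_finite ballI)
      fix r assume r: "r \<in> {1..N}"
      have "1 / real N > 0" using N by simp
      from eventually_window[OF this J h[OF r] e(1)]
      show "\<forall>\<^sub>F a in sequentially. J (?w a) \<omega> \<le> (1 + e) * J a \<omega> \<and> ?h r (?w a) - ?h r a \<ge> real N" .
    qed simp
    then obtain a0 where a0: "\<And>a r. a \<ge> a0 \<Longrightarrow> r \<in> {1..N} \<Longrightarrow> J (?w a) \<omega> \<le> (1 + e) * J a \<omega> \<and> ?h r (?w a) - ?h r a \<ge> real N"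
      unfolding eventually_sequentially by blast
    have "\<forall>\<^sub>F t in at_top. \<bar>leftmost N X t / t - v\<bar> < e"
      using tendstoD[OF L e(1)] by (simp add: dist_real_def)
    then obtain T1 where T1: "\<And>t. t \<ge> T1 \<Longrightarrow> \<bar>leftmost N X t / t - v\<bar> < e"
      unfolding eventually_at_top_linorder by blast
    have "\<forall>\<^sub>F t in at_top. \<forall>n\<in>{1..N}. \<bar>B n t \<omega> / t\<bar> < e"
    proof (intro eventually_ball_finite ballI)
      fix n assume "n \<in> {1..N}"
      from tendstoD[OF B[OF this] e(1)] show "\<forall>\<^sub>F t in at_top. \<bar>B n t \<omega> / t\<bar> < e" by (simp add: dist_real_def)
    qed simp
    then obtain T2 where T2: "\<And>t n. t \<ge> T2 \<Longrightarrow> n \<in> {1..N} \<Longrightarrow> \<bar>B n t \<omega> / t\<bar> < e"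
      unfolding eventually_at_top_linorder by blast
    show ?thesis
      unfolding eventually_at_top_linorder
    proof (intro exI allI impI)
      fix t assume "t \<ge> max (max T1 T2) (max 1 (J a0 \<omega>))"
      then have t: "t \<ge> T1" "t \<ge> T2" "t \<ge> 1" "t \<ge> J a0 \<omega>" by auto
      obtain a where a: "J a \<omega> \<le> t" "t < J (Suc a) \<omega>" using good_times_interval[OF good] t(3) by (metis order_trans zero_le_one)
      have aa: "a \<ge> a0" by (rule good_times_interval_late[OF good t(4) a(2)])
      obtain r where r: "r \<in> {1..N}" "rightmost N X t = X t r" using rightmost_attained[OF N] by blast
      let ?b = "?w a"
      have win: "J ?b \<omega> \<le> (1 + e) * J a \<omega>" "?h r ?b - ?h r a \<ge> real N" using a0[OF aa r(1)] by auto
      have ee: "(1 + e) * J a \<omega> \<le> (1 + e) * t" using a(1) e by (intro mult_left_mono) auto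
      have le2: "(1 + e) * t \<le> 2 * t" using e t(3) by (intro mult_right_mono) auto
      have J1: "J i \<omega> \<ge> t" "J i \<omega> \<le> (1 + e) * t" if "a < i" "i \<le> ?b" for i
      proof -
        have "J (Suc a) \<omega> \<le> J i \<omega>" using good_times_less[OF good, of "Suc a" i] that by (cases "Suc a = i") auto
        then show "J i \<omega> \<ge> t" using a(2) by linarith
        have "J i \<omega> \<le> J ?b \<omega>" using good_times_less[OF good, of i ?b] that by (cases "i = ?b") auto
        then show "J i \<omega> \<le> (1 + e) * t" using win(1) ee by linarith
      qed
      have Bb: "\<bar>B n s \<omega>\<bar> \<le> 2 * e * t" if "t \<le> s" "s \<le> (1 + e) * t" "n \<in> {1..N}" for n s
      proof -
        have "s > 0" using that t(3) by linarith
        have "\<bar>B n s \<omega> / s\<bar> < e" using T2[of s n] that t by auto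
        then have "\<bar>B n s \<omega>\<bar> < e * s" using \<open>s > 0\<close> by (simp add: abs_divide divide_less_eq)
        also have "e * s \<le> e * (2 * t)" using that le2 e by (intro mult_left_mono) linarith+
        finally show ?thesis by simp
      qed
      have te: "t \<le> (1 + e) * t" using e t(3) by (simp add: distrib_right)
      have hits: "(\<Sum>i=a..<?b. of_bool (K (Suc i) \<omega> = r)) \<ge> N"
      proof -
        have "?h r ?b = ?h r a + (\<Sum>i=a..<?b. of_bool (K (Suc i) \<omega> = r))"
          using sum.atLeastLessThan_concat[of 0 a ?b "\<lambda>i. of_bool (K (Suc i) \<omega> = r) :: real"] by (simp add: atLeast0LessThan)
        then have "real N \<le> (\<Sum>i=a..<?b. of_bool (K (Suc i) \<omega> = r))" using win(2) by linarith
        also have "\<dots> = real (\<Sum>i=a..<?b. of_bool (K (Suc i) \<omega> = r))" by simp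
        finally show ?thesis unfolding of_nat_le_iff .
      qed
      have "\<exists>i. a < i \<and> i \<le> ?b \<and> X t r \<le> leftmost N X (J i \<omega>) + 4 * (2 * e * t)"
      proof (rule nbbm_catch_up[OF path _ a _ _ _ r(1) hits])
        show "K (Suc i) \<omega> \<in> {1..N}" for i using good by (simp add: good_times_def)
        show "\<bar>B n (J i \<omega>) \<omega>\<bar> \<le> 2 * e * t" if "a < i" "i \<le> ?b" "n \<in> {1..N}" for i n
          using that J1[OF that(1,2)] by (intro Bb) auto
        show "\<bar>B n t \<omega>\<bar> \<le> 2 * e * t" if "n \<in> {1..N}" for n using that te by (intro Bb) auto
      qed simp
      then obtain i where i: "a < i" "i \<le> ?b" "X t r \<le> leftmost N X (J i \<omega>) + 4 * (2 * e * t)" by blast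
      let ?s = "J i \<omega>"
      note s = J1[OF i(1,2)]
      have s0: "?s > 0" using s t by linarith
      have "leftmost N X ?s / ?s < v + e" using T1[of ?s] s t by auto
      then have "leftmost N X ?s < (v + e) * ?s" using s0 by (simp add: divide_less_eq)
      also have "(v + e) * ?s = v * t + v * (?s - t) + e * ?s" by (simp add: algebra_simps)
      also have "\<dots> \<le> v * t + \<bar>v\<bar> * (e * t) + e * (2 * t)"
      proof -
        have "v * (?s - t) \<le> \<bar>v\<bar> * (?s - t)" using s by (intro mult_right_mono) auto
        also have "\<dots> \<le> \<bar>v\<bar> * (e * t)" using s by (intro mult_left_mono) (auto simp: algebra_simps)
        finally have "v * (?s - t) \<le> \<bar>v\<bar> * (e * t)" .
        moreover have "e * ?s \<le> e * (2 * t)" using s le2 e by (intro mult_left_mono) auto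
        ultimately show ?thesis by linarith
      qed
      finally have "X t r \<le> v * t + \<bar>v\<bar> * (e * t) + e * (2 * t) + 4 * (2 * e * t)" using i(3) by linarith
      also have "\<dots> = (v + (\<bar>v\<bar> + 10) * e) * t" by (simp add: algebra_simps)
      finally show "rightmost N X t / t \<le> v + (\<bar>v\<bar> + 10) * e" using t(3) unfolding r(2) by (simp add: divide_le_eq)
    qed
  qed
  show ?thesis
  proof (rule order_tendstoI)
    fix y assume "y < v"
    from order_tendstoD(1)[OF L this]
    show "\<forall>\<^sub>F t in at_top. y < rightmost N X t / t"
      using eventually_gt_at_top[of 0]
    proof eventually_elim
      fix t :: real assume *: "y < leftmost N X t / t" "0 < t"
      have "leftmost N X t / t \<le> rightmost N X t / t" using leftmost_le_rightmost[OF N] *(2) by (intro divide_right_mono) auto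
      then show "y < rightmost N X t / t" using * by linarith
    qed
  next
    fix y assume y: "v < y"
    define e where "e = min 1 ((y - v) / (2 * (\<bar>v\<bar> + 10)))"
    have e: "0 < e" "e \<le> 1" using y by (auto simp: e_def)
    have "(\<bar>v\<bar> + 10) * e \<le> (\<bar>v\<bar> + 10) * ((y - v) / (2 * (\<bar>v\<bar> + 10)))" by (intro mult_left_mono) (auto simp: e_def)
    also have "\<dots> = (y - v) / 2"
    proof -
      have "\<bar>v\<bar> + 10 \<noteq> 0" by linarith
      then show ?thesis by (simp add: field_simps)
    qed
    finally have small: "(\<bar>v\<bar> + 10) * e \<le> (y - v) / 2" .
    have "(y - v) / 2 < y - v" using y by simp
    with small have "(\<bar>v\<bar> + 10) * e < y - v" by (rule le_less_trans)
    then have "v + (\<bar>v\<bar> + 10) * e < y" by (simp only: less_diff_eq add.commute)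
    with upper[OF e] show "\<forall>\<^sub>F t in at_top. rightmost N X t / t < y" by (auto elim: eventually_mono)
  qed
qed

text \<open>Every jump increases the sum of the positions, which is therefore bounded below by the sum of
  the driving Brownian motions.\<close>

lemma nbbm_speed_nonneg:
  assumes N: "N > 0" and path: "bd_path N (\<lambda>x. x) 0 J K B x0 \<omega> X" and good: "good_times N J K \<omega>"
    and B: "\<And>n. n \<in> {1..N} \<Longrightarrow> ((\<lambda>t. B n t \<omega> / t) \<longlongrightarrow> 0) at_top"
    and R: "((\<lambda>t. rightmost N X t / t) \<longlongrightarrow> v) at_top"
  shows "v \<ge> 0"
proof -
  define S where "S i = (\<Sum>n=1..N. X (J i \<omega>) n - B n (J i \<omega>) \<omega>)" for i
  have "S i \<le> S (Suc i)" for i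
  proof -
    obtain m where m: "m \<in> {1..N}"
      "\<And>n. n \<in> {1..N} \<Longrightarrow> X (J i \<omega>) m + (B m (J (Suc i) \<omega>) \<omega> - B m (J i \<omega>) \<omega>) + 0 * (J (Suc i) \<omega> - J i \<omega>)
              \<le> X (J i \<omega>) n + (B n (J (Suc i) \<omega>) \<omega> - B n (J i \<omega>) \<omega>) + 0 * (J (Suc i) \<omega> - J i \<omega>)"
      "\<And>n. n \<in> {1..N} \<Longrightarrow> X (J (Suc i) \<omega>) n = (if n = m
              then X (J i \<omega>) (K (Suc i) \<omega>) + (B (K (Suc i) \<omega>) (J (Suc i) \<omega>) \<omega> - B (K (Suc i) \<omega>) (J i \<omega>) \<omega>) + 0 * (J (Suc i) \<omega> - J i \<omega>)
              else X (J i \<omega>) n + (B n (J (Suc i) \<omega>) \<omega> - B n (J i \<omega>) \<omega>) + 0 * (J (Suc i) \<omega> - J i \<omega>))"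
      by (rule bd_path_jump[OF path, of i]) blast
    have Kin: "K (Suc i) \<omega> \<in> {1..N}" using good by (simp add: good_times_def)
    show ?thesis unfolding S_def
    proof (rule sum_mono)
      fix n assume n: "n \<in> {1..N}"
      show "X (J i \<omega>) n - B n (J i \<omega>) \<omega> \<le> X (J (Suc i) \<omega>) n - B n (J (Suc i) \<omega>) \<omega>"
        using m(2)[OF Kin] unfolding m(3)[OF n] by (cases "n = m") auto
    qed
  qed
  then have S: "S 0 \<le> S i" for i by (rule lift_Suc_mono_le) simp
  have ineq: "S 0 / t + (\<Sum>n=1..N. B n t \<omega> / t) \<le> real N * (rightmost N X t / t)" if t: "t > 0" for t
  proof -
    obtain i where i: "J i \<omega> \<le> t" "t < J (Suc i) \<omega>" using good_times_interval[OF good] t by (metis less_imp_le)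
    have "S 0 + (\<Sum>n=1..N. B n t \<omega>) \<le> S i + (\<Sum>n=1..N. B n t \<omega>)" using S by simp
    also have "\<dots> = (\<Sum>n=1..N. X t n)"
      unfolding S_def sum.distrib[symmetric] by (rule sum.cong[OF refl]) (use bd_pathD(2)[OF path i] in simp)
    also have "\<dots> \<le> (\<Sum>n=1..N. rightmost N X t)" by (rule sum_mono) (rule le_rightmost)
    also have "\<dots> = real N * rightmost N X t" by simp
    finally have "(S 0 + (\<Sum>n=1..N. B n t \<omega>)) / t \<le> (real N * rightmost N X t) / t" using t by (intro divide_right_mono) auto
    then show ?thesis by (simp add: add_divide_distrib sum_divide_distrib)
  qed
  have "((\<lambda>t. S 0 / t + (\<Sum>n=1..N. B n t \<omega> / t)) \<longlongrightarrow> 0 + (\<Sum>n=1..N. 0)) at_top"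
    by (intro tendsto_intros B tendsto_divide_0[OF tendsto_const] filterlim_at_top_imp_at_infinity filterlim_ident)
  then have "((\<lambda>t. S 0 / t + (\<Sum>n=1..N. B n t \<omega> / t)) \<longlongrightarrow> 0) at_top" by simp
  moreover have "((\<lambda>t. real N * (rightmost N X t / t)) \<longlongrightarrow> real N * v) at_top" by (intro tendsto_intros R)
  moreover have "\<forall>\<^sub>F t in at_top. S 0 / t + (\<Sum>n=1..N. B n t \<omega> / t) \<le> real N * (rightmost N X t / t)"
    using eventually_gt_at_top[of 0] by eventually_elim (rule ineq)
  ultimately have "0 \<le> real N * v" by (intro tendsto_le[OF trivial_limit_at_top_linorder])
  then show ?thesis using N by (simp add: zero_le_mult_iff)
qed

subsection \<open>Paths with prescribed values at the jump times\<close>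

text \<open>The least \<open>i\<close> with \<open>t\<close> before jump \<open>Suc i\<close> is the
  number of the gap containing \<open>t\<close>. This extends values \<open>v i\<close> prescribed
  at the jumps to a path that satisfies the clause of \<open>bd_path\<close> between jumps.\<close>

definition interp where
  "interp J B mu v \<omega> t n = (let i = (LEAST i. t < J (Suc i) \<omega>) in v i n + (B n t \<omega> - B n (J i \<omega>) \<omega>) + mu * (t - J i \<omega>))"

lemma interp_eq:
  assumes "good_times N J K \<omega>" "J i \<omega> \<le> t" "t < J (Suc i) \<omega>"
  shows "interp J B mu v \<omega> t n = v i n + (B n t \<omega> - B n (J i \<omega>) \<omega>) + mu * (t - J i \<omega>)"
proof -
  have "(LEAST i. t < J (Suc i) \<omega>) = i"
    using assms(3) good_times_interval_late[OF assms(1,2)] by (rule Least_equality)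
  then show ?thesis by (simp add: interp_def)
qed

lemma bd_path_interp:
  fixes mu :: real and s :: "real \<Rightarrow> real" and B :: "nat \<Rightarrow> real \<Rightarrow> 'a \<Rightarrow> real"
  assumes good: "good_times N J K \<omega>" and v0: "\<And>n. n \<in> {1..N} \<Longrightarrow> v 0 n = x0 n"
  defines "p \<equiv> \<lambda>i n. v i n + (B n (J (Suc i) \<omega>) \<omega> - B n (J i \<omega>) \<omega>) + mu * (J (Suc i) \<omega> - J i \<omega>)"
  assumes step: "\<And>i. \<exists>m\<in>{1..N}. (\<forall>n\<in>{1..N}. s (p i m) \<le> s (p i n)) \<and>
      (\<forall>n\<in>{1..N}. v (Suc i) n = (if n = m then p i (K (Suc i) \<omega>) else p i n))"
  shows "bd_path N s mu J K B x0 \<omega> (interp J B mu v \<omega>)"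
proof -
  have lt: "J i \<omega> < J (Suc i) \<omega>" for i using good by (simp add: good_times_def)
  have at: "interp J B mu v \<omega> (J i \<omega>) n = v i n" for i n
    using interp_eq[OF good order_refl lt] by simp
  have J0: "J 0 \<omega> = 0" using good by (simp add: good_times_def)
  show ?thesis
    unfolding bd_path_def Let_def at
  proof (intro conjI allI impI ballI)
    fix n assume "n \<in> {1..N}"
    then show "interp J B mu v \<omega> 0 n = x0 n" using at[of 0 n] v0 by (simp add: J0)
  next
    fix i t n assume "J i \<omega> \<le> t" "t < J (Suc i) \<omega>"
    then show "interp J B mu v \<omega> t n = v i n + (B n t \<omega> - B n (J i \<omega>) \<omega>) + mu * (t - J i \<omega>)"
      by (rule interp_eq[OF good])
  next
    fix i
    show "\<exists>m\<in>{1..N}. (\<forall>n\<in>{1..N}. s (v i m + (B m (J (Suc i) \<omega>) \<omega> - B m (J i \<omega>) \<omega>) + mu * (J (Suc i) \<omega> - J i \<omega>))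
              \<le> s (v i n + (B n (J (Suc i) \<omega>) \<omega> - B n (J i \<omega>) \<omega>) + mu * (J (Suc i) \<omega> - J i \<omega>))) \<and>
          (\<forall>n\<in>{1..N}. v (Suc i) n = (if n = m
             then v i (K (Suc i) \<omega>) + (B (K (Suc i) \<omega>) (J (Suc i) \<omega>) \<omega> - B (K (Suc i) \<omega>) (J i \<omega>) \<omega>) + mu * (J (Suc i) \<omega> - J i \<omega>)
             else v i n + (B n (J (Suc i) \<omega>) \<omega> - B n (J i \<omega>) \<omega>) + mu * (J (Suc i) \<omega> - J i \<omega>)))"
      using step[of i] unfolding p_def .
  qed
qed

subsection \<open>The coupling inequality\<close>

text \<open>The third equation is the point of the renaming. Read through the updated names, the
  exchange cancels and only the label \<open>m'\<close> is replaced, by a copy of the parent. In its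
  own labels the second system thus performs an ordinary N-BBM step.\<close>

lemma couple_step_simps:
  fixes e c and N :: nat and mu :: real and s :: "real \<Rightarrow> real"
  defines "p \<equiv> \<lambda>n. cy c n + inc N e n + mu * fst e" and "w \<equiv> \<lambda>n. cz c n + inc N e n + mu * fst e"
  defines "m \<equiv> argmin N (\<lambda>n. s (p n))" and "m' \<equiv> argmin N w"
  shows "cy (couple_step N s mu e c) n = (if n = m then p (fst (snd e)) else p n)"
    "cz (couple_step N s mu e c) n = (if n = m then w (fst (snd e)) else if n = m' then w m else w n)"
    "cz (couple_step N s mu e c) (Transposition.transpose m m' n) = (if n = m' then w (fst (snd e)) else w n)"
    "cs (couple_step N s mu e c) = Transposition.transpose m m' \<circ> cs c"
proof -
  have eq: "couple_step N s mu e c = (p(m := p (fst (snd e))), (w(m' := w m))(m := w (fst (snd e))), Transposition.transpose m m' \<circ> cs c)"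
    by (simp add: couple_step_def cy_def cz_def cs_def Let_def split_beta p_def w_def m_def m'_def)
  show "cy (couple_step N s mu e c) n = (if n = m then p (fst (snd e)) else p n)"
    unfolding eq cy_def by simp
  show z: "cz (couple_step N s mu e c) n = (if n = m then w (fst (snd e)) else if n = m' then w m else w n)" for n
    unfolding eq cz_def by simp
  show "cz (couple_step N s mu e c) (Transposition.transpose m m' n) = (if n = m' then w (fst (snd e)) else w n)"
    unfolding z by (auto simp: Transposition.transpose_def)
  show "cs (couple_step N s mu e c) = Transposition.transpose m m' \<circ> cs c"
    unfolding eq cs_def by simp
qed

text \<open>At \<open>m\<close> both systems put a copy of the same parent, whose positions are
  ordered. At \<open>m'\<close> the second system now has the position \<open>?w ?m\<close>, which
  lies above its minimum \<open>?w ?m'\<close> and hence above the position of the first system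
  there. Nothing is assumed about which label the first system kills.\<close>

lemma couple_step_le:
  assumes N: "N > 0" and k: "fst (snd e) \<in> {1..N}" and le: "\<And>n. n \<in> {1..N} \<Longrightarrow> cy c n \<le> cz c n" and n: "n \<in> {1..N}"
  shows "cy (couple_step N s mu e c) n \<le> cz (couple_step N s mu e c) n"
proof -
  let ?p = "\<lambda>n. cy c n + inc N e n + mu * fst e" and ?w = "\<lambda>n. cz c n + inc N e n + mu * fst e"
  let ?m = "argmin N (\<lambda>n. s (?p n))" and ?m' = "argmin N ?w"
  have m: "?m \<in> {1..N}" by (rule argmin(1)[OF N])
  have min: "?w ?m' \<le> ?w ?m" by (rule argmin(2)[OF N m])
  have pw: "?p n \<le> ?w n" if "n \<in> {1..N}" for n using le[OF that] by simp
  show ?thesis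
    unfolding couple_step_simps using pw[OF k] pw[OF n] min by auto
qed

text \<open>The critical label is \<open>m'\<close>, where the second system receives
  \<open>?w ?m\<close>. This is at most \<open>?p ?m + C\<close>, and since \<open>?m\<close> is the
  lowest particle of the first system, at most \<open>?p n + C\<close> for every label
  \<open>n\<close>.\<close>

lemma couple_step_gap:
  assumes N: "N > 0" and k: "fst (snd e) \<in> {1..N}" and gap: "\<And>n. n \<in> {1..N} \<Longrightarrow> cz c n \<le> cy c n + C" and n: "n \<in> {1..N}"
    and lowest: "\<And>j. j \<in> {1..N} \<Longrightarrow> cy c (argmin N (\<lambda>n. s (cy c n + inc N e n + mu * fst e))) + inc N e (argmin N (\<lambda>n. s (cy c n + inc N e n + mu * fst e))) \<le> cy c j + inc N e j"
  shows "cz (couple_step N s mu e c) n \<le> cy (couple_step N s mu e c) n + C"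
proof -
  let ?p = "\<lambda>n. cy c n + inc N e n + mu * fst e" and ?w = "\<lambda>n. cz c n + inc N e n + mu * fst e"
  let ?m = "argmin N (\<lambda>n. s (?p n))" and ?m' = "argmin N ?w"
  have m: "?m \<in> {1..N}" by (rule argmin(1)[OF N])
  have low: "?p ?m \<le> ?p n" using lowest[OF n] by linarith
  have wp: "?w n \<le> ?p n + C" if "n \<in> {1..N}" for n using gap[OF that] by simp
  show ?thesis
    unfolding couple_step_simps using wp[OF k] wp[OF n] wp[OF m] low by auto
qed

definition ties :: "nat \<Rightarrow> (nat \<Rightarrow> real) \<Rightarrow> bool" where
  "ties N p \<longleftrightarrow> (\<exists>m\<in>{1..N}. \<exists>n\<in>{1..N}. m \<noteq> n \<and> \<bar>p m\<bar> = \<bar>p n\<bar>)"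

lemma inc_exc_seq:
  assumes "good_sample N g k B \<omega>" "n \<in> {1..N}"
  shows "inc N (exc_seq N g k B l \<omega>) n = B n (jump_time g (Suc l) \<omega>) \<omega> - B n (jump_time g l \<omega>) \<omega>"
proof -
  have g: "g l \<omega> > 0" using assms(1) by (simp add: good_sample_def)
  have "good_excs N (\<lambda>l. relabel N id (exc_seq N g k B l \<omega>))"
    by (rule good_excs_relabel[OF assms(1) permutes_id])
  moreover have "relabel N id (exc_seq N g k B l \<omega>) = exc_seq N g k B l \<omega>" for l
    by (auto simp: relabel_def good_sample_exc_seq[OF assms(1)] fun_eq_iff)
  ultimately have "continuous_on {0..} (snd (snd (exc_seq N g k B l \<omega>)) n)"
    using assms(2) unfolding good_excs_def by simp
  then have "evalp (snd (snd (exc_seq N g k B l \<omega>)) n) (g l \<omega>) = snd (snd (exc_seq N g k B l \<omega>)) n (g l \<omega>)"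
    by (rule evalp_eq) (use g in simp)
  then show ?thesis
    using assms(2) g unfolding inc_def good_sample_exc_seq[OF assms(1)] by (simp add: jump_time_def)
qed

text \<open>Two absolute values agree only if the difference or the sum of the positions vanishes.
  Each is a function of the past plus an atomless function of the current excursion, so
  \<open>iid_seq_no_hit\<close> excludes both. The drift cancels in the difference and counts twice
  in the sum, whence \<open>0\<close> and \<open>2 * mu\<close>.\<close>

theorem couple_no_ties:
  assumes I: "ingredients M N g k B" and N: "N > 0" and s: "s \<in> borel_measurable borel"
  shows "AE \<omega> in M. \<forall>i. \<not> ties N (\<lambda>n. cy (couple N s mu x0 (\<lambda>l. exc_seq N g k B l \<omega>) i) n
      + inc N (exc_seq N g k B i \<omega>) n + mu * fst (exc_seq N g k B i \<omega>))"
proof -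
  interpret prob_space M by (rule ingredientsD(1)[OF I])
  let ?X = "exc_seq N g k B" and ?Q = "exc_law M N g k B"
  have iid: "iid_seq M ?Q ?X" by (rule exc_seq_iid[OF I])
  have Q: "prob_space ?Q" by (rule prob_space_exc_law[OF I])
  let ?y = "\<lambda>\<omega> i n. cy (couple N s mu x0 (\<lambda>l. ?X l \<omega>) i) n"
  have ym: "(\<lambda>\<omega>. ?y \<omega> i n) \<in> borel_measurable (past M ?Q ?X i)" for i n
    by (rule couple_measurable(1)[OF N s iid_seq_measurable[OF iid] sets_exc_law])
  have XE: "?X l \<in> measurable M (Exc N)" for l
    using iid_seq_measurable[OF iid, of l] by (simp only: measurable_cong_sets[OF refl sets_exc_law])
  have key: "AE \<omega> in M. (?y \<omega> i m + r * ?y \<omega> i n) + (inc N (?X i \<omega>) m + (r * inc N (?X i \<omega>) n + b * fst (?X i \<omega>))) \<noteq> 0"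
    if mn: "m \<in> {1..N}" "n \<in> {1..N}" "m \<noteq> n" for i m n and r b :: real
  proof (rule iid_seq_no_hit[OF iid Q prob_space_axioms, where d="\<lambda>e. inc N e m + (r * inc N e n + b * fst e)"])
    show "(\<lambda>\<omega>. ?y \<omega> i m + r * ?y \<omega> i n) \<in> borel_measurable (past M ?Q ?X i)" using ym[of i m] ym[of i n] by measurable
    have [measurable]: "(\<lambda>e. inc N e j) \<in> borel_measurable (Exc N)" for j
      by (rule measurable_inc) (rule measurable_ident_sets[OF refl])
    have [measurable]: "fst \<in> borel_measurable (Exc N)" unfolding Exc_def by measurable
    have dm: "(\<lambda>e. inc N e m + (r * inc N e n + b * fst e)) \<in> borel_measurable (Exc N)" by measurable
    then show "(\<lambda>e. inc N e m + (r * inc N e n + b * fst e)) \<in> borel_measurable ?Q"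
      by (simp only: measurable_cong_sets[OF sets_exc_law refl])
    fix x :: real
    have "AE \<omega> in M. inc N (?X 0 \<omega>) m + (r * inc N (?X 0 \<omega>) n + b * fst (?X 0 \<omega>)) \<noteq> x"
      using ingredients_no_atom[OF I mn, of r b x] AE_good_sample[OF I N]
    proof eventually_elim
      case (elim \<omega>)
      have "B j 0 \<omega> = 0" if "j \<in> {1..N}" for j using elim(2) that by (simp add: good_sample_def)
      then have "inc N (?X 0 \<omega>) j = B j (g 0 \<omega>) \<omega>" if "j \<in> {1..N}" for j
        using inc_exc_seq[OF elim(2) that, of 0] that by (simp add: jump_time_def)
      moreover have "fst (?X 0 \<omega>) = g 0 \<omega>" by (simp add: good_sample_exc_seq[OF elim(2)])
      ultimately show ?case using elim(1) mn by simp
    qed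
    then show "AE e in ?Q. inc N e m + (r * inc N e n + b * fst e) \<noteq> x"
      unfolding exc_law_def using XE[of 0] dm by (subst AE_distr_iff) auto
  qed
  have "AE \<omega> in M. \<forall>i. \<forall>m\<in>{1..N}. \<forall>n\<in>{1..N}. m \<noteq> n \<longrightarrow>
      (?y \<omega> i m + (-1) * ?y \<omega> i n) + (inc N (?X i \<omega>) m + ((-1) * inc N (?X i \<omega>) n + 0 * fst (?X i \<omega>))) \<noteq> 0 \<and>
      (?y \<omega> i m + 1 * ?y \<omega> i n) + (inc N (?X i \<omega>) m + (1 * inc N (?X i \<omega>) n + (2 * mu) * fst (?X i \<omega>))) \<noteq> 0"
    unfolding AE_all_countable
  proof (intro allI AE_ball_countable[THEN iffD2] ballI)
    fix i m n assume "m \<in> {1..N}" "n \<in> {1..N}"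
    then show "AE \<omega> in M. m \<noteq> n \<longrightarrow>
      (?y \<omega> i m + (-1) * ?y \<omega> i n) + (inc N (?X i \<omega>) m + ((-1) * inc N (?X i \<omega>) n + 0 * fst (?X i \<omega>))) \<noteq> 0 \<and>
      (?y \<omega> i m + 1 * ?y \<omega> i n) + (inc N (?X i \<omega>) m + (1 * inc N (?X i \<omega>) n + (2 * mu) * fst (?X i \<omega>))) \<noteq> 0"
      using key[of m n i "-1" 0] key[of m n i 1 "2 * mu"] by (cases "m = n") auto
  qed auto
  then show ?thesis
  proof eventually_elim
    case (elim \<omega>)
    show ?case
    proof (intro allI notI)
      fix i assume "ties N (\<lambda>n. ?y \<omega> i n + inc N (?X i \<omega>) n + mu * fst (?X i \<omega>))"
      then obtain m n where mn: "m \<in> {1..N}" "n \<in> {1..N}" "m \<noteq> n"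
        "\<bar>?y \<omega> i m + inc N (?X i \<omega>) m + mu * fst (?X i \<omega>)\<bar> = \<bar>?y \<omega> i n + inc N (?X i \<omega>) n + mu * fst (?X i \<omega>)\<bar>"
        unfolding ties_def by blast
      have a: "(?y \<omega> i m + (-1) * ?y \<omega> i n) + (inc N (?X i \<omega>) m + ((-1) * inc N (?X i \<omega>) n + 0 * fst (?X i \<omega>))) \<noteq> 0"
        "(?y \<omega> i m + 1 * ?y \<omega> i n) + (inc N (?X i \<omega>) m + (1 * inc N (?X i \<omega>) n + (2 * mu) * fst (?X i \<omega>))) \<noteq> 0"
        using elim[rule_format, OF mn(1-3)] by blast+
      from mn(4) show False unfolding abs_eq_iff
      proof
        assume "?y \<omega> i m + inc N (?X i \<omega>) m + mu * fst (?X i \<omega>) = ?y \<omega> i n + inc N (?X i \<omega>) n + mu * fst (?X i \<omega>)"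
        with a(1) show False by linarith
      next
        assume "?y \<omega> i m + inc N (?X i \<omega>) m + mu * fst (?X i \<omega>) = - (?y \<omega> i n + inc N (?X i \<omega>) n + mu * fst (?X i \<omega>))"
        with a(2) show False by (simp add: algebra_simps)
      qed
    qed
  qed
qed

section \<open>From the coupled chain at jump times to the processes\<close>

lemma jump_time_gaps:
  assumes "J 0 \<omega> = 0"
  shows "jump_time (\<lambda>i \<omega>. J (Suc i) \<omega> - J i \<omega>) i \<omega> = J i \<omega>"
  unfolding jump_time_def using sum_lessThan_telescope[of "\<lambda>i. J i \<omega>" i] assms by simp

lemma good_sample_good_times:
  assumes "good_sample N (\<lambda>i \<omega>. J (Suc i) \<omega> - J i \<omega>) (\<lambda>i. K (Suc i)) B \<omega>" "J 0 \<omega> = 0"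
  shows "good_times N J K \<omega>"
  using assms by (simp add: good_sample_def good_times_def jump_time_gaps)

theorem nbbm_speeds:
  assumes N: "N > 0" and bd: "bd_ingredients M N J K B" and speed: "is_NBBM_speed M N v"
    and path: "AE \<omega> in M. bd_path N (\<lambda>x. x) 0 J K B x0 \<omega> (X \<omega>)"
  shows "AE \<omega> in M. ((\<lambda>t. leftmost N (X \<omega>) t / t) \<longlongrightarrow> v) at_top \<and> ((\<lambda>t. rightmost N (X \<omega>) t / t) \<longlongrightarrow> v) at_top \<and> v \<ge> 0"
proof -
  let ?g = "\<lambda>i \<omega>. J (Suc i) \<omega> - J i \<omega>" and ?k = "\<lambda>i. K (Suc i)"
  have J0: "\<And>\<omega>. \<omega> \<in> space M \<Longrightarrow> J 0 \<omega> = 0" and I: "ingredients M N ?g ?k B"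
    using bd unfolding bd_ingredients_iff by blast+
  have L: "AE \<omega> in M. ((\<lambda>t. leftmost N (X \<omega>) t / t) \<longlongrightarrow> v) at_top"
    using speed bd path unfolding is_NBBM_speed_def by blast
  have h: "AE \<omega> in M. \<forall>r\<in>{1..N}. (\<lambda>n. (\<Sum>i<n. of_bool (?k i \<omega> = r)) / real n) \<longlonglongrightarrow> 1 / real N"
    by (rule AE_ball_countable[THEN iffD2]) (use ingredients_lln(2)[OF I N] in auto)
  have B: "AE \<omega> in M. \<forall>n\<in>{1..N}. ((\<lambda>t. B n t \<omega> / t) \<longlongrightarrow> 0) at_top"
    by (rule AE_ball_countable[THEN iffD2]) (use ingredients_lln(3)[OF I N] in auto)
  show ?thesis
    using L path h B ingredients_lln(1)[OF I N] AE_good_sample[OF I N] AE_space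
  proof eventually_elim
    case (elim \<omega>)
    have good: "good_times N J K \<omega>" by (rule good_sample_good_times[OF elim(6) J0[OF elim(7)]])
    have "(\<Sum>i<n. J (Suc i) \<omega> - J i \<omega>) = J n \<omega>" for n
      using jump_time_gaps[of J \<omega>, OF J0[OF elim(7)]] unfolding jump_time_def .
    with elim(5) have Jn: "(\<lambda>n. J n \<omega> / real n) \<longlonglongrightarrow> 1 / real N" by (simp only:)
    have R: "((\<lambda>t. rightmost N (X \<omega>) t / t) \<longlongrightarrow> v) at_top"
      by (rule nbbm_rightmost_speed[OF N elim(2) good Jn _ _ elim(1)]) (use elim(3,4) in blast)+
    moreover have "v \<ge> 0"
      by (rule nbbm_speed_nonneg[OF N elim(2) good _ R]) (use elim(4) in blast)
    ultimately show ?case using elim(1) by blast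
  qed
qed

text \<open>\<open>Y\<close> may break ties by any rule, even a non-measurable one. Without ties the
  minimiser is unique, so \<open>Y\<close> kills exactly the label that \<open>argmin\<close>
  selects and follows the measurable chain.\<close>

lemma bee_path_couple:
  assumes N: "N > 0" and good: "good_sample N (\<lambda>i \<omega>. J (Suc i) \<omega> - J i \<omega>) (\<lambda>i. K (Suc i)) B \<omega>" and J0: "J 0 \<omega> = 0"
    and path: "bd_path N (\<lambda>x. - \<bar>x\<bar>) mu J K B x0 \<omega> Y"
  defines "X \<equiv> \<lambda>l. exc_seq N (\<lambda>i \<omega>. J (Suc i) \<omega> - J i \<omega>) (\<lambda>i. K (Suc i)) B l \<omega>"
  defines "c \<equiv> couple N (\<lambda>x. - \<bar>x\<bar>) mu x0 X"
  assumes ties: "\<And>i. \<not> ties N (\<lambda>n. cy (c i) n + inc N (X i) n + mu * fst (X i))"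
    and n: "n \<in> {1..N}"
  shows "Y (J i \<omega>) n = cy (c i) n"
  using n
proof (induction i arbitrary: n)
  case 0
  then show ?case using bd_pathD(1)[OF path 0] by (simp add: J0 c_def cy_def)
next
  case (Suc i)
  let ?p = "\<lambda>n. cy (c i) n + inc N (X i) n + mu * fst (X i)"
  let ?q = "\<lambda>n. Y (J i \<omega>) n + (B n (J (Suc i) \<omega>) \<omega> - B n (J i \<omega>) \<omega>) + mu * (J (Suc i) \<omega> - J i \<omega>)"
  have X: "fst (X i) = J (Suc i) \<omega> - J i \<omega>" "fst (snd (X i)) = K (Suc i) \<omega>"
    unfolding X_def good_sample_exc_seq[OF good] by simp_all
  have Kin: "K (Suc i) \<omega> \<in> {1..N}" using good by (simp add: good_sample_def)
  have q: "?q n = ?p n" if "n \<in> {1..N}" for n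
  proof -
    have "inc N (X i) n = B n (J (Suc i) \<omega>) \<omega> - B n (J i \<omega>) \<omega>"
      using inc_exc_seq[OF good that, of i] unfolding X_def jump_time_gaps[of J \<omega>, OF J0] .
    then show ?thesis using Suc.IH[OF that] unfolding X by simp
  qed
  obtain m where m: "m \<in> {1..N}" "\<And>n. n \<in> {1..N} \<Longrightarrow> - \<bar>?q m\<bar> \<le> - \<bar>?q n\<bar>"
    "\<And>n. n \<in> {1..N} \<Longrightarrow> Y (J (Suc i) \<omega>) n = (if n = m then ?q (K (Suc i) \<omega>) else ?q n)"
    by (rule bd_path_jump[OF path, of i]) blast
  let ?m = "argmin N (\<lambda>n. - \<bar>?p n\<bar>)"
  have m1: "?m \<in> {1..N}" by (rule argmin(1)[OF N])
  have "- \<bar>?p ?m\<bar> \<le> - \<bar>?p m\<bar>" by (rule argmin(2)[OF N m(1)])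
  moreover have "- \<bar>?p m\<bar> \<le> - \<bar>?p ?m\<bar>" using m(2)[OF m1] unfolding q[OF m(1)] q[OF m1] .
  ultimately have "\<bar>?p m\<bar> = \<bar>?p ?m\<bar>" by linarith
  then have mm: "m = ?m" using ties[of i] m(1) m1 unfolding ties_def by blast
  have "cy (c (Suc i)) n = (if n = ?m then ?p (fst (snd (X i))) else ?p n)"
    unfolding c_def couple.simps couple_step_simps(1) ..
  also have "\<dots> = Y (J (Suc i) \<omega>) n"
    unfolding m(3)[OF Suc.prems] mm[symmetric] X(2) q[OF Kin] q[OF Suc.prems] ..
  finally show ?case ..
qed

text \<open>The known speed concerns N-BBMs without drift, hence the term
  \<open>mu * jump_time g i \<omega>\<close> subtracted in \<open>v\<close>; a common translation
  does not affect who is leftmost. The second conclusion recovers the drifted system in the labels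
  of the Bee system, where both are driven by the same increments.\<close>

lemma coupled_nbbm_path:
  fixes s :: "real \<Rightarrow> real" and mu :: real and x0 :: "nat \<Rightarrow> real"
    and g' :: "nat \<Rightarrow> 'a \<Rightarrow> real" and B' :: "nat \<Rightarrow> real \<Rightarrow> 'a \<Rightarrow> real"
  assumes N: "N > 0" and good: "good_sample N g k B \<omega>"
  defines "X \<equiv> \<lambda>l. exc_seq N g k B l \<omega>"
  defines "c \<equiv> couple N s mu x0 X"
  assumes \<sigma>: "\<And>i. cs (c i) permutes {1..N}"
    and g': "\<And>i. g' i \<omega> = g i \<omega>" and k': "\<And>i. k' i \<omega> = inv (cs (c i)) (k i \<omega>)"
    and B': "\<And>i n t. n \<in> {1..N} \<Longrightarrow> jump_time g i \<omega> \<le> t \<Longrightarrow> t \<le> jump_time g (Suc i) \<omega> \<Longrightarrow>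
      B' n t \<omega> - B' n (jump_time g i \<omega>) \<omega> = B (cs (c i) n) t \<omega> - B (cs (c i) n) (jump_time g i \<omega>) \<omega>"
  defines "v \<equiv> \<lambda>i j. cz (c i) (cs (c i) j) - mu * jump_time g i \<omega>"
  defines "X' \<equiv> interp (jump_time g') B' 0 v \<omega>"
  shows "bd_path N (\<lambda>x. x) 0 (jump_time g') (\<lambda>i. k' (i - 1)) B' x0 \<omega> X'"
    and "jump_time g i \<omega> \<le> t \<Longrightarrow> t < jump_time g (Suc i) \<omega> \<Longrightarrow> j \<in> {1..N} \<Longrightarrow>
      X' t j + mu * t = cz (c i) (cs (c i) j) + (B (cs (c i) j) t \<omega> - B (cs (c i) j) (jump_time g i \<omega>) \<omega>) + mu * (t - jump_time g i \<omega>)"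
proof -
  have J': "jump_time g' i \<omega> = jump_time g i \<omega>" for i by (simp add: jump_time_def g')
  have lt: "jump_time g i \<omega> < jump_time g (Suc i) \<omega>" for i using good by (simp add: jump_time_def good_sample_def)
  have good': "good_times N (jump_time g') (\<lambda>i. k' (i - 1)) \<omega>"
    unfolding good_times_def J'
  proof (intro conjI allI lt)
    show "jump_time g 0 \<omega> = 0" by (simp add: jump_time_def)
    show "filterlim (\<lambda>i. jump_time g i \<omega>) at_top sequentially" using good by (simp add: good_sample_def)
    fix i
    have "k i \<omega> \<in> {1..N}" using good by (simp add: good_sample_def)
    then show "k' (Suc i - 1) \<omega> \<in> {1..N}"
      unfolding diff_Suc_1 k' using permutes_in_image[OF permutes_inv[OF \<sigma>]] by blast
  qed
  have Bd: "B' n (jump_time g (Suc i) \<omega>) \<omega> - B' n (jump_time g i \<omega>) \<omega> = inc N (X i) (cs (c i) n)" if "n \<in> {1..N}" for i n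
  proof -
    have "cs (c i) n \<in> {1..N}" using that permutes_in_image[OF \<sigma>] by blast
    from inc_exc_seq[OF good this] show ?thesis
      using B'[OF that less_imp_le[OF lt] order_refl] unfolding X_def by simp
  qed
  have Xf: "fst (X i) = g i \<omega>" "fst (snd (X i)) = k i \<omega>" for i unfolding X_def good_sample_exc_seq[OF good] by simp_all
  show "bd_path N (\<lambda>x. x) 0 (jump_time g') (\<lambda>i. k' (i - 1)) B' x0 \<omega> X'"
    unfolding X'_def
  proof (rule bd_path_interp[OF good'])
    show "v 0 n = x0 n" for n by (simp add: v_def c_def cz_def cs_def jump_time_def)
    fix i
    let ?w = "\<lambda>n. cz (c i) n + inc N (X i) n + mu * fst (X i)"
    let ?p = "\<lambda>n. v i n + (B' n (jump_time g' (Suc i) \<omega>) \<omega> - B' n (jump_time g' i \<omega>) \<omega>) + 0 * (jump_time g' (Suc i) \<omega> - jump_time g' i \<omega>)"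
    let ?m' = "argmin N ?w" and ?m = "argmin N (\<lambda>n. s (cy (c i) n + inc N (X i) n + mu * fst (X i)))"
    let ?\<sigma> = "cs (c i)"
    have p: "?p n = ?w (?\<sigma> n) - mu * jump_time g (Suc i) \<omega>" if "n \<in> {1..N}" for n
      using Bd[OF that, of i] unfolding J' v_def Xf by (simp add: jump_time_def algebra_simps)
    have inv: "inv ?\<sigma> n \<in> {1..N} \<and> ?\<sigma> (inv ?\<sigma> n) = n" if "n \<in> {1..N}" for n
      using that permutes_in_image[OF permutes_inv[OF \<sigma>]] permutes_inverses[OF \<sigma>] by blast
    have m': "?m' \<in> {1..N}" by (rule argmin(1)[OF N])
    \<comment> \<open>The own label of the particle that the second system kills; \<open>?m'\<close>
      is its name in the labels of the first system.\<close>
    let ?a = "inv ?\<sigma> ?m'"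
    have a: "?a \<in> {1..N}" "?\<sigma> ?a = ?m'" using inv[OF m'] by auto
    have kin: "k i \<omega> \<in> {1..N}" using good by (simp add: good_sample_def)
    show "\<exists>m\<in>{1..N}. (\<forall>n\<in>{1..N}. ?p m \<le> ?p n) \<and> (\<forall>n\<in>{1..N}. v (Suc i) n = (if n = m then ?p (k' (Suc i - 1) \<omega>) else ?p n))"
    proof (intro bexI[of _ ?a] conjI ballI a(1))
      fix n assume n: "n \<in> {1..N}"
      then have sn: "?\<sigma> n \<in> {1..N}" using permutes_in_image[OF \<sigma>] by blast
      show "?p ?a \<le> ?p n" unfolding p[OF a(1)] p[OF n] a(2) using argmin(2)[OF N sn, of ?w] by linarith
      have "cs (c (Suc i)) n = Transposition.transpose ?m ?m' (?\<sigma> n)"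
        unfolding c_def couple.simps couple_step_simps(4) by simp
      then have V: "v (Suc i) n = (if ?\<sigma> n = ?m' then ?w (k i \<omega>) else ?w (?\<sigma> n)) - mu * jump_time g (Suc i) \<omega>"
        unfolding v_def using couple_step_simps(3)[of N s mu "X i" "c i" "?\<sigma> n"] by (simp add: c_def Xf)
      have "?\<sigma> n = ?\<sigma> ?a \<longleftrightarrow> n = ?a" by (rule inj_eq[OF permutes_inj[OF \<sigma>]])
      then have E: "?\<sigma> n = ?m' \<longleftrightarrow> n = ?a" unfolding a(2) .
      have PK: "?p (k' (Suc i - 1) \<omega>) = ?w (k i \<omega>) - mu * jump_time g (Suc i) \<omega>"
        using p[OF inv[OF kin, THEN conjunct1]] unfolding diff_Suc_1 k' inv[OF kin, THEN conjunct2] .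
      show "v (Suc i) n = (if n = ?a then ?p (k' (Suc i - 1) \<omega>) else ?p n)"
      proof (cases "n = ?a")
        case True
        then have "?\<sigma> n = ?m'" using E by blast
        then show ?thesis unfolding V PK if_P[OF True] by (simp only: if_True simp_thms)
      next
        case False
        then have "?\<sigma> n \<noteq> ?m'" using E by blast
        then show ?thesis unfolding V p[OF n] if_not_P[OF False] by (simp only: if_False simp_thms)
      qed
    qed
  qed
  assume t: "jump_time g i \<omega> \<le> t" "t < jump_time g (Suc i) \<omega>" and j: "j \<in> {1..N}"
  have "X' t j = v i j + (B' j t \<omega> - B' j (jump_time g i \<omega>) \<omega>)"
    using interp_eq[OF good', of i t B' 0 v j] t unfolding X'_def J' by simp
  also have "B' j t \<omega> - B' j (jump_time g i \<omega>) \<omega> = B (cs (c i) j) t \<omega> - B (cs (c i) j) (jump_time g i \<omega>) \<omega>"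
    using t by (intro B'[OF j]) auto
  finally show "X' t j + mu * t = cz (c i) (cs (c i) j) + (B (cs (c i) j) t \<omega> - B (cs (c i) j) (jump_time g i \<omega>) \<omega>) + mu * (t - jump_time g i \<omega>)"
    by (simp add: v_def algebra_simps)
qed

lemma tendsto_speed_of_bounded_gap:
  fixes f h :: "real \<Rightarrow> real"
  assumes f: "((\<lambda>t. f t / t) \<longlongrightarrow> v) at_top"
    and b: "\<And>t. t \<ge> T \<Longrightarrow> f t + mu * t - C \<le> h t" "\<And>t. t \<ge> T \<Longrightarrow> h t \<le> f t + mu * t"
  shows "((\<lambda>t. h t / t) \<longlongrightarrow> v + mu) at_top"
proof (rule tendsto_sandwich)
  have "((\<lambda>t. f t / t + mu - C / t) \<longlongrightarrow> v + mu - 0) at_top"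
    by (intro tendsto_intros f tendsto_divide_0[OF tendsto_const] filterlim_at_top_imp_at_infinity filterlim_ident)
  then show "((\<lambda>t. f t / t + mu - C / t) \<longlongrightarrow> v + mu) at_top" by simp
  show "((\<lambda>t. f t / t + mu) \<longlongrightarrow> v + mu) at_top" by (intro tendsto_intros f)
  show "\<forall>\<^sub>F t in at_top. f t / t + mu - C / t \<le> h t / t"
    using eventually_ge_at_top[of "max 1 T"]
  proof eventually_elim
    fix t assume t: "max 1 T \<le> t"
    then have "(f t + mu * t - C) / t \<le> h t / t" using b(1)[of t] by (intro divide_right_mono) auto
    then show "f t / t + mu - C / t \<le> h t / t" using t by (simp add: add_divide_distrib diff_divide_distrib)
  qed
  show "\<forall>\<^sub>F t in at_top. h t / t \<le> f t / t + mu"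
    using eventually_ge_at_top[of "max 1 T"]
  proof eventually_elim
    fix t assume t: "max 1 T \<le> t"
    then have "h t / t \<le> (f t + mu * t) / t" using b(2)[of t] by (intro divide_right_mono) auto
    then show "h t / t \<le> f t / t + mu" using t by (simp add: add_divide_distrib)
  qed
qed

text \<open>The decision whom to kill rests on the positions just before a jump. These are left
  limits and not values of the path, so strict negativity during the gap reaches them only as a weak
  inequality, which is enough for comparing absolute values.\<close>

lemma continuous_nonpos_endpoint:
  fixes f :: "real \<Rightarrow> real"
  assumes "a < b" "continuous_on {a..b} f" "\<And>t. a \<le> t \<Longrightarrow> t < b \<Longrightarrow> f t < 0"
  shows "f b \<le> 0"
proof (rule tendsto_upperbound)
  show "(f \<longlongrightarrow> f b) (at_left b)" by (rule continuous_on_Icc_at_leftD[OF assms(2,1)])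
  show "\<forall>\<^sub>F t in at_left b. f t \<le> 0"
    using eventually_at_left_real[OF assms(1)] by eventually_elim (use assms(3) in \<open>force intro: less_imp_le\<close>)
qed simp

text \<open>This is the deterministic part, for one sample point: all probabilistic input enters as
  hypotheses. Domination holds from the start and makes the Bee system negative after some time;
  from then on \<open>couple_step_gap\<close> bounds the distances, so each extreme differs from
  that of the drifted N-BBM by at most a constant.\<close>

lemma bee_couple_limits:
  fixes X :: "nat \<Rightarrow> real \<times> nat \<times> (nat \<Rightarrow> real \<Rightarrow> real)"
  assumes N: "N > 0" and good: "good_times N J K \<omega>"
    and cont: "\<And>n. n \<in> {1..N} \<Longrightarrow> continuous_on {0..} (\<lambda>t. B n t \<omega>)"
    and path: "bd_path N (\<lambda>x. - \<bar>x\<bar>) mu J K B x0 \<omega> Y"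
  defines "c \<equiv> couple N (\<lambda>x. - \<bar>x\<bar>) mu x0 X"
  assumes X: "\<And>i. fst (X i) = J (Suc i) \<omega> - J i \<omega>" "\<And>i. fst (snd (X i)) = K (Suc i) \<omega>"
      "\<And>i n. n \<in> {1..N} \<Longrightarrow> inc N (X i) n = B n (J (Suc i) \<omega>) \<omega> - B n (J i \<omega>) \<omega>"
    and \<sigma>: "\<And>i. cs (c i) permutes {1..N}"
    and Y: "\<And>i n. n \<in> {1..N} \<Longrightarrow> Y (J i \<omega>) n = cy (c i) n"
    and X': "\<And>i t j. J i \<omega> \<le> t \<Longrightarrow> t < J (Suc i) \<omega> \<Longrightarrow> j \<in> {1..N} \<Longrightarrow>
      X' t j + mu * t = cz (c i) (cs (c i) j) + (B (cs (c i) j) t \<omega> - B (cs (c i) j) (J i \<omega>) \<omega>) + mu * (t - J i \<omega>)"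
    and L: "((\<lambda>t. leftmost N X' t / t) \<longlongrightarrow> v) at_top" and R: "((\<lambda>t. rightmost N X' t / t) \<longlongrightarrow> v) at_top"
    and v: "v + mu < 0"
  shows "((\<lambda>t. leftmost N Y t / t) \<longlongrightarrow> v + mu) at_top \<and> ((\<lambda>t. rightmost N Y t / t) \<longlongrightarrow> v + mu) at_top"
proof -
  have Jlt: "J i \<omega> < J (Suc i) \<omega>" for i using good by (simp add: good_times_def)
  have J0: "J i \<omega> \<ge> 0" for i
    using good_times_less[OF good, of 0 i] good by (cases i) (auto simp: good_times_def)
  have Kin: "K (Suc i) \<omega> \<in> {1..N}" for i using good by (simp add: good_times_def)
  have le: "cy (c i) n \<le> cz (c i) n" if "n \<in> {1..N}" for i n
    using that
  proof (induction i arbitrary: n)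
    case 0
    then show ?case by (simp add: c_def cy_def cz_def)
  next
    case (Suc i)
    show ?case unfolding c_def couple.simps
    proof (rule couple_step_le[OF N _ _ Suc.prems])
      show "fst (snd (X i)) \<in> {1..N}" unfolding X(2) by (rule Kin)
      show "cy (couple N (\<lambda>x. - \<bar>x\<bar>) mu x0 X i) n \<le> cz (couple N (\<lambda>x. - \<bar>x\<bar>) mu x0 X i) n" if "n \<in> {1..N}" for n
        using Suc.IH[OF that] unfolding c_def .
    qed
  qed
  have \<sigma>in: "cs (c i) j \<in> {1..N}" if "j \<in> {1..N}" for i j using that permutes_in_image[OF \<sigma>] by blast
  have \<sigma>inv: "\<exists>j\<in>{1..N}. cs (c i) j = n" if "n \<in> {1..N}" for i n
    using that permutes_in_image[OF permutes_inv[OF \<sigma>]] permutes_inverses(1)[OF \<sigma>] by blast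
  \<comment> \<open>Partners have the same Brownian increments and the same drift, so their distance
    is constant during a gap.\<close>
  have diff: "X' t j + mu * t - Y t (cs (c i) j) = cz (c i) (cs (c i) j) - cy (c i) (cs (c i) j)"
    if t: "J i \<omega> \<le> t" "t < J (Suc i) \<omega>" and j: "j \<in> {1..N}" for i t j
    using X'[OF t j] bd_pathD(2)[OF path t \<sigma>in[OF j]] Y[OF \<sigma>in[OF j, of i], of i] by simp
  have up: "Y t (cs (c i) j) \<le> X' t j + mu * t" if "J i \<omega> \<le> t" "t < J (Suc i) \<omega>" "j \<in> {1..N}" for i t j
    using diff[OF that] le[OF \<sigma>in[OF that(3)], of i i] by linarith
  have Rup: "rightmost N Y t \<le> rightmost N X' t + mu * t" if t0: "t \<ge> 0" for t
  proof -
    obtain i where i: "J i \<omega> \<le> t" "t < J (Suc i) \<omega>" using good_times_interval[OF good t0] by blast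
    obtain n where n: "n \<in> {1..N}" "rightmost N Y t = Y t n" using rightmost_attained[OF N] by blast
    obtain j where j: "j \<in> {1..N}" "cs (c i) j = n" using \<sigma>inv[OF n(1)] by blast
    show ?thesis using up[OF i j(1)] le_rightmost[OF j(1), of X' t] unfolding n(2) j(2) by linarith
  qed
  have "((\<lambda>t. rightmost N X' t / t + mu) \<longlongrightarrow> v + mu) at_top" by (intro tendsto_intros R)
  from order_tendstoD(2)[OF this v]
  obtain T where T: "\<And>t. t \<ge> T \<Longrightarrow> rightmost N X' t / t + mu < 0" unfolding eventually_at_top_linorder by blast
  have neg: "Y t n < 0" if t: "t \<ge> max T 1" and n: "n \<in> {1..N}" for t n
  proof -
    have "(rightmost N X' t / t + mu) * t < 0" using T[of t] t by (intro mult_neg_pos) auto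
    then have "rightmost N X' t + mu * t < 0" using t by (simp add: distrib_right)
    then show ?thesis using Rup[of t] le_rightmost[OF n, of Y t] t by linarith
  qed
  obtain i0 where i0: "J i0 \<omega> \<ge> max T 1"
  proof -
    have "filterlim (\<lambda>i. J i \<omega>) at_top sequentially" using good by (simp add: good_times_def)
    then have "\<forall>\<^sub>F i in sequentially. max T 1 \<le> J i \<omega>" unfolding filterlim_at_top by blast
    then show thesis using that unfolding eventually_sequentially by blast
  qed
  have Ji0: "J i0 \<omega> \<le> J i \<omega>" if "i0 \<le> i" for i
    using that good_times_less[OF good, of i0 i] by (cases "i0 = i") auto
  let ?p = "\<lambda>i n. cy (c i) n + inc N (X i) n + mu * fst (X i)"
  have pneg: "?p i n \<le> 0" if i: "i0 \<le> i" and n: "n \<in> {1..N}" for i n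
  proof -
    let ?f = "\<lambda>t. cy (c i) n + (B n t \<omega> - B n (J i \<omega>) \<omega>) + mu * (t - J i \<omega>)"
    have "?f (J (Suc i) \<omega>) \<le> 0"
    proof (rule continuous_nonpos_endpoint[OF Jlt[of i]])
      have "continuous_on {J i \<omega>..J (Suc i) \<omega>} (\<lambda>t. B n t \<omega>)"
        by (rule continuous_on_subset[OF cont[OF n]]) (use J0[of i] in auto)
      then show "continuous_on {J i \<omega>..J (Suc i) \<omega>} ?f" by (intro continuous_intros)
      fix t assume t: "J i \<omega> \<le> t" "t < J (Suc i) \<omega>"
      have "Y t n < 0" using Ji0[OF i] i0 t by (intro neg n) linarith
      then show "?f t < 0" using bd_pathD(2)[OF path t n] Y[OF n, of i] by simp
    qed
    then show ?thesis unfolding X(1) X(3)[OF n] .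
  qed
  \<comment> \<open>By domination every term is nonnegative, so the sum bounds each single distance
    at the jump \<open>i0\<close>.\<close>
  define C where "C = (\<Sum>n\<in>{1..N}. cz (c i0) n - cy (c i0) n)"
  have gap: "cz (c i) n \<le> cy (c i) n + C" if "i0 \<le> i" "n \<in> {1..N}" for i n
    using that
  proof (induction i arbitrary: n rule: dec_induct)
    case base
    have "cz (c i0) n - cy (c i0) n \<le> C" unfolding C_def
      using base le by (intro member_le_sum) auto
    then show ?case by simp
  next
    case (step i)
    show ?case unfolding c_def couple.simps
    proof (rule couple_step_gap[OF N _ _ step.prems])
      show "fst (snd (X i)) \<in> {1..N}" unfolding X(2) by (rule Kin)
      show "cz (couple N (\<lambda>x. - \<bar>x\<bar>) mu x0 X i) n \<le> cy (couple N (\<lambda>x. - \<bar>x\<bar>) mu x0 X i) n + C" if "n \<in> {1..N}" for n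
        using step.IH[OF that] unfolding c_def .
      fix j assume j: "j \<in> {1..N}"
      let ?m = "argmin N (\<lambda>n. - \<bar>?p i n\<bar>)"
      have "- \<bar>?p i ?m\<bar> \<le> - \<bar>?p i j\<bar>" by (rule argmin(2)[OF N j])
      moreover have "?p i ?m \<le> 0" using step.hyps by (intro pneg argmin(1)[OF N]) auto
      moreover have "?p i j \<le> 0" using step.hyps by (intro pneg j) auto
      ultimately have "cy (c i) ?m + inc N (X i) ?m \<le> cy (c i) j + inc N (X i) j" by linarith
      then show "cy (couple N (\<lambda>x. - \<bar>x\<bar>) mu x0 X i) (argmin N (\<lambda>n. - \<bar>cy (couple N (\<lambda>x. - \<bar>x\<bar>) mu x0 X i) n + inc N (X i) n + mu * fst (X i)\<bar>)) +
          inc N (X i) (argmin N (\<lambda>n. - \<bar>cy (couple N (\<lambda>x. - \<bar>x\<bar>) mu x0 X i) n + inc N (X i) n + mu * fst (X i)\<bar>))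
          \<le> cy (couple N (\<lambda>x. - \<bar>x\<bar>) mu x0 X i) j + inc N (X i) j"
        unfolding c_def .
    qed
  qed
  have low: "X' t j + mu * t - C \<le> Y t (cs (c i) j)" if "t \<ge> J i0 \<omega>" "J i \<omega> \<le> t" "t < J (Suc i) \<omega>" "j \<in> {1..N}" for i t j
  proof -
    have "i0 \<le> i" by (rule good_times_interval_late[OF good that(1,3)])
    from gap[OF this \<sigma>in[OF that(4), of i]] diff[OF that(2-4)] show ?thesis by linarith
  qed
  have i0nn: "J i0 \<omega> \<ge> 0" by (rule J0)
  have "leftmost N X' t + mu * t - C \<le> leftmost N Y t" "leftmost N Y t \<le> leftmost N X' t + mu * t"
    "rightmost N X' t + mu * t - C \<le> rightmost N Y t" "rightmost N Y t \<le> rightmost N X' t + mu * t"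
    if t: "t \<ge> J i0 \<omega>" for t
  proof -
    have t0: "t \<ge> 0" using t i0nn by linarith
    obtain i where i: "J i \<omega> \<le> t" "t < J (Suc i) \<omega>" using good_times_interval[OF good t0] by blast
    show "rightmost N Y t \<le> rightmost N X' t + mu * t" by (rule Rup[OF t0])
    obtain n where n: "n \<in> {1..N}" "leftmost N Y t = Y t n" using leftmost_attained[OF N] by blast
    obtain j where j: "j \<in> {1..N}" "cs (c i) j = n" using \<sigma>inv[OF n(1)] by blast
    show "leftmost N X' t + mu * t - C \<le> leftmost N Y t"
      using low[OF t i j(1)] leftmost_le[OF j(1), of X' t] unfolding n(2) j(2) by linarith
    obtain j' where j': "j' \<in> {1..N}" "leftmost N X' t = X' t j'" using leftmost_attained[OF N] by blast
    show "leftmost N Y t \<le> leftmost N X' t + mu * t"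
      using up[OF i j'(1)] leftmost_le[OF \<sigma>in[OF j'(1), of i], of Y t] unfolding j'(2) by linarith
    obtain j'' where j'': "j'' \<in> {1..N}" "rightmost N X' t = X' t j''" using rightmost_attained[OF N] by blast
    show "rightmost N X' t + mu * t - C \<le> rightmost N Y t"
      using low[OF t i j''(1)] le_rightmost[OF \<sigma>in[OF j''(1), of i], of Y t] unfolding j''(2) by linarith
  qed
  then show ?thesis
    using tendsto_speed_of_bounded_gap[OF L, of "J i0 \<omega>" mu C "leftmost N Y"]
      tendsto_speed_of_bounded_gap[OF R, of "J i0 \<omega>" mu C "rightmost N Y"] by blast
qed

text \<open>Both extremes are included because reflection exchanges them. \<open>v \<ge> 0\<close>
  is a conclusion here since \<open>is_NBBM_speed\<close> yields information only once some N-BBM on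
  \<open>M\<close> is available, and the coupled system provides one.\<close>

theorem bee_speed_leftward_drift:
  assumes N: "N > 0" and bd: "bd_ingredients M N J K B" and speed: "is_NBBM_speed M N v"
    and v: "v + mu < 0"
    and path: "AE \<omega> in M. bd_path N (\<lambda>x. - \<bar>x\<bar>) mu J K B x0 \<omega> (Y \<omega>)"
  shows "v \<ge> 0"
    and "AE \<omega> in M. ((\<lambda>t. leftmost N (Y \<omega>) t / t) \<longlongrightarrow> v + mu) at_top \<and> ((\<lambda>t. rightmost N (Y \<omega>) t / t) \<longlongrightarrow> v + mu) at_top"
proof -
  define g where "g i \<omega> = J (Suc i) \<omega> - J i \<omega>" for i \<omega>
  define k where "k i = K (Suc i)" for i
  have gk: "g = (\<lambda>i \<omega>. J (Suc i) \<omega> - J i \<omega>)" "k = (\<lambda>i. K (Suc i))" by (auto simp: g_def k_def fun_eq_iff)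
  have J0: "\<And>\<omega>. \<omega> \<in> space M \<Longrightarrow> J 0 \<omega> = 0" and I: "ingredients M N g k B"
    using bd unfolding bd_ingredients_iff gk by blast+
  interpret prob_space M by (rule ingredientsD(1)[OF I])
  let ?s = "\<lambda>x::real. - \<bar>x\<bar>"
  have s: "?s \<in> borel_measurable borel" by measurable
  let ?X = "\<lambda>\<omega> l. exc_seq N g k B l \<omega>"
  let ?c = "\<lambda>\<omega>. couple N ?s mu x0 (?X \<omega>)"
  let ?Q = "exc_law M N g k B"
  have iid: "iid_seq M ?Q (exc_seq N g k B)" by (rule exc_seq_iid[OF I])
  have \<sigma>: "(\<lambda>\<omega>. cs (?c \<omega> l)) \<in> measurable (past M ?Q (exc_seq N g k B) l) (count_space {\<tau>. \<tau> permutes {1..N}})" for l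
    by (rule couple_measurable(3)[OF N s iid_seq_measurable[OF iid] sets_exc_law])
  have \<sigma>p: "cs (?c \<omega> l) permutes {1..N}" if "\<omega> \<in> space M" for l \<omega>
    using measurable_space[OF \<sigma>[of l]] that by simp
  obtain g' k' B' where I': "ingredients M N g' k' B'"
    and rel: "AE \<omega> in M. (\<forall>i. g' i \<omega> = g i \<omega> \<and> k' i \<omega> = inv (cs (?c \<omega> i)) (k i \<omega>)) \<and>
       (\<forall>i. \<forall>n\<in>{1..N}. \<forall>t. jump_time g i \<omega> \<le> t \<longrightarrow> t \<le> jump_time g (Suc i) \<omega> \<longrightarrow>
          B' n t \<omega> - B' n (jump_time g i \<omega>) \<omega> = B (cs (?c \<omega> i) n) t \<omega> - B (cs (?c \<omega> i) n) (jump_time g i \<omega>) \<omega>)"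
    by (rule relabelled_ingredients[OF I N \<sigma>])
  \<comment> \<open>\<open>bd_ingredients\<close> and \<open>bd_path\<close> number the marks from
    1, \<open>ingredients\<close> from 0.\<close>
  let ?K' = "\<lambda>i. k' (i - 1)"
  have bd': "bd_ingredients M N (jump_time g') ?K' B'"
    unfolding bd_ingredients_iff
  proof
    show "\<forall>\<omega>\<in>space M. jump_time g' 0 \<omega> = 0" by (simp add: jump_time_def)
    show "ingredients M N (\<lambda>i \<omega>. jump_time g' (Suc i) \<omega> - jump_time g' i \<omega>) (\<lambda>i. k' (Suc i - 1)) B'"
      using I' by (simp add: jump_time_def)
  qed
  let ?v = "\<lambda>\<omega> i j. cz (?c \<omega> i) (cs (?c \<omega> i) j) - mu * jump_time g i \<omega>"
  let ?X' = "\<lambda>\<omega>. interp (jump_time g') B' 0 (?v \<omega>) \<omega>"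
  note coupled = coupled_nbbm_path[OF N, where s="?s" and mu=mu and g'=g' and k'=k' and B'=B']
  have facts: "AE \<omega> in M. good_sample N g k B \<omega> \<and> \<omega> \<in> space M \<and>
      bd_path N (\<lambda>x. x) 0 (jump_time g') ?K' B' x0 \<omega> (?X' \<omega>) \<and>
      (\<forall>i t j. jump_time g i \<omega> \<le> t \<longrightarrow> t < jump_time g (Suc i) \<omega> \<longrightarrow> j \<in> {1..N} \<longrightarrow>
        ?X' \<omega> t j + mu * t = cz (?c \<omega> i) (cs (?c \<omega> i) j) + (B (cs (?c \<omega> i) j) t \<omega> - B (cs (?c \<omega> i) j) (jump_time g i \<omega>) \<omega>) + mu * (t - jump_time g i \<omega>))"
    using AE_good_sample[OF I N] rel AE_space
  proof eventually_elim
    case (elim \<omega>)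
    have 1: "\<And>i. g' i \<omega> = g i \<omega>" "\<And>i. k' i \<omega> = inv (cs (?c \<omega> i)) (k i \<omega>)"
      and 2: "\<And>i n t. n \<in> {1..N} \<Longrightarrow> jump_time g i \<omega> \<le> t \<Longrightarrow> t \<le> jump_time g (Suc i) \<omega> \<Longrightarrow>
        B' n t \<omega> - B' n (jump_time g i \<omega>) \<omega> = B (cs (?c \<omega> i) n) t \<omega> - B (cs (?c \<omega> i) n) (jump_time g i \<omega>) \<omega>"
      using elim(2) by blast+
    have 3: "bd_path N (\<lambda>x. x) 0 (jump_time g') ?K' B' x0 \<omega> (?X' \<omega>)"
      by (rule coupled(1)[where B=B and g=g and k=k, OF elim(1) \<sigma>p[OF elim(3)] 1 2])
    have 4: "?X' \<omega> t j + mu * t = cz (?c \<omega> i) (cs (?c \<omega> i) j) + (B (cs (?c \<omega> i) j) t \<omega> - B (cs (?c \<omega> i) j) (jump_time g i \<omega>) \<omega>) + mu * (t - jump_time g i \<omega>)"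
      if "jump_time g i \<omega> \<le> t" "t < jump_time g (Suc i) \<omega>" "j \<in> {1..N}" for i t j
      by (rule coupled(2)[where B=B and g=g and k=k, OF elim(1) \<sigma>p[OF elim(3)] 1 2 that])
    show ?case using elim(1,3) 3 4 by blast
  qed
  then have "AE \<omega> in M. bd_path N (\<lambda>x. x) 0 (jump_time g') ?K' B' x0 \<omega> (?X' \<omega>)" by (auto elim: eventually_mono)
  note speeds = nbbm_speeds[OF N bd' speed this]
  have "AE \<omega> in M. v \<ge> 0" using speeds by eventually_elim blast
  then show "v \<ge> 0" by simp
  show "AE \<omega> in M. ((\<lambda>t. leftmost N (Y \<omega>) t / t) \<longlongrightarrow> v + mu) at_top \<and> ((\<lambda>t. rightmost N (Y \<omega>) t / t) \<longlongrightarrow> v + mu) at_top"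
    using facts speeds path couple_no_ties[OF I N s, of mu x0]
  proof eventually_elim
    case (elim \<omega>)
    have good: "good_sample N g k B \<omega>" and sp: "\<omega> \<in> space M" using elim(1) by blast+
    have J: "jump_time g i \<omega> = J i \<omega>" for i unfolding gk by (rule jump_time_gaps[of J \<omega>, OF J0[OF sp]])
    show ?case
    proof (rule bee_couple_limits[where X="?X \<omega>" and X'="?X' \<omega>", OF N _ _ elim(3)])
      show "good_times N J K \<omega>"
        by (rule good_sample_good_times[OF good[unfolded gk] J0[OF sp]])
      show "continuous_on {0..} (\<lambda>t. B n t \<omega>)" if "n \<in> {1..N}" for n using good that unfolding good_sample_def by blast
      show "fst (?X \<omega> i) = J (Suc i) \<omega> - J i \<omega>" "fst (snd (?X \<omega> i)) = K (Suc i) \<omega>" for i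
        unfolding good_sample_exc_seq[OF good] by (simp_all add: g_def k_def)
      show "inc N (?X \<omega> i) n = B n (J (Suc i) \<omega>) \<omega> - B n (J i \<omega>) \<omega>" if "n \<in> {1..N}" for i n
        using inc_exc_seq[OF good that] unfolding J .
      show "cs (?c \<omega> i) permutes {1..N}" for i by (rule \<sigma>p[OF sp])
      show "Y \<omega> (J i \<omega>) n = cy (?c \<omega> i) n" if "n \<in> {1..N}" for i n
        unfolding gk by (rule bee_path_couple[OF N good[unfolded gk] J0[OF sp] elim(3) elim(4)[unfolded gk, rule_format] that])
      show "?X' \<omega> t j + mu * t = cz (?c \<omega> i) (cs (?c \<omega> i) j) + (B (cs (?c \<omega> i) j) t \<omega> - B (cs (?c \<omega> i) j) (J i \<omega>) \<omega>) + mu * (t - J i \<omega>)"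
        if "J i \<omega> \<le> t" "t < J (Suc i) \<omega>" "j \<in> {1..N}" for i t j
        using elim(1) that unfolding J by blast
      show "((\<lambda>t. leftmost N (?X' \<omega>) t / t) \<longlongrightarrow> v) at_top" "((\<lambda>t. rightmost N (?X' \<omega>) t / t) \<longlongrightarrow> v) at_top"
        using elim(2) by blast+
      show "v + mu < 0" by (rule v)
    qed
  qed
qed

section \<open>Reflection at the origin and the theorem\<close>

lemma bd_path_reflect:
  assumes "bd_path N (\<lambda>x. - \<bar>x\<bar>) mu J K B x0 \<omega> Y"
  shows "bd_path N (\<lambda>x. - \<bar>x\<bar>) (- mu) J K (\<lambda>n t \<omega>. - B n t \<omega>) (\<lambda>n. - x0 n) \<omega> (\<lambda>t n. - Y t n)"
proof -
  have neg: "- Y (J i \<omega>) n + (- B n t \<omega> - - B n (J i \<omega>) \<omega>) + - mu * (t - J i \<omega>) =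
      - (Y (J i \<omega>) n + (B n t \<omega> - B n (J i \<omega>) \<omega>) + mu * (t - J i \<omega>))" for i n t
    by (simp add: algebra_simps)
  show ?thesis
    unfolding bd_path_def Let_def neg abs_minus_cancel
  proof (intro conjI allI impI ballI)
    fix n assume "n \<in> {1..N}"
    then show "- Y 0 n = - x0 n" using bd_pathD(1)[OF assms] by simp
  next
    fix i t n assume "J i \<omega> \<le> t" "t < J (Suc i) \<omega>" "n \<in> {1..N}"
    then show "- Y t n = - (Y (J i \<omega>) n + (B n t \<omega> - B n (J i \<omega>) \<omega>) + mu * (t - J i \<omega>))"
      using bd_pathD(2)[OF assms] by simp
  next
    fix i
    let ?p = "\<lambda>n. Y (J i \<omega>) n + (B n (J (Suc i) \<omega>) \<omega> - B n (J i \<omega>) \<omega>) + mu * (J (Suc i) \<omega> - J i \<omega>)"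
    obtain m where m: "m \<in> {1..N}" "\<And>n. n \<in> {1..N} \<Longrightarrow> - \<bar>?p m\<bar> \<le> - \<bar>?p n\<bar>"
      "\<And>n. n \<in> {1..N} \<Longrightarrow> Y (J (Suc i) \<omega>) n = (if n = m then ?p (K (Suc i) \<omega>) else ?p n)"
      by (rule bd_path_jump[OF assms, of i]) blast
    show "\<exists>m\<in>{1..N}. (\<forall>n\<in>{1..N}. - \<bar>?p m\<bar> \<le> - \<bar>?p n\<bar>) \<and>
        (\<forall>n\<in>{1..N}. - Y (J (Suc i) \<omega>) n = (if n = m then - ?p (K (Suc i) \<omega>) else - ?p n))"
    proof (intro bexI[OF _ m(1)] conjI ballI)
      fix n assume n: "n \<in> {1..N}"
      show "- \<bar>?p m\<bar> \<le> - \<bar>?p n\<bar>" by (rule m(2)[OF n])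
      show "- Y (J (Suc i) \<omega>) n = (if n = m then - ?p (K (Suc i) \<omega>) else - ?p n)"
        unfolding m(3)[OF n] by (rule if_distrib)
    qed
  qed
qed

lemma rightmost_reflect:
  assumes "N > 0"
  shows "rightmost N (\<lambda>t n. - Y t n) t = - leftmost N Y t"
proof (rule antisym)
  obtain n where n: "n \<in> {1..N}" "rightmost N (\<lambda>t n. - Y t n) t = - Y t n" using rightmost_attained[OF assms] by blast
  show "rightmost N (\<lambda>t n. - Y t n) t \<le> - leftmost N Y t" unfolding n(2) using leftmost_le[OF n(1), of Y t] by simp
  obtain n where n: "n \<in> {1..N}" "leftmost N Y t = Y t n" using leftmost_attained[OF assms] by blast
  show "- leftmost N Y t \<le> rightmost N (\<lambda>t n. - Y t n) t"
    unfolding n(2) using le_rightmost[OF n(1), of "\<lambda>t n. - Y t n" t] by simp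
qed

theorem mainTheorem3:
  fixes M :: "'a measure" and N :: nat and mu v :: real
    and J :: "nat \<Rightarrow> 'a \<Rightarrow> real" and K :: "nat \<Rightarrow> 'a \<Rightarrow> nat"
    and B :: "nat \<Rightarrow> real \<Rightarrow> 'a \<Rightarrow> real" and x0 :: "nat \<Rightarrow> real"
    and Y :: "'a \<Rightarrow> real \<Rightarrow> nat \<Rightarrow> real"
  assumes "N \<ge> 2"
    and "bd_ingredients M N J K B"
    and "is_NBBM_speed M N v"
    and "\<bar>mu\<bar> > v"
    and "AE \<omega> in M. bd_path N (\<lambda>x. - \<bar>x\<bar>) mu J K B x0 \<omega> (Y \<omega>)"
  shows "AE \<omega> in M. ((\<lambda>t. leftmost N (Y \<omega>) t / t) \<longlongrightarrow> (1 - v / \<bar>mu\<bar>) * mu) at_top"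
proof -
  have N: "N > 0" using assms(1) by simp
  show ?thesis
  proof (cases "mu \<le> 0")
    case True
    then have v: "v + mu < 0" using assms(4) by simp
    note bee = bee_speed_leftward_drift[OF N assms(2,3) v assms(5)]
    \<comment> \<open>At \<open>mu = 0\<close> the hypothesis would say \<open>v < 0\<close>,
      against \<open>v \<ge> 0\<close>. This has to be settled before the division by
      \<open>\<bar>mu\<bar>\<close> can be simplified.\<close>
    have "mu \<noteq> 0" using bee(1) v by auto
    then have "(1 - v / \<bar>mu\<bar>) * mu = v + mu" using True by (simp add: field_simps)
    then show ?thesis using bee(2) by (auto elim: eventually_mono)
  next
    case False
    then have v: "v + - mu < 0" using assms(4) by simp
    have bd: "bd_ingredients M N J K (\<lambda>n t \<omega>. - B n t \<omega>)"
      using assms(2) reflected_ingredients unfolding bd_ingredients_iff by blast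
    have path: "AE \<omega> in M. bd_path N (\<lambda>x. - \<bar>x\<bar>) (- mu) J K (\<lambda>n t \<omega>. - B n t \<omega>) (\<lambda>n. - x0 n) \<omega> (\<lambda>t n. - Y \<omega> t n)"
      using assms(5) by eventually_elim (rule bd_path_reflect)
    have lim: "(1 - v / \<bar>mu\<bar>) * mu = - (v + - mu)" using False by (simp add: field_simps)
    \<comment> \<open>The reflected system drifts to the left, and its rightmost particle is the
      mirror image of the leftmost particle of \<open>Y\<close>.\<close>
    from bee_speed_leftward_drift(2)[OF N bd assms(3) v path] show ?thesis
    proof eventually_elim
      case (elim \<omega>)
      then have "((\<lambda>t. - (rightmost N (\<lambda>t n. - Y \<omega> t n) t / t)) \<longlongrightarrow> - (v + - mu)) at_top" by (intro tendsto_minus) blast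
      then show ?case unfolding lim rightmost_reflect[OF N] by simp
    qed
  qed
qed

end
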